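(* Let $G$ be a connected Lie group with Lie algebra $\mathfrak{g}$, and let $\rho:G\rightarrow GL(\mathcal{V})$ be a representation of $G$ in a finite dimensional real vector space $\mathcal{V}$. Suppose $\ker(\rho)$ is discrete in $G$. Let $f\in\mathbb{R}[\lambda]$ be a real polynomial without multiple roots in $\mathbb{C}$. Then (i) every connected component of the subset $$Z(\rho,f)=\{g\in G \mid f(\rho(g))=0\}$$ of $G$ is a closed embedded submanifold of $G$, and is a conjugacy class in $G$; (ii) every connected component of the subset $$\mathfrak{z}(d\rho,f)=\{X\in\mathfrak{g} \mid f(d\rho(X))=0\}$$ of $\mathfrak{g}$ is a closed embedded submanifold of $\mathfrak{g}$, and is an adjoint orbit in $\mathfrak{g}$.
   Context: Lie groups and Lie algebras are real and finite dimensional; a representation is a smooth homomorphism, and $d\rho:\mathfrak{g}\to\mathfrak{gl}(\mathcal{V})$ is its differential. "Without multiple roots in $\mathbb{C}$" means that $f$ is nonzero and coprime to its derivative $f'$. For a linear operator $A$ on $\mathcal{V}$, $f(A)$ is the polynomial evaluated at $A$ in $\mathrm{End}(\mathcal{V})$. An adjoint orbit in $\mathfrak{g}$ is an orbit of the adjoint action of $G$ on $\mathfrak{g}$. *)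

theory Defs
  imports
    "HOL-Analysis.Analysis"
    "HOL-Algebra.Group_Action"
    "HOL-Computational_Algebra.Polynomial"
begin

section \<open>Smooth functions on subsets of Euclidean spaces\<close>

text \<open>\<open>Ck_on n S f\<close> is meant for open \<open>S\<close>: all iterated directional derivatives of
  \<open>f\<close> up to order \<open>n\<close> exist and are continuous on \<open>S\<close>.\<close>

primrec Ck_on :: "nat \<Rightarrow> 'e::real_normed_vector set \<Rightarrow> ('e \<Rightarrow> 'b::real_normed_vector) \<Rightarrow> bool" where
  "Ck_on 0 S f \<longleftrightarrow> continuous_on S f"
| "Ck_on (Suc n) S f \<longleftrightarrow>
     (\<forall>x\<in>S. f differentiable (at x)) \<and> (\<forall>v. Ck_on n S (\<lambda>x. frechet_derivative f (at x) v))"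

text \<open>Smoothness on an arbitrary set means local extendability to smooth functions on open sets.
  It is used below for relatively open subsets of a linear subspace, where it agrees with
  smoothness in linear coordinates of that subspace.\<close>

definition smooth_on :: "'e::real_normed_vector set \<Rightarrow> ('e \<Rightarrow> 'b::real_normed_vector) \<Rightarrow> bool" where
  "smooth_on S f \<longleftrightarrow>
     (\<forall>x\<in>S. \<exists>Q h. open Q \<and> x \<in> Q \<and> (\<forall>n. Ck_on n Q h) \<and> (\<forall>y\<in>S \<inter> Q. h y = f y))"


section \<open>Smooth manifolds\<close>

text \<open>A manifold is given by a topology, an atlas, and the vector space in which charts take their
  values. The latter is a linear subspace of a Euclidean space type rather than a whole type,
  because every type of class \<^class>\<open>euclidean_space\<close> has positive dimension and dimension 0 must
  not be excluded.\<close>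

record ('a, 'e) manifold =
  mtop :: "'a topology"
  atlas :: "('a set \<times> ('a \<Rightarrow> 'e)) set"
  model :: "'e set"

definition local_chart :: "('a, 'e::euclidean_space) manifold \<Rightarrow> 'a set \<Rightarrow> ('a \<Rightarrow> 'e) \<Rightarrow> bool" where
  "local_chart M U \<phi> \<longleftrightarrow>
     openin (mtop M) U \<and> openin (top_of_set (model M)) (\<phi> ` U) \<and>
     homeomorphic_map (subtopology (mtop M) U) (top_of_set (\<phi> ` U)) \<phi>"

definition chart_compat :: "'a set \<times> ('a \<Rightarrow> 'e::euclidean_space) \<Rightarrow> 'a set \<times> ('a \<Rightarrow> 'e) \<Rightarrow> bool" where
  "chart_compat c d \<longleftrightarrow>
     (case c of (U, \<phi>) \<Rightarrow> case d of (V, \<psi>) \<Rightarrow>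
        smooth_on (\<phi> ` (U \<inter> V)) (\<psi> \<circ> inv_into U \<phi>) \<and>
        smooth_on (\<psi> ` (U \<inter> V)) (\<phi> \<circ> inv_into V \<psi>))"

definition smooth_manifold :: "('a, 'e::euclidean_space) manifold \<Rightarrow> bool" where
  "smooth_manifold M \<longleftrightarrow>
     subspace (model M) \<and>
     Hausdorff_space (mtop M) \<and> second_countable (mtop M) \<and>
     (\<forall>(U, \<phi>)\<in>atlas M. local_chart M U \<phi>) \<and>
     (\<Union>(U, \<phi>)\<in>atlas M. U) = topspace (mtop M) \<and>
     (\<forall>c\<in>atlas M. \<forall>d\<in>atlas M. chart_compat c d)"

definition max_atlas :: "('a, 'e::euclidean_space) manifold \<Rightarrow> ('a set \<times> ('a \<Rightarrow> 'e)) set" where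
  "max_atlas M = {(U, \<phi>). local_chart M U \<phi> \<and> (\<forall>d\<in>atlas M. chart_compat (U, \<phi>) d)}"

definition prod_manifold ::
  "('a, 'e::euclidean_space) manifold \<Rightarrow> ('b, 'f::euclidean_space) manifold
    \<Rightarrow> ('a \<times> 'b, 'e \<times> 'f) manifold" where
  "prod_manifold M N =
     \<lparr>mtop = prod_topology (mtop M) (mtop N),
      atlas = {(U \<times> V, map_prod \<phi> \<psi>) | U \<phi> V \<psi>. (U, \<phi>) \<in> atlas M \<and> (V, \<psi>) \<in> atlas N},
      model = model M \<times> model N\<rparr>"

definition smooth_map ::
  "('a, 'e::euclidean_space) manifold \<Rightarrow> ('b, 'f::euclidean_space) manifold \<Rightarrow> ('a \<Rightarrow> 'b) \<Rightarrow> bool" where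
  "smooth_map M N F \<longleftrightarrow>
     continuous_map (mtop M) (mtop N) F \<and>
     (\<forall>(U, \<phi>)\<in>atlas M. \<forall>(V, \<psi>)\<in>atlas N.
        smooth_on (\<phi> ` (U \<inter> F -` V)) (\<psi> \<circ> F \<circ> inv_into U \<phi>))"

text \<open>The values of \<open>f\<close> outside the manifold are irrelevant.\<close>

definition smooth_fun :: "('a, 'e::euclidean_space) manifold \<Rightarrow> ('a \<Rightarrow> 'b::real_normed_vector) \<Rightarrow> bool" where
  "smooth_fun M f \<longleftrightarrow> (\<forall>(U, \<phi>)\<in>atlas M. smooth_on (\<phi> ` U) (f \<circ> inv_into U \<phi>))"

text \<open>The local slice condition for subsets, with respect to charts of the maximal atlas.\<close>

definition embedded_submanifold :: "('a, 'e::euclidean_space) manifold \<Rightarrow> 'a set \<Rightarrow> bool" where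
  "embedded_submanifold M S \<longleftrightarrow>
     S \<subseteq> topspace (mtop M) \<and>
     (\<exists>k. \<forall>p\<in>S. \<exists>U \<phi> L. (U, \<phi>) \<in> max_atlas M \<and> p \<in> U \<and>
        subspace L \<and> L \<subseteq> model M \<and> dim L = k \<and> \<phi> ` (U \<inter> S) = \<phi> ` U \<inter> L)"


section \<open>Tangent spaces\<close>

text \<open>Tangent vectors are derivations at \<open>p\<close> of the algebra of smooth real functions. Totalising
  them by 0 on non-smooth functions makes equality of tangent vectors equality of functions.
  No extensionality of the test functions is needed: if \<open>h\<close> vanishes on the manifold then
  \<open>h = h * \<chi>\<close> with \<open>\<chi>\<close> the indicator of its complement, so the Leibniz rule gives \<open>X h = 0\<close>.\<close>

definition tangent_space ::
  "('a, 'e::euclidean_space) manifold \<Rightarrow> 'a \<Rightarrow> (('a \<Rightarrow> real) \<Rightarrow> real) set" where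
  "tangent_space M p = {X.
     (\<forall>f. \<not> smooth_fun M f \<longrightarrow> X f = 0) \<and>
     (\<forall>f g. smooth_fun M f \<longrightarrow> smooth_fun M g \<longrightarrow> X (\<lambda>x. f x + g x) = X f + X g) \<and>
     (\<forall>c f. smooth_fun M f \<longrightarrow> X (\<lambda>x. c * f x) = c * X f) \<and>
     (\<forall>f g. smooth_fun M f \<longrightarrow> smooth_fun M g \<longrightarrow>
        X (\<lambda>x. f x * g x) = f p * X g + g p * X f)}"

definition pushforward ::
  "('b, 'f::euclidean_space) manifold \<Rightarrow> ('a \<Rightarrow> 'b) \<Rightarrow> (('a \<Rightarrow> real) \<Rightarrow> real) \<Rightarrow> (('b \<Rightarrow> real) \<Rightarrow> real)" where
  "pushforward N F X = (\<lambda>f. if smooth_fun N f then X (f \<circ> F) else 0)"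


section \<open>Lie groups, Lie algebras and the adjoint action\<close>

definition lie_group :: "('a, 'm) monoid_scheme \<Rightarrow> ('a, 'e::euclidean_space) manifold \<Rightarrow> bool" where
  "lie_group G M \<longleftrightarrow>
     group G \<and> smooth_manifold M \<and> topspace (mtop M) = carrier G \<and>
     smooth_map (prod_manifold M M) M (\<lambda>(g, h). g \<otimes>\<^bsub>G\<^esub> h) \<and>
     smooth_map M M (\<lambda>g. inv\<^bsub>G\<^esub> g)"

definition lie_algebra ::
  "('a, 'm) monoid_scheme \<Rightarrow> ('a, 'e::euclidean_space) manifold \<Rightarrow> (('a \<Rightarrow> real) \<Rightarrow> real) set" where
  "lie_algebra G M = tangent_space M \<one>\<^bsub>G\<^esub>"

text \<open>The Lie algebra is a vector space under the pointwise operations. Its manifold structure is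
  the standard one of a finite-dimensional real vector space: the charts are the linear
  isomorphisms onto the model space, and the topology is that of pointwise convergence (the product
  topology on functions), a Hausdorff vector space topology and hence the canonical one in finite
  dimension.\<close>

definition lie_algebra_manifold ::
  "('a, 'm) monoid_scheme \<Rightarrow> ('a, 'e::euclidean_space) manifold
    \<Rightarrow> ((('a \<Rightarrow> real) \<Rightarrow> real), 'e) manifold" where
  "lie_algebra_manifold G M =
     \<lparr>mtop = top_of_set (lie_algebra G M),
      atlas = {(lie_algebra G M, L) | L. bij_betw L (lie_algebra G M) (model M) \<and>
         (\<forall>X\<in>lie_algebra G M. \<forall>Y\<in>lie_algebra G M. \<forall>a b.
            L (\<lambda>f. a * X f + b * Y f) = a *\<^sub>R L X + b *\<^sub>R L Y)},
      model = model M\<rparr>"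

definition conj_map :: "('a, 'm) monoid_scheme \<Rightarrow> 'a \<Rightarrow> 'a \<Rightarrow> 'a" where
  "conj_map G g = (\<lambda>h. g \<otimes>\<^bsub>G\<^esub> h \<otimes>\<^bsub>G\<^esub> inv\<^bsub>G\<^esub> g)"

definition Ad ::
  "('a, 'm) monoid_scheme \<Rightarrow> ('a, 'e::euclidean_space) manifold \<Rightarrow> 'a
    \<Rightarrow> (('a \<Rightarrow> real) \<Rightarrow> real) \<Rightarrow> (('a \<Rightarrow> real) \<Rightarrow> real)" where
  "Ad G M g = pushforward M (conj_map G g)"

definition conjugacy_classes :: "('a, 'm) monoid_scheme \<Rightarrow> 'a set set" where
  "conjugacy_classes G = orbits G (carrier G) (conj_map G)"

definition adjoint_orbits ::
  "('a, 'm) monoid_scheme \<Rightarrow> ('a, 'e::euclidean_space) manifold \<Rightarrow> (('a \<Rightarrow> real) \<Rightarrow> real) set set" where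
  "adjoint_orbits G M = orbits G (lie_algebra G M) (Ad G M)"


section \<open>Representations\<close>

text \<open>The representation space is a type \<open>'v\<close> of class \<^class>\<open>real_normed_vector\<close> that is assumed
  finite-dimensional (possibly of dimension 0). Every finite-dimensional real vector space carries a
  norm, the choice is immaterial, and all linear operators are bounded, so \<open>End(V)\<close> is
  \<open>'v \<Rightarrow>\<^sub>L 'v\<close>.\<close>

definition GL :: "('v::real_normed_vector \<Rightarrow>\<^sub>L 'v) monoid" where
  "GL = \<lparr>carrier = {A. \<exists>B. A o\<^sub>L B = id_blinfun \<and> B o\<^sub>L A = id_blinfun},
         mult = (o\<^sub>L), one = id_blinfun\<rparr>"

text \<open>\<open>GL(V)\<close> is an open subset of the vector space \<open>End(V)\<close>, so smoothness into \<open>GL(V)\<close> is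
  smoothness into \<open>End(V)\<close>.\<close>

definition lie_representation ::
  "('a, 'm) monoid_scheme \<Rightarrow> ('a, 'e::euclidean_space) manifold
    \<Rightarrow> ('a \<Rightarrow> ('v::real_normed_vector \<Rightarrow>\<^sub>L 'v)) \<Rightarrow> bool" where
  "lie_representation G M \<rho> \<longleftrightarrow> \<rho> \<in> hom G GL \<and> smooth_fun M \<rho>"

text \<open>The differential at the identity, with the tangent space of \<open>GL(V)\<close> at the identity identified
  with \<open>End(V)\<close>: \<open>d\<rho>(X)\<close> is the operator \<open>A\<close> on which each linear functional \<open>\<Lambda>\<close> of
  \<open>End(V)\<close> takes the value \<open>X(\<Lambda> \<circ> \<rho>)\<close>.\<close>

definition rep_differential ::
  "('a \<Rightarrow> ('v::real_normed_vector \<Rightarrow>\<^sub>L 'v)) \<Rightarrow> (('a \<Rightarrow> real) \<Rightarrow> real) \<Rightarrow> ('v \<Rightarrow>\<^sub>L 'v)" where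
  "rep_differential \<rho> X =
     (THE A. \<forall>\<Lambda> :: ('v \<Rightarrow>\<^sub>L 'v) \<Rightarrow> real. bounded_linear \<Lambda> \<longrightarrow> \<Lambda> A = X (\<Lambda> \<circ> \<rho>))"

definition poly_op :: "real poly \<Rightarrow> ('v::real_normed_vector \<Rightarrow>\<^sub>L 'v) \<Rightarrow> ('v \<Rightarrow>\<^sub>L 'v)" where
  "poly_op f A = (\<Sum>i\<le>degree f. coeff f i *\<^sub>R (((o\<^sub>L) A ^^ i) id_blinfun))"

definition Z_group ::
  "('a, 'm) monoid_scheme \<Rightarrow> ('a \<Rightarrow> ('v::real_normed_vector \<Rightarrow>\<^sub>L 'v)) \<Rightarrow> real poly \<Rightarrow> 'a set" where
  "Z_group G \<rho> f = {g \<in> carrier G. poly_op f (\<rho> g) = 0}"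

definition z_algebra ::
  "('a, 'm) monoid_scheme \<Rightarrow> ('a, 'e::euclidean_space) manifold
    \<Rightarrow> ('a \<Rightarrow> ('v::real_normed_vector \<Rightarrow>\<^sub>L 'v)) \<Rightarrow> real poly \<Rightarrow> (('a \<Rightarrow> real) \<Rightarrow> real) set" where
  "z_algebra G M \<rho> f = {X \<in> lie_algebra G M. poly_op f (rep_differential \<rho> X) = 0}"

end

theory Submission
  imports Defs
    "HOL-Computational_Algebra.Field_as_Ring"
    "HOL-Computational_Algebra.Polynomial_Factorial"
begin

text \<open>Write \<open>A = \<rho> p\<close> for a point \<open>p\<close> with \<open>f A = 0\<close>. Since \<open>f\<close> and \<open>f'\<close> are coprime,
  \<open>f' A\<close> is invertible by Bezout. This fact is used twice.

  First, if \<open>D = [B, A]\<close> commutes with \<open>A\<close>, then \<open>0 = [B, f A] = f' A D\<close>, so \<open>D = 0\<close>. Applied to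
  operators \<open>B\<close> in the image of the differential of \<open>\<rho>\<close>, it says that the directions at \<open>p\<close>
  that commute with \<open>A\<close> form a complement of the tangent space of the orbit of \<open>p\<close>. By the
  inverse function theorem every point near \<open>p\<close> is therefore conjugate, by an element near the
  identity, to a point \<open>x\<close> of a slice through \<open>p\<close> in these directions. Secondly, the derivative
  of \<open>f\<close> at \<open>A\<close> in a direction that commutes with \<open>A\<close> is multiplication by \<open>f' A\<close>, which is
  injective; so \<open>x = p\<close> is the only zero on the slice. Hence near \<open>p\<close> the zero set is the orbit
  of \<open>p\<close> and it is flat in the slice coordinates (theorem \<open>slice\<close>). The orbits of a connected
  group are connected, so they are the components of the zero set, and a slice chart at one
  point is carried along the orbit by the group (theorem \<open>components_are_orbits\<close>).

  The argument needs \<open>\<rho>\<close> to be an immersion. This is where discreteness of the kernel enters: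
  by translation \<open>\<rho>\<close> has constant rank, so a vector killed by the differential would be tangent to
  a curve in the kernel (theorem \<open>T_injective\<close>).

  Conjugation on the group and the adjoint action on the Lie algebra are two instances of the
  same argument, with \<open>\<rho>\<close> and its differential as equivariant maps to the operators. For the
  second one the Lie algebra, whose elements are derivations, has to be identified with the model
  space: Hadamard's lemma and bump functions show that the derivations are exactly the
  directional derivatives (theorem \<open>coordinate_system_exists\<close>).\<close>

section \<open>Calculus of smooth functions\<close>

lemma frechet_derivative_eqI:
  "(f has_derivative D) (at x) \<Longrightarrow> frechet_derivative f (at x) = D"
  using frechet_derivative_at by metis

lemma differentiable_has_frechet:
  "f differentiable (at x) \<Longrightarrow> (f has_derivative frechet_derivative f (at x)) (at x)"
  by (simp add: frechet_derivative_works)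

lemma Ck_on_cong:
  assumes "open S" "\<And>x. x \<in> S \<Longrightarrow> f x = g x"
  shows "Ck_on n S f \<longleftrightarrow> Ck_on n S g"
  using assms(2)
proof (induction n arbitrary: f g)
  case 0
  then show ?case by (simp cong: continuous_on_cong)
next
  case (Suc n)
  have *: "(f has_derivative D) (at x) \<longleftrightarrow> (g has_derivative D) (at x)" if "x \<in> S" for x D
    using has_derivative_transform_within_open[OF _ \<open>open S\<close> that] Suc.prems by metis
  then have d: "f differentiable (at x) \<longleftrightarrow> g differentiable (at x)" if "x \<in> S" for x
    using that by (simp add: differentiable_def)
  have "frechet_derivative f (at x) = frechet_derivative g (at x)" if "x \<in> S" for x
    using * that by (simp add: frechet_derivative_def)
  then have "Ck_on n S (\<lambda>x. frechet_derivative f (at x) v) \<longleftrightarrow>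
        Ck_on n S (\<lambda>x. frechet_derivative g (at x) v)" for v
    by (intro Suc.IH) simp
  then show ?case using d by simp
qed

lemma Ck_on_subset: "Ck_on n S f \<Longrightarrow> T \<subseteq> S \<Longrightarrow> Ck_on n T f"
  by (induction n arbitrary: f) (auto intro: continuous_on_subset)

lemma Ck_on_SucI:
  assumes "open S" "\<And>x. x \<in> S \<Longrightarrow> (f has_derivative f' x) (at x)"
    "\<And>v. Ck_on n S (\<lambda>x. f' x v)"
  shows "Ck_on (Suc n) S f"
proof -
  have "Ck_on n S (\<lambda>x. frechet_derivative f (at x) v)" for v
    by (subst Ck_on_cong[OF \<open>open S\<close>, where g = "\<lambda>x. f' x v"])
       (simp_all add: assms(3) frechet_derivative_eqI[OF assms(2)])
  then show ?thesis using assms(2) by (auto simp: differentiable_def)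
qed

lemma Ck_on_SucD: "Ck_on (Suc n) S f \<Longrightarrow> Ck_on n S f"
proof (induction n arbitrary: f)
  case 0
  then show ?case
    by (auto intro!: continuous_at_imp_continuous_on differentiable_imp_continuous_within)
qed (metis Ck_on.simps(2))

lemma Ck_on_imp_continuous: "Ck_on n S f \<Longrightarrow> continuous_on S f"
  by (induction n) (use Ck_on_SucD in auto)

lemma Ck_on_const: "Ck_on n S (\<lambda>x. c)"
  by (induction n arbitrary: c) auto

lemma Ck_on_bounded_linear:
  assumes "bounded_linear h" shows "Ck_on n S h"
proof (cases n)
  case 0 then show ?thesis
    using assms by (simp add: linear_continuous_on)
next
  case (Suc k)
  have "frechet_derivative h (at x) = h" for x
    by (rule frechet_derivative_eqI) (simp add: assms bounded_linear_imp_has_derivative)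
  then show ?thesis
    using assms Suc by (simp add: Ck_on_const bounded_linear_imp_differentiable)
qed

lemma Ck_on_add:
  assumes "open S" "Ck_on n S f" "Ck_on n S g"
  shows "Ck_on n S (\<lambda>x. f x + g x)"
  using assms(2,3)
proof (induction n arbitrary: f g)
  case 0 then show ?case by (simp add: continuous_on_add)
next
  case (Suc n)
  show ?case
    by (rule Ck_on_SucI[OF \<open>open S\<close>,
          where f' = "\<lambda>x v. frechet_derivative f (at x) v + frechet_derivative g (at x) v"])
       (use Suc in \<open>auto intro!: has_derivative_add differentiable_has_frechet\<close>)
qed

lemma Ck_on_sum:
  assumes "open S" "\<And>i. i \<in> I \<Longrightarrow> Ck_on n S (f i)"
  shows "Ck_on n S (\<lambda>x. \<Sum>i\<in>I. f i x)"
  using assms(2)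
proof (induction I rule: infinite_finite_induct)
  case (insert i I)
  have eq: "(\<lambda>x. \<Sum>i\<in>insert i I. f i x) = (\<lambda>x. f i x + (\<Sum>i\<in>I. f i x))"
    using insert by auto
  show ?case unfolding eq by (rule Ck_on_add[OF \<open>open S\<close>]) (use insert in auto)
qed (auto simp: Ck_on_const)

lemma Ck_on_bilinear:
  assumes "bounded_bilinear p" "open S" "Ck_on n S f" "Ck_on n S g"
  shows "Ck_on n S (\<lambda>x. p (f x) (g x))"
  using assms(3,4)
proof (induction n arbitrary: f g)
  case 0 then show ?case by (simp add: bounded_bilinear.continuous_on[OF assms(1)])
next
  case (Suc n)
  note C = Suc.prems[THEN Ck_on_SucD]
  show ?case
    by (rule Ck_on_SucI[OF \<open>open S\<close>, where
          f' = "\<lambda>x v. p (f x) (frechet_derivative g (at x) v) + p (frechet_derivative f (at x) v) (g x)"])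
       (use Suc C in \<open>auto intro!: bounded_bilinear.FDERIV[OF assms(1)] differentiable_has_frechet
          Ck_on_add \<open>open S\<close>\<close>)
qed

lemma Ck_on_linear_compose:
  assumes "bounded_linear h" "open S" "Ck_on n S f"
  shows "Ck_on n S (\<lambda>x. h (f x))"
  using assms(3)
proof (induction n arbitrary: f)
  case 0 then show ?case by (simp add: bounded_linear.continuous_on[OF assms(1)])
next
  case (Suc n)
  show ?case
    by (rule Ck_on_SucI[OF \<open>open S\<close>, where f' = "\<lambda>x v. h (frechet_derivative f (at x) v)"])
       (use Suc in \<open>auto intro!: bounded_linear.has_derivative[OF assms(1)] differentiable_has_frechet\<close>)
qed

lemma Ck_on_compose:
  fixes f :: "'a::real_normed_vector \<Rightarrow> 'c::euclidean_space" and g :: "'c \<Rightarrow> 'b::real_normed_vector"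
  assumes "open S" "open T" "f ` S \<subseteq> T" "Ck_on n S f" "Ck_on n T g"
  shows "Ck_on n S (\<lambda>x. g (f x))"
  using assms(4,5)
proof (induction n arbitrary: g)
  case 0 then show ?case
    using assms(3) by (auto intro: continuous_on_compose2)
next
  case (Suc n)
  note C = Suc.prems[THEN Ck_on_SucD]
  let ?Df = "\<lambda>x. frechet_derivative f (at x)" and ?Dg = "\<lambda>x. frechet_derivative g (at x)"
  \<comment> \<open>The chain rule, written as a sum over the basis so that every factor has the form to which
    the induction hypothesis or bilinearity applies.\<close>
  have "((\<lambda>x. g (f x)) has_derivative (\<lambda>v. \<Sum>b\<in>Basis. (?Df x v \<bullet> b) *\<^sub>R ?Dg (f x) b)) (at x)"
    if "x \<in> S" for x
  proof -
    have 1: "(f has_derivative ?Df x) (at x)" and 2: "(g has_derivative ?Dg (f x)) (at (f x))"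
      using Suc.prems that assms(3) by (auto intro!: differentiable_has_frechet)
    have lin: "linear (?Dg (f x))"
      using 2 has_derivative_linear by blast
    have "((\<lambda>x. g (f x)) has_derivative (\<lambda>v. ?Dg (f x) (?Df x v))) (at x)"
      using has_derivative_compose[OF 1 2] .
    moreover have "(\<lambda>v. ?Dg (f x) (?Df x v)) = (\<lambda>v. \<Sum>b\<in>Basis. (?Df x v \<bullet> b) *\<^sub>R ?Dg (f x) b)"
    proof
      fix v
      let ?w = "?Df x v"
      have "?Dg (f x) ?w = ?Dg (f x) (\<Sum>b\<in>Basis. (?w \<bullet> b) *\<^sub>R b)"
        by (simp add: euclidean_representation)
      also have "\<dots> = (\<Sum>b\<in>Basis. (?w \<bullet> b) *\<^sub>R ?Dg (f x) b)"
        using lin by (simp add: linear_sum linear_scale)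
      finally show "?Dg (f x) ?w = (\<Sum>b\<in>Basis. (?w \<bullet> b) *\<^sub>R ?Dg (f x) b)" .
    qed
    ultimately show ?thesis by metis
  qed
  moreover have "Ck_on n S (\<lambda>x. \<Sum>b\<in>Basis. (?Df x v \<bullet> b) *\<^sub>R ?Dg (f x) b)" for v
    using Suc.prems C
    by (intro Ck_on_sum \<open>open S\<close> Ck_on_bilinear[OF bounded_bilinear_scaleR]
         Ck_on_linear_compose[OF bounded_linear_inner_left]
         Suc.IH[where g = "\<lambda>y. frechet_derivative g (at y) _"]) simp_all
  ultimately show ?case by (rule Ck_on_SucI[OF \<open>open S\<close>])
qed

lemma has_derivative_zero_comparison:
  assumes "(f has_derivative (\<lambda>_. 0)) (at x)" "f x = 0" "h x = 0"
    and "eventually (\<lambda>y. norm (h y) \<le> K * norm (f y)) (at x)"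
  shows "(h has_derivative (\<lambda>_. 0)) (at x)"
proof -
  have f: "((\<lambda>y. norm (f y) / norm (y - x)) \<longlongrightarrow> 0) (at x)"
    using assms(1,2) by (simp add: has_derivative_iff_norm)
  have "((\<lambda>y. norm (h y) / norm (y - x)) \<longlongrightarrow> 0) (at x)"
  proof (rule Lim_null_comparison)
    show "eventually (\<lambda>y. norm (norm (h y) / norm (y - x)) \<le> K * (norm (f y) / norm (y - x))) (at x)"
      using assms(4) by eventually_elim (auto simp: divide_right_mono)
    show "((\<lambda>y. K * (norm (f y) / norm (y - x))) \<longlongrightarrow> 0) (at x)"
      using tendsto_mult_right_zero[OF f] .
  qed
  then show ?thesis using assms(3) by (simp add: has_derivative_iff_norm)
qed

text \<open>With \<open>D = A y - A x\<close>, the inverses satisfy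
  \<open>J y - J x = - J x D J x + J y D J x D J x\<close>, and the last term is quadratic in \<open>D\<close>
  because \<open>J\<close> stays bounded near \<open>x\<close>.\<close>

lemma has_derivative_blinfun_inverse:
  fixes A J :: "'a::real_normed_vector \<Rightarrow> ('e::real_normed_vector \<Rightarrow>\<^sub>L 'e)"
  assumes "open S" "x \<in> S" and A: "(A has_derivative A') (at x)"
    and inv: "\<And>y. y \<in> S \<Longrightarrow> J y o\<^sub>L A y = id_blinfun" "\<And>y. y \<in> S \<Longrightarrow> A y o\<^sub>L J y = id_blinfun"
  shows "(J has_derivative (\<lambda>v. - (J x o\<^sub>L A' v o\<^sub>L J x))) (at x)"
proof -
  define D where "D y = A y - A x" for y
  define K where "K = 2 * norm (J x)"
  define r where "r y = D y o\<^sub>L (J x o\<^sub>L D y o\<^sub>L J x)" for y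
  have mult: "J y (A y v) = v" "A y (J y v) = v" if "y \<in> S" for y v
    using inv[OF that, THEN arg_cong[where f = "\<lambda>B. blinfun_apply B v"]] by auto
  have eq1: "J y = J x - (J y o\<^sub>L D y o\<^sub>L J x)" if "y \<in> S" for y
    by (rule blinfun_eqI) (simp add: D_def mult that \<open>x \<in> S\<close> blinfun.bilinear_simps)
  have eq2: "J y = J x - (J x o\<^sub>L D y o\<^sub>L J x) + (J y o\<^sub>L r y)" if "y \<in> S" for y
    by (rule blinfun_eqI) (simp add: D_def r_def mult that \<open>x \<in> S\<close> blinfun.bilinear_simps)
  have derD: "(D has_derivative A') (at x)"
    unfolding D_def using A by (auto intro!: derivative_eq_intros)
  have [simp]: "D x = 0" by (simp add: D_def)
  have bl: "bounded_linear (\<lambda>B. J x o\<^sub>L B o\<^sub>L J x)"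
    by (intro bounded_linear_compose[OF bounded_bilinear.bounded_linear_left[OF bounded_bilinear_blinfun_compose]]
       bounded_bilinear.bounded_linear_right[OF bounded_bilinear_blinfun_compose])
  have der2: "((\<lambda>y. J x o\<^sub>L D y o\<^sub>L J x) has_derivative (\<lambda>v. J x o\<^sub>L A' v o\<^sub>L J x)) (at x)"
    by (rule bounded_linear.has_derivative[OF bl derD])
  have derr: "(r has_derivative (\<lambda>_. 0)) (at x)"
  proof -
    have "(r has_derivative (\<lambda>v. (D x o\<^sub>L (J x o\<^sub>L A' v o\<^sub>L J x)) + (A' v o\<^sub>L (J x o\<^sub>L D x o\<^sub>L J x)))) (at x)"
      unfolding r_def by (rule bounded_bilinear.FDERIV[OF bounded_bilinear_blinfun_compose derD der2])
    then show ?thesis by simp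
  qed
  have bdd: "eventually (\<lambda>y. norm (J y o\<^sub>L r y) \<le> K * norm (r y)) (at x)"
  proof -
    have cont: "(D \<longlongrightarrow> 0) (at x)"
      using has_derivative_continuous[OF derD] by (simp add: continuous_within)
    have "eventually (\<lambda>y. norm (D y) < 1 / (2 * norm (J x) + 1)) (at x)"
      using tendsto_norm[OF cont] by (rule order_tendstoD) (simp add: add_nonneg_pos)
    moreover have "eventually (\<lambda>y. y \<in> S) (at x)"
      using \<open>open S\<close> \<open>x \<in> S\<close> by (simp add: eventually_at_in_open')
    ultimately show ?thesis
    proof eventually_elim
      case (elim y)
      have "norm (D y) * (2 * norm (J x) + 1) < 1"
        using elim(1) pos_less_divide_eq[of "2 * norm (J x) + 1" "norm (D y)" 1] by (simp add: add_nonneg_pos)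
      then have *: "2 * (norm (D y) * norm (J x)) \<le> 1"
        by (smt (verit) distrib_left mult.commute mult.left_commute mult_cancel_right1 norm_ge_zero)
      have "norm (J y) \<le> norm (J x) + norm (J y o\<^sub>L D y o\<^sub>L J x)"
        using eq1[OF elim(2)] norm_triangle_ineq4 by metis
      also have "norm (J y o\<^sub>L D y o\<^sub>L J x) \<le> norm (J y) * norm (D y) * norm (J x)"
        by (meson mult_right_mono norm_blinfun_compose norm_ge_zero order_trans)
      also have "\<dots> \<le> norm (J y) * (1/2)"
        using mult_left_mono[OF *, of "norm (J y)"] by (simp add: mult_ac)
      finally have "norm (J y) \<le> K" by (simp add: K_def)
      then show ?case
        by (meson mult_right_mono norm_blinfun_compose norm_ge_zero order_trans)
    qed
  qed
  have "((\<lambda>y. J y o\<^sub>L r y) has_derivative (\<lambda>_. 0)) (at x)"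
    by (rule has_derivative_zero_comparison[OF derr _ _ bdd]) (simp_all add: r_def)
  then have "((\<lambda>y. J x - (J x o\<^sub>L D y o\<^sub>L J x) + (J y o\<^sub>L r y)) has_derivative
      (\<lambda>v. 0 - (J x o\<^sub>L A' v o\<^sub>L J x) + 0)) (at x)"
    by (intro has_derivative_add has_derivative_diff der2 has_derivative_const)
  then have "(J has_derivative (\<lambda>v. 0 - (J x o\<^sub>L A' v o\<^sub>L J x) + 0)) (at x)"
    by (rule has_derivative_transform_within_open[OF _ \<open>open S\<close> \<open>x \<in> S\<close>]) (use eq2 in metis)
  then show ?thesis by simp
qed

text \<open>The derivative \<open>- J A' J\<close> of the inverse is bilinear in \<open>J\<close> and \<open>A'\<close>, so one more derivative
  of \<open>A\<close> gives one more derivative of \<open>J\<close>.\<close>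

lemma Ck_on_blinfun_inverse:
  fixes A J :: "'a::real_normed_vector \<Rightarrow> ('e::real_normed_vector \<Rightarrow>\<^sub>L 'e)"
  assumes "open S" "Ck_on (Suc n) S A"
    and inv: "\<And>y. y \<in> S \<Longrightarrow> J y o\<^sub>L A y = id_blinfun" "\<And>y. y \<in> S \<Longrightarrow> A y o\<^sub>L J y = id_blinfun"
  shows "Ck_on (Suc n) S J"
  using assms(2)
proof (induction n)
  case 0
  have d: "(J has_derivative (\<lambda>v. - (J x o\<^sub>L frechet_derivative A (at x) v o\<^sub>L J x))) (at x)" if "x \<in> S" for x
    using that 0 by (intro has_derivative_blinfun_inverse[OF \<open>open S\<close> _ _ inv] differentiable_has_frechet) auto
  then have c: "continuous_on S J"
    by (intro continuous_at_imp_continuous_on ballI) (metis has_derivative_continuous)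
  show ?case
  proof (rule Ck_on_SucI[OF \<open>open S\<close> d])
    show "Ck_on 0 S (\<lambda>x. - (J x o\<^sub>L frechet_derivative A (at x) v o\<^sub>L J x))" for v
      using 0 c by (auto intro!: continuous_intros bounded_bilinear.continuous_on[OF bounded_bilinear_blinfun_compose])
  qed
next
  case (Suc n)
  note IH = Suc.IH[OF Ck_on_SucD[OF Suc.prems]]
  have d: "(J has_derivative (\<lambda>v. - (J x o\<^sub>L frechet_derivative A (at x) v o\<^sub>L J x))) (at x)" if "x \<in> S" for x
    using that Suc.prems by (intro has_derivative_blinfun_inverse[OF \<open>open S\<close> _ _ inv] differentiable_has_frechet) auto
  show ?case
  proof (rule Ck_on_SucI[OF \<open>open S\<close> d])
    show "Ck_on (Suc n) S (\<lambda>x. - (J x o\<^sub>L frechet_derivative A (at x) v o\<^sub>L J x))" for v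
      by (intro Ck_on_linear_compose[OF bounded_linear_minus[OF bounded_linear_ident]]
          Ck_on_bilinear[OF bounded_bilinear_blinfun_compose] \<open>open S\<close> IH)
        (use Suc.prems in auto)
  qed
qed

lemma Ck_on_blinfunI:
  fixes F :: "'a::real_normed_vector \<Rightarrow> ('e::euclidean_space \<Rightarrow>\<^sub>L 'b::real_normed_vector)"
  assumes "open S" "\<And>b. b \<in> Basis \<Longrightarrow> Ck_on n S (\<lambda>x. F x b)"
  shows "Ck_on n S F"
proof -
  have "B = (\<Sum>b\<in>Basis. blinfun_scaleR_left (B b) o\<^sub>L blinfun_inner_left b)" for B :: "'e \<Rightarrow>\<^sub>L 'b"
  proof (rule blinfun_eqI)
    fix v
    have "blinfun_apply B v = blinfun_apply B (\<Sum>b\<in>Basis. (v \<bullet> b) *\<^sub>R b)" by (simp add: euclidean_representation)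
    also have "\<dots> = (\<Sum>b\<in>Basis. (v \<bullet> b) *\<^sub>R blinfun_apply B b)"
      by (simp add: blinfun.sum_right blinfun.scaleR_right)
    finally show "blinfun_apply B v = blinfun_apply (\<Sum>b\<in>Basis. blinfun_scaleR_left (B b) o\<^sub>L blinfun_inner_left b) v"
      by (simp add: blinfun.sum_left inner_commute)
  qed
  then have eq: "F = (\<lambda>x. \<Sum>b\<in>Basis. blinfun_scaleR_left (F x b) o\<^sub>L blinfun_inner_left b)" by blast
  have bl: "bounded_linear (\<lambda>w::'b. blinfun_scaleR_left w o\<^sub>L blinfun_inner_left b)" for b :: 'e
    by (intro bounded_linear_compose[OF bounded_bilinear.bounded_linear_left[OF bounded_bilinear_blinfun_compose]]
       bounded_linear_blinfun_scaleR_left)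
  have "Ck_on n S (\<lambda>x. \<Sum>b\<in>Basis. blinfun_scaleR_left (F x b) o\<^sub>L blinfun_inner_left b)"
    by (rule Ck_on_sum[OF \<open>open S\<close>]) (rule Ck_on_linear_compose[OF bl \<open>open S\<close> assms(2)])
  then show ?thesis by (simp only: flip: eq)
qed

definition Cinf :: "'e::real_normed_vector set \<Rightarrow> ('e \<Rightarrow> 'b::real_normed_vector) \<Rightarrow> bool" where
  "Cinf S f \<longleftrightarrow> (\<forall>n. Ck_on n S f)"

lemma Cinf_derivative: "Cinf S f \<Longrightarrow> Cinf S (\<lambda>x. frechet_derivative f (at x) v)"
  unfolding Cinf_def using Ck_on.simps(2) by blast

lemma Cinf_has_derivative:
  "Cinf S f \<Longrightarrow> x \<in> S \<Longrightarrow> (f has_derivative frechet_derivative f (at x)) (at x)"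
  unfolding Cinf_def using Ck_on.simps(2) differentiable_has_frechet by blast

lemma Cinf_continuous: "Cinf S f \<Longrightarrow> continuous_on S f"
  by (metis Ck_on_imp_continuous Cinf_def)

lemma Cinf_subset: "Cinf S f \<Longrightarrow> T \<subseteq> S \<Longrightarrow> Cinf T f"
  unfolding Cinf_def using Ck_on_subset by blast

lemma Cinf_const: "Cinf S (\<lambda>x. c)"
  and Cinf_bounded_linear: "bounded_linear h \<Longrightarrow> Cinf S h"
  and Cinf_add: "open S \<Longrightarrow> Cinf S f \<Longrightarrow> Cinf S g \<Longrightarrow> Cinf S (\<lambda>x. f x + g x)"
  and Cinf_bilinear: "bounded_bilinear p \<Longrightarrow> open S \<Longrightarrow> Cinf S f' \<Longrightarrow> Cinf S g' \<Longrightarrow>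
    Cinf S (\<lambda>x. p (f' x) (g' x))"
  and Cinf_linear_compose: "bounded_linear h' \<Longrightarrow> open S \<Longrightarrow> Cinf S f'' \<Longrightarrow> Cinf S (\<lambda>x. h' (f'' x))"
  unfolding Cinf_def
  by (auto simp: Ck_on_const Ck_on_bounded_linear Ck_on_add Ck_on_bilinear Ck_on_linear_compose)

lemma Cinf_compose:
  fixes f :: "'a::real_normed_vector \<Rightarrow> 'c::euclidean_space" and g :: "'c \<Rightarrow> 'b::real_normed_vector"
  shows "open S \<Longrightarrow> open T \<Longrightarrow> f ` S \<subseteq> T \<Longrightarrow> Cinf S f \<Longrightarrow> Cinf T g \<Longrightarrow> Cinf S (\<lambda>x. g (f x))"
  unfolding Cinf_def using Ck_on_compose by blast

lemma Cinf_Pair: "open S \<Longrightarrow> Cinf S f \<Longrightarrow> Cinf S g \<Longrightarrow> Cinf S (\<lambda>x. (f x, g x))"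
proof -
  assume "open S" "Cinf S f" "Cinf S g"
  moreover have "(\<lambda>x. (f x, g x)) = (\<lambda>x. (f x, 0) + (0, g x))" by auto
  ultimately show ?thesis
    by (simp only:) (intro Cinf_add Cinf_linear_compose[where h' = "\<lambda>x. (x, 0)"]
      Cinf_linear_compose[where h' = "\<lambda>x. (0, x)"], auto intro!: bounded_linear_Pair bounded_linear_zero bounded_linear_ident)
qed

text \<open>Once the derivative of the local inverse is \<open>inverse \<circ> dH \<circ> g\<close>, its regularity improves by
  one degree at each step, as inversion of operators preserves the order of differentiability.\<close>

theorem smooth_inverse_function:
  fixes H :: "'e::euclidean_space \<Rightarrow> 'e"
  assumes "open S" "Cinf S H" "x0 \<in> S" "(H has_derivative D) (at x0)" "\<And>v. D v = 0 \<Longrightarrow> v = 0"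
  obtains P Q g where "open P" "P \<subseteq> S" "x0 \<in> P" "open Q" "H x0 \<in> Q" "homeomorphism P Q H g" "Cinf Q g"
proof -
  define f' where "f' x = Blinfun (frechet_derivative H (at x))" for x
  have f'_app: "blinfun_apply (f' x) = frechet_derivative H (at x)" if "x \<in> S" for x
    unfolding f'_def using Cinf_has_derivative[OF assms(2) that]
    by (simp add: bounded_linear_Blinfun_apply has_derivative_bounded_linear)
  have der: "(H has_derivative blinfun_apply (f' x)) (at x)" if "x \<in> S" for x
    using Cinf_has_derivative[OF assms(2) that] f'_app[OF that] by simp
  have contv: "continuous_on S (\<lambda>x. f' x v)" for v
    using Cinf_continuous[OF Cinf_derivative[OF assms(2)]] f'_app by (simp cong: continuous_on_cong)
  have D: "D = blinfun_apply (f' x0)"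
    using has_derivative_unique assms(4) der \<open>x0 \<in> S\<close> by blast
  have linD: "linear D" using assms(4) has_derivative_linear by blast
  have "inj D" using linD assms(5) by (simp add: linear_injective_0)
  then obtain invf where "linear invf" "invf \<circ> D = id"
    using linD linear_injective_left_inverse by blast
  then have *: "Blinfun invf o\<^sub>L f' x0 = id_blinfun"
    by (intro blinfun_eqI) (auto simp: D linear_conv_bounded_linear bounded_linear_Blinfun_apply fun_eq_iff)
  obtain P Q g g' where g: "open P" "P \<subseteq> S" "x0 \<in> P" "open Q" "H x0 \<in> Q" "homeomorphism P Q H g"
    and dg: "\<And>y. y \<in> Q \<Longrightarrow> (g has_derivative g' y) (at y)"
      "\<And>y. y \<in> Q \<Longrightarrow> g' y = inv_into UNIV (blinfun_apply (f' (g y)))"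
      "\<And>y. y \<in> Q \<Longrightarrow> bij (blinfun_apply (f' (g y)))"
    using inverse_function_theorem[OF \<open>open S\<close> der continuous_on_blinfun_componentwise[OF contv] \<open>x0 \<in> S\<close> *]
    by metis
  have gP: "g ` Q \<subseteq> P" using g(6) by (auto simp: homeomorphism_def)
  have gc: "continuous_on Q g" using g(6) by (auto simp: homeomorphism_def)
  have blg: "bounded_linear (g' y)" if "y \<in> Q" for y using dg(1)[OF that] has_derivative_bounded_linear by blast
  define J where "J y = Blinfun (g' y)" for y
  have J: "blinfun_apply (J y) = g' y" if "y \<in> Q" for y
    using blg[OF that] by (simp add: J_def bounded_linear_Blinfun_apply)
  have inv: "J y o\<^sub>L f' (g y) = id_blinfun" "f' (g y) o\<^sub>L J y = id_blinfun" if "y \<in> Q" for y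
    using dg(2,3)[OF that] J[OF that]
    by (auto intro!: blinfun_eqI simp: bij_is_inj bij_is_surj inv_f_f surj_f_inv_f)
  have smooth': "Ck_on n S f'" for n
  proof (rule Ck_on_blinfunI[OF \<open>open S\<close>])
    show "Ck_on n S (\<lambda>x. f' x b)" for b
      using Cinf_derivative[OF assms(2), of b] f'_app Ck_on_cong[OF \<open>open S\<close>]
      unfolding Cinf_def by (metis (mono_tags, lifting))
  qed
  have comp: "Ck_on n Q (\<lambda>y. f' (g y))" if "Ck_on n Q g" for n
    by (rule Ck_on_compose[OF g(4) \<open>open S\<close> subset_trans[OF gP g(2)] that smooth'])
  have "Ck_on n Q g" for n
  proof (induction n)
    case 0 then show ?case using gc by simp
  next
    case (Suc n)
    have "Ck_on n Q J"
    proof (cases n)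
      case 0
      \<comment> \<open>So far \<open>f' \<circ> g\<close> is merely continuous. Composed with \<open>H\<close>, the inverse derivative \<open>J\<close> is the
        inverse of the differentiable map \<open>f'\<close>, hence continuous.\<close>
      have "Ck_on (Suc 0) P f'"
        using smooth' g(2) Ck_on_subset by blast
      then have "Ck_on (Suc 0) P (\<lambda>x. J (H x))"
      proof (rule Ck_on_blinfun_inverse[OF g(1)])
        fix x assume "x \<in> P"
        then have "g (H x) = x" "H x \<in> Q"
          using g(6) by (auto simp: homeomorphism_def)
        then show "J (H x) o\<^sub>L f' x = id_blinfun" "f' x o\<^sub>L J (H x) = id_blinfun"
          using inv[of "H x"] by simp_all
      qed
      then have "continuous_on P (\<lambda>x. J (H x))" by (rule Ck_on_imp_continuous)
      then have "continuous_on Q (\<lambda>y. J (H (g y)))"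
        using gc gP by (rule continuous_on_compose2)
      moreover have "H (g y) = y" if "y \<in> Q" for y using g(6) that by (auto simp: homeomorphism_def)
      ultimately have "continuous_on Q J" by (simp cong: continuous_on_cong)
      then show ?thesis using 0 by simp
    next
      case k: (Suc k)
      have "Ck_on (Suc k) Q J"
        by (rule Ck_on_blinfun_inverse[OF g(4) comp inv]) (use Suc.IH k in \<open>simp_all del: Ck_on.simps\<close>)
      then show ?thesis using k by simp
    qed
    then have "Ck_on n Q (\<lambda>y. J y v)" for v
      by (rule Ck_on_linear_compose[OF blinfun.bounded_linear_left g(4)])
    moreover have "Ck_on n Q (\<lambda>y. J y v) \<longleftrightarrow> Ck_on n Q (\<lambda>y. g' y v)" for v
      by (rule Ck_on_cong[OF g(4)]) (simp add: J)
    ultimately have "Ck_on n Q (\<lambda>y. g' y v)" for v by simp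
    show ?case by (rule Ck_on_SucI[OF g(4) dg(1)]) (assumption, fact)
  qed
  then show thesis using that g by (auto simp: Cinf_def)
qed

section \<open>Hadamard's lemma and bump functions\<close>

lemma segment_in_ball:
  fixes q :: "'e::real_normed_vector"
  assumes "x \<in> ball q r" "t \<in> cbox 0 (1::real)"
  shows "q + t *\<^sub>R (x - q) \<in> ball q r"
proof -
  have "\<bar>t\<bar> * norm (x - q) \<le> 1 * norm (x - q)"
    using assms(2) by (intro mult_right_mono) auto
  then show ?thesis using assms(1) by (simp add: dist_norm norm_minus_commute)
qed

lemma continuous_on_segment:
  fixes h :: "'e::real_normed_vector \<Rightarrow> real"
  assumes "continuous_on (ball q r) h"
  shows "continuous_on (ball q r \<times> cbox 0 1) (\<lambda>(x, t). t ^ j * h (q + t *\<^sub>R (x - q)))"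
proof -
  have "continuous_on (ball q r \<times> cbox 0 1) (\<lambda>p. h (q + snd p *\<^sub>R (fst p - q)))"
  proof (rule continuous_on_compose2[OF assms])
    show "continuous_on (ball q r \<times> cbox 0 1) (\<lambda>p. q + snd p *\<^sub>R (fst p - q))"
      by (intro continuous_intros)
    show "(\<lambda>p. q + snd p *\<^sub>R (fst p - q)) ` (ball q r \<times> cbox 0 1) \<subseteq> ball q r"
      using segment_in_ball by fastforce
  qed
  then show ?thesis unfolding split_def by (intro continuous_intros)
qed

text \<open>Differentiation under the integral sign turns an integral with weight \<open>t ^ j\<close> into one with
  weight \<open>t ^ Suc j\<close>; this is why the statement is about all weights at once.\<close>

lemma Ck_on_integral_segment:
  fixes h :: "'e::euclidean_space \<Rightarrow> real"
  assumes "Ck_on n (ball q r) h"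
  shows "Ck_on n (ball q r) (\<lambda>x. integral (cbox 0 1) (\<lambda>t. t ^ j * h (q + t *\<^sub>R (x - q))))"
  using assms
proof (induction n arbitrary: h j)
  case 0
  have "continuous_on (ball q r) h" using 0 by simp
  then have "continuous_on (ball q r \<times> cbox 0 1) (\<lambda>(x, t). t ^ j * h (q + t *\<^sub>R (x - q)))"
    by (rule continuous_on_segment)
  then have "continuous_on (ball q r) (\<lambda>x. integral (cbox 0 1) (\<lambda>t. t ^ j * h (q + t *\<^sub>R (x - q))))"
    by (rule integral_continuous_on_param)
  then show ?case by simp
next
  case (Suc n)
  have in_ball: "q + t *\<^sub>R (x - q) \<in> ball q r" if "x \<in> ball q r" "t \<in> cbox 0 1" for x t
    using segment_in_ball that by blast
  let ?D = "\<lambda>x. frechet_derivative h (at x)"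
  define F where "F x t = t ^ Suc j *\<^sub>R Blinfun (?D (q + t *\<^sub>R (x - q)))" for x t
  have hd: "(h has_derivative ?D x) (at x)" if "x \<in> ball q r" for x
    using Suc.prems that by (auto intro: differentiable_has_frechet)
  have F: "blinfun_apply (F x t) v = t ^ Suc j * ?D (q + t *\<^sub>R (x - q)) v"
    if "x \<in> ball q r" "t \<in> cbox 0 1" for x t v
    using has_derivative_bounded_linear[OF hd[OF in_ball[OF that]]]
    by (simp add: F_def bounded_linear_Blinfun_apply blinfun.scaleR_left)
  have contD: "continuous_on (ball q r) (\<lambda>x. ?D x v)" for v
    by (rule Ck_on_imp_continuous[of n]) (use Suc.prems in simp)
  have contDv: "continuous_on (ball q r \<times> cbox 0 1) (\<lambda>(x, t). t ^ Suc j * ?D (q + t *\<^sub>R (x - q)) v)" for v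
    by (rule continuous_on_segment[OF contD])
  have contF: "continuous_on (ball q r \<times> cbox 0 1) (\<lambda>(x, t). F x t)"
    by (rule continuous_on_blinfun_componentwise,
        rule continuous_on_eq[OF contDv]) (auto simp: F)
  have conth: "continuous_on (ball q r \<times> cbox 0 1) (\<lambda>(x, t). t ^ j * h (q + t *\<^sub>R (x - q)))"
    by (rule continuous_on_segment[OF Ck_on_imp_continuous[OF Suc.prems]])
  have der: "((\<lambda>x. integral (cbox 0 1) (\<lambda>t. t ^ j * h (q + t *\<^sub>R (x - q)))) has_derivative
       (\<lambda>v. integral (cbox 0 1) (\<lambda>t. t ^ Suc j * ?D (q + t *\<^sub>R (x - q)) v))) (at x)"
    if x: "x \<in> ball q r" for x
  proof -
    have "((\<lambda>x. integral (cbox 0 1) (\<lambda>t. t ^ j * h (q + t *\<^sub>R (x - q)))) has_derivative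
        blinfun_apply (integral (cbox 0 1) (F x))) (at x within ball q r)"
    proof (rule leibniz_rule[OF _ _ contF x convex_ball])
      fix x t assume xt: "x \<in> ball q r" "t \<in> cbox 0 (1::real)"
      have 1: "((\<lambda>x. q + t *\<^sub>R (x - q)) has_derivative (\<lambda>v. t *\<^sub>R v)) (at x within ball q r)"
        by (auto intro!: derivative_eq_intros)
      have "((\<lambda>x. t ^ j * h (q + t *\<^sub>R (x - q))) has_derivative
          (\<lambda>v. t ^ j * ?D (q + t *\<^sub>R (x - q)) (t *\<^sub>R v))) (at x within ball q r)"
        by (rule has_derivative_mult_right[OF has_derivative_compose[where g = h, OF 1 hd[OF in_ball[OF xt]]]])
      moreover have "blinfun_apply (F x t) = (\<lambda>v. t ^ j * ?D (q + t *\<^sub>R (x - q)) (t *\<^sub>R v))"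
        using has_derivative_linear[OF hd[OF in_ball[OF xt]]]
        by (auto simp: F[OF xt] linear_scale)
      ultimately show "((\<lambda>x. t ^ j * h (q + t *\<^sub>R (x - q))) has_derivative blinfun_apply (F x t))
          (at x within ball q r)" by simp
    next
      fix x assume x: "x \<in> ball q r"
      have "continuous_on (cbox 0 1) (\<lambda>t. case (x, t) of (x, t) \<Rightarrow> t ^ j * h (q + t *\<^sub>R (x - q)))"
        by (rule continuous_on_compose2[OF conth]) (use x in \<open>auto intro!: continuous_intros\<close>)
      then have "continuous_on (cbox 0 1) (\<lambda>t. t ^ j * h (q + t *\<^sub>R (x - q)))" by simp
      then show "(\<lambda>t. t ^ j * h (q + t *\<^sub>R (x - q))) integrable_on cbox 0 1"
        by (rule integrable_continuous)
    qed
    moreover have "blinfun_apply (integral (cbox 0 1) (F x)) =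
        (\<lambda>v. integral (cbox 0 1) (\<lambda>t. t ^ Suc j * ?D (q + t *\<^sub>R (x - q)) v))"
    proof
      fix v
      have "continuous_on (cbox 0 1) (\<lambda>t. case (x, t) of (x, t) \<Rightarrow> F x t)"
        by (rule continuous_on_compose2[OF contF]) (use x in \<open>auto intro!: continuous_intros\<close>)
      then have "continuous_on (cbox 0 1) (F x)" by simp
      then have int: "F x integrable_on cbox 0 1" by (rule integrable_continuous)
      have "blinfun_apply (integral (cbox 0 1) (F x)) v = integral (cbox 0 1) (\<lambda>t. F x t v)"
        using integral_linear[OF int blinfun.bounded_linear_left[of v]] unfolding o_def by (rule sym)
      also have "\<dots> = integral (cbox 0 1) (\<lambda>t. t ^ Suc j * ?D (q + t *\<^sub>R (x - q)) v)"
        by (rule integral_cong) (rule F[OF x])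
      finally show "blinfun_apply (integral (cbox 0 1) (F x)) v =
        integral (cbox 0 1) (\<lambda>t. t ^ Suc j * ?D (q + t *\<^sub>R (x - q)) v)" .
    qed
    ultimately show ?thesis
      using at_within_open[OF x open_ball] by simp
  qed
  show ?case
    by (rule Ck_on_SucI[OF open_ball der], assumption, rule Suc.IH) (use Suc.prems in simp)
qed

text \<open>The difference \<open>h x - h q\<close> is the integral of the derivative of \<open>h\<close> along the segment from \<open>q\<close>
  to \<open>x\<close>; the coefficients of the displacement in this integral are the functions \<open>H b\<close>.\<close>

theorem Hadamard:
  fixes h :: "'e::euclidean_space \<Rightarrow> real"
  assumes "Cinf (ball q r) h" "r > 0"
  obtains H where "\<And>b. Cinf (ball q r) (H b)" "\<And>b. H b q = frechet_derivative h (at q) b"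
    "\<And>x. x \<in> ball q r \<Longrightarrow> h x = h q + (\<Sum>b\<in>Basis. ((x - q) \<bullet> b) * H b x)"
proof -
  let ?D = "\<lambda>x. frechet_derivative h (at x)"
  define H where "H b x = integral (cbox 0 1) (\<lambda>t. t ^ 0 * ?D (q + t *\<^sub>R (x - q)) b)" for b x
  have 1: "Cinf (ball q r) (H b)" for b
    unfolding Cinf_def H_def
    by (intro allI Ck_on_integral_segment) (use Cinf_derivative[OF assms(1)] Cinf_def in blast)
  have 2: "H b q = frechet_derivative h (at q) b" for b
    by (simp add: H_def)
  have 3: "h x = h q + (\<Sum>b\<in>Basis. ((x - q) \<bullet> b) * H b x)" if x: "x \<in> ball q r" for x
  proof -
    have in_ball: "q + t *\<^sub>R (x - q) \<in> ball q r" if "t \<in> {0..1}" for t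
      using segment_in_ball x that by (auto simp: cbox_interval)
    have hd: "(h has_derivative ?D y) (at y)" if "y \<in> ball q r" for y
      using Cinf_has_derivative assms(1) that by blast
    have "((\<lambda>t. ?D (q + t *\<^sub>R (x - q)) (x - q)) has_integral
        h (q + 1 *\<^sub>R (x - q)) - h (q + 0 *\<^sub>R (x - q))) {0..1}"
    proof (rule fundamental_theorem_of_calculus)
      fix t :: real assume t: "t \<in> {0..1}"
      have "((\<lambda>t. q + t *\<^sub>R (x - q)) has_derivative (\<lambda>s. s *\<^sub>R (x - q))) (at t within {0..1})"
        by (auto intro!: derivative_eq_intros)
      then have "((\<lambda>t. h (q + t *\<^sub>R (x - q))) has_derivative (\<lambda>s. ?D (q + t *\<^sub>R (x - q)) (s *\<^sub>R (x - q))))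
          (at t within {0..1})"
        using has_derivative_compose[where g = h and f = "\<lambda>t. q + t *\<^sub>R (x - q)", OF _ hd[OF in_ball[OF t]]] by blast
      then show "((\<lambda>t. h (q + t *\<^sub>R (x - q))) has_vector_derivative ?D (q + t *\<^sub>R (x - q)) (x - q)) (at t within {0..1})"
        using has_derivative_linear[OF hd[OF in_ball[OF t]]]
        by (simp add: has_vector_derivative_def linear_scale)
    qed simp
    then have "h x - h q = integral {0..1} (\<lambda>t. ?D (q + t *\<^sub>R (x - q)) (x - q))"
      by (simp add: integral_unique)
    also have "\<dots> = integral {0..1} (\<lambda>t. \<Sum>b\<in>Basis. ((x - q) \<bullet> b) * ?D (q + t *\<^sub>R (x - q)) b)"
    proof (rule integral_cong)
      fix t :: real assume t: "t \<in> {0..1}"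
      have lin: "linear (?D (q + t *\<^sub>R (x - q)))"
        using has_derivative_linear[OF hd[OF in_ball[OF t]]] .
      have "?D (q + t *\<^sub>R (x - q)) (x - q) = ?D (q + t *\<^sub>R (x - q)) (\<Sum>b\<in>Basis. ((x - q) \<bullet> b) *\<^sub>R b)"
        by (simp only: euclidean_representation)
      also have "\<dots> = (\<Sum>b\<in>Basis. ((x - q) \<bullet> b) * ?D (q + t *\<^sub>R (x - q)) b)"
        using lin by (simp only: linear_sum linear_scale real_scaleR_def)
      finally show "?D (q + t *\<^sub>R (x - q)) (x - q) = (\<Sum>b\<in>Basis. ((x - q) \<bullet> b) * ?D (q + t *\<^sub>R (x - q)) b)" .
    qed
    also have "\<dots> = (\<Sum>b\<in>Basis. integral {0..1} (\<lambda>t. ((x - q) \<bullet> b) * ?D (q + t *\<^sub>R (x - q)) b))"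
    proof (rule integral_sum)
      fix b :: 'e assume "b \<in> Basis"
      have "continuous_on {0..1} (\<lambda>t. ?D (q + t *\<^sub>R (x - q)) b)"
        by (rule continuous_on_compose2[OF Cinf_continuous[OF Cinf_derivative[OF assms(1)]]])
           (use in_ball in \<open>auto intro!: continuous_intros\<close>)
      then have "continuous_on {0..1} (\<lambda>t. ((x - q) \<bullet> b) * ?D (q + t *\<^sub>R (x - q)) b)"
        by (rule continuous_on_mult_left)
      then show "(\<lambda>t. ((x - q) \<bullet> b) * ?D (q + t *\<^sub>R (x - q)) b) integrable_on {0..1}"
        by (rule integrable_continuous_interval)
    qed simp
    also have "\<dots> = (\<Sum>b\<in>Basis. ((x - q) \<bullet> b) * H b x)"
      by (simp add: H_def cbox_interval)
    finally show ?thesis by simp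
  qed
  show thesis using that[OF 1 2 3] .
qed

text \<open>The family \<open>exp (- 1 / t) / t ^ k\<close>, extended by 0, is closed under differentiation up to
  linear combinations.\<close>

definition flat_exp :: "nat \<Rightarrow> real \<Rightarrow> real" where
  "flat_exp k t = (if t > 0 then exp (- 1 / t) / t ^ k else 0)"

lemma flat_exp_derivative:
  "(flat_exp k has_real_derivative (flat_exp (k + 2) t - real k * flat_exp (k + 1) t)) (at t)"
proof -
  consider "t > 0" | "t < 0" | "t = 0" by linarith
  then show ?thesis
  proof cases
    case 1
    have "((\<lambda>t. exp (- 1 / t) / t ^ k) has_real_derivative
        (flat_exp (k + 2) t - real k * flat_exp (k + 1) t)) (at t)"
      using 1 by (cases k) (auto intro!: derivative_eq_intros simp: flat_exp_def field_simps power2_eq_square power_add, metis One_nat_def power_eq_if)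
    then show ?thesis
      by (rule has_field_derivative_transform_within_open[where S = "{0<..}"])
         (use 1 in \<open>auto simp: flat_exp_def\<close>)
  next
    case 2
    have "((\<lambda>t::real. 0) has_real_derivative (flat_exp (k + 2) t - real k * flat_exp (k + 1) t)) (at t)"
      using 2 by (simp add: flat_exp_def)
    then show ?thesis
      by (rule has_field_derivative_transform_within_open[where S = "{..<0}"])
         (use 2 in \<open>auto simp: flat_exp_def\<close>)
  next
    case 3
    have "((\<lambda>y::real. inverse y ^ Suc k / exp (inverse y)) \<longlongrightarrow> 0) (at_right 0)"
      by (rule filterlim_compose[OF tendsto_power_div_exp_0 filterlim_inverse_at_top_right])
    then have "((\<lambda>y. flat_exp k y / y) \<longlongrightarrow> 0) (at_right 0)"
      by (rule Lim_transform_eventually)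
         (auto simp: eventually_at_filter flat_exp_def exp_minus field_simps)
    moreover have "((\<lambda>y. flat_exp k y / y) \<longlongrightarrow> 0) (at_left 0)"
      by (rule Lim_transform_eventually[OF tendsto_const]) (auto simp: eventually_at_filter flat_exp_def)
    ultimately have "((\<lambda>y. flat_exp k y / y) \<longlongrightarrow> 0) (at 0)"
      by (simp add: filterlim_split_at)
    then show ?thesis using 3
      by (simp add: has_field_derivative_iff flat_exp_def)
  qed
qed

lemma Ck_on_flat_exp: "Ck_on n UNIV (flat_exp k)"
proof (induction n arbitrary: k)
  case 0
  have "isCont (flat_exp k) t" for t
    using flat_exp_derivative DERIV_isCont by blast
  then show ?case by (simp add: continuous_at_imp_continuous_on)
next
  case (Suc n)
  have 1: "Ck_on n UNIV (\<lambda>x. 1 * flat_exp (k + 2) x * v)" for v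
    by (rule Ck_on_linear_compose[OF _ _ Suc]) (auto intro: bounded_linear_intros)
  have 2: "Ck_on n UNIV (\<lambda>x. flat_exp (k + 1) x * (- real k * v))" for v
    by (rule Ck_on_linear_compose[OF _ _ Suc]) (rule bounded_linear_mult_left, simp)
  have eq: "(\<lambda>x. (flat_exp (k + 2) x - real k * flat_exp (k + 1) x) * v) =
      (\<lambda>x. 1 * flat_exp (k + 2) x * v + flat_exp (k + 1) x * (- real k * v))" for v
    by (auto simp: algebra_simps)
  show ?case
  proof (rule Ck_on_SucI[OF open_UNIV])
    show "(flat_exp k has_derivative (*) (flat_exp (k + 2) x - real k * flat_exp (k + 1) x)) (at x)" for x
      using flat_exp_derivative by (simp add: has_field_derivative_def)
    show "Ck_on n UNIV (\<lambda>x. (flat_exp (k + 2) x - real k * flat_exp (k + 1) x) * v)" for v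
      unfolding eq by (rule Ck_on_add[OF open_UNIV 1 2])
  qed
qed

lemma smooth_bump:
  fixes q :: "'e::euclidean_space"
  assumes "\<epsilon> > 0"
  obtains \<beta> :: "'e \<Rightarrow> real"
  where "Cinf UNIV \<beta>" "\<beta> q = 1" "\<And>x. \<epsilon> \<le> dist q x \<Longrightarrow> \<beta> x = 0"
proof -
  define c where "c = flat_exp 0 (\<epsilon>\<^sup>2)"
  have "c > 0" using assms by (simp add: c_def flat_exp_def)
  define \<beta> where "\<beta> x = inverse c * flat_exp 0 (\<epsilon>\<^sup>2 + - 1 * ((x + - q) \<bullet> (x + - q)))" for x :: 'e
  have "Cinf UNIV (\<lambda>x. x + - q)"
    by (rule Cinf_add[OF open_UNIV Cinf_bounded_linear[OF bounded_linear_ident] Cinf_const])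
  then have "Cinf UNIV (\<lambda>x. (x + - q) \<bullet> (x + - q))"
    by (rule Cinf_bilinear[OF bounded_bilinear_inner open_UNIV]) fact
  then have "Cinf UNIV (\<lambda>x. - 1 * ((x + - q) \<bullet> (x + - q)))"
    by (rule Cinf_linear_compose[OF bounded_linear_mult_right open_UNIV])
  then have "Cinf UNIV (\<lambda>x. \<epsilon>\<^sup>2 + - 1 * ((x + - q) \<bullet> (x + - q)))"
    by (rule Cinf_add[OF open_UNIV Cinf_const])
  then have "Cinf UNIV (\<lambda>x. flat_exp 0 (\<epsilon>\<^sup>2 + - 1 * ((x + - q) \<bullet> (x + - q))))"
    by (rule Cinf_compose[OF open_UNIV open_UNIV subset_UNIV]) (simp add: Cinf_def Ck_on_flat_exp)
  then have "Cinf UNIV \<beta>"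
    unfolding \<beta>_def by (rule Cinf_linear_compose[OF bounded_linear_mult_right open_UNIV])
  moreover have "\<beta> q = 1" using \<open>c > 0\<close> by (simp add: \<beta>_def c_def)
  moreover have "\<beta> x = 0" if "\<epsilon> \<le> dist q x" for x
  proof -
    have "\<epsilon>\<^sup>2 \<le> (dist q x)\<^sup>2" using that assms by (simp add: power_mono)
    also have "\<dots> = (x + - q) \<bullet> (x + - q)"
      by (simp add: dist_norm norm_minus_commute[of q x] flip: power2_norm_eq_inner)
    finally show ?thesis by (simp add: \<beta>_def flat_exp_def)
  qed
  ultimately show thesis using that by blast
qed

section \<open>Smooth maps on subsets of Euclidean spaces\<close>

lemma smooth_onI:
  assumes "\<And>x. x \<in> S \<Longrightarrow> \<exists>Q h. open Q \<and> x \<in> Q \<and> Cinf Q h \<and> (\<forall>y\<in>S \<inter> Q. h y = f y)"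
  shows "smooth_on S f"
  unfolding smooth_on_def
proof
  fix x assume "x \<in> S"
  then obtain Q h where "open Q" "x \<in> Q" "Cinf Q h" "\<forall>y\<in>S \<inter> Q. h y = f y"
    using assms by blast
  then show "\<exists>Q h. open Q \<and> x \<in> Q \<and> (\<forall>n. Ck_on n Q h) \<and> (\<forall>y\<in>S \<inter> Q. h y = f y)"
    unfolding Cinf_def by (intro exI[of _ Q] exI[of _ h]) simp
qed

lemma smooth_onE:
  assumes "smooth_on S f" "x \<in> S"
  obtains Q h where "open Q" "x \<in> Q" "Cinf Q h" "\<And>y. y \<in> S \<Longrightarrow> y \<in> Q \<Longrightarrow> h y = f y"
proof -
  obtain Q h where "open Q" "x \<in> Q" "\<forall>n. Ck_on n Q h" "\<forall>y\<in>S \<inter> Q. h y = f y"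
    using assms unfolding smooth_on_def by blast
  then show thesis using that[of Q h] by (simp add: Cinf_def)
qed

lemma Cinf_imp_smooth_on: "Cinf Q h \<Longrightarrow> open Q \<Longrightarrow> S \<subseteq> Q \<Longrightarrow> smooth_on S h"
  by (rule smooth_onI) blast

lemma smooth_on_subset:
  assumes "smooth_on S f" "T \<subseteq> S" shows "smooth_on T f"
proof (rule smooth_onI)
  fix x assume "x \<in> T"
  then have "x \<in> S" using assms(2) by blast
  then obtain Q h where "open Q" "x \<in> Q" "Cinf Q h" "\<And>y. y \<in> S \<Longrightarrow> y \<in> Q \<Longrightarrow> h y = f y"
    using smooth_onE[OF assms(1)] by metis
  then show "\<exists>Q h. open Q \<and> x \<in> Q \<and> Cinf Q h \<and> (\<forall>y\<in>T \<inter> Q. h y = f y)"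
    using assms(2) by (intro exI[of _ Q] exI[of _ h]) auto
qed

lemma smooth_on_cong: "(\<And>x. x \<in> S \<Longrightarrow> f x = g x) \<Longrightarrow> smooth_on S f \<longleftrightarrow> smooth_on S g"
  unfolding smooth_on_def by simp

lemma smooth_on_local:
  assumes "\<And>x. x \<in> S \<Longrightarrow> \<exists>Q. open Q \<and> x \<in> Q \<and> smooth_on (S \<inter> Q) f"
  shows "smooth_on S f"
proof (rule smooth_onI)
  fix x assume "x \<in> S"
  then obtain Q where Q: "open Q" "x \<in> Q" "smooth_on (S \<inter> Q) f" using assms by blast
  obtain R h where "open R" "x \<in> R" "Cinf R h" "\<And>y. y \<in> S \<inter> Q \<Longrightarrow> y \<in> R \<Longrightarrow> h y = f y"
    using smooth_onE[OF Q(3), of x] \<open>x \<in> S\<close> Q(2) by blast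
  then show "\<exists>Q h. open Q \<and> x \<in> Q \<and> Cinf Q h \<and> (\<forall>y\<in>S \<inter> Q. h y = f y)"
    using Q by (intro exI[of _ "Q \<inter> R"] exI[of _ h]) (auto intro: Cinf_subset)
qed

lemma smooth_on_imp_continuous_on:
  assumes "smooth_on S f" shows "continuous_on S f"
proof -
  have "continuous (at x within S) f" if x: "x \<in> S" for x
  proof -
    obtain Q h where Q: "open Q" "x \<in> Q" "Cinf Q h" "\<And>y. y \<in> S \<Longrightarrow> y \<in> Q \<Longrightarrow> h y = f y"
      using smooth_onE[OF assms x] by metis
    have "isCont h x" using Cinf_continuous[OF Q(3)] Q(1,2) continuous_on_eq_continuous_at by blast
    then have c: "continuous (at x within S) h" by (simp add: continuous_at_imp_continuous_at_within)
    obtain d where d: "d > 0" "ball x d \<subseteq> Q" using Q(1,2) open_contains_ball by blast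
    show ?thesis
      by (rule continuous_transform_within[OF c d(1) x]) (use Q(4) d(2) in \<open>auto simp: subset_iff dist_commute\<close>)
  qed
  then show ?thesis by (simp add: continuous_on_eq_continuous_within)
qed

lemma smooth_on_compose:
  fixes f :: "'a::real_normed_vector \<Rightarrow> 'c::euclidean_space" and g :: "'c \<Rightarrow> 'b::real_normed_vector"
  assumes "smooth_on S f" "smooth_on T g" "f ` S \<subseteq> T"
  shows "smooth_on S (\<lambda>x. g (f x))"
proof (rule smooth_onI)
  fix x assume "x \<in> S"
  obtain Q h where Q: "open Q" "x \<in> Q" "Cinf Q h" "\<And>y. y \<in> S \<Longrightarrow> y \<in> Q \<Longrightarrow> h y = f y"
    using smooth_onE[OF assms(1) \<open>x \<in> S\<close>] by metis
  have "f x \<in> T" using \<open>x \<in> S\<close> assms(3) by blast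
  then obtain R k where R: "open R" "f x \<in> R" "Cinf R k" "\<And>y. y \<in> T \<Longrightarrow> y \<in> R \<Longrightarrow> k y = g y"
    using smooth_onE[OF assms(2)] by metis
  define O' where "O' = Q \<inter> h -` R"
  have O': "open O'"
    unfolding O'_def using continuous_open_preimage[OF Cinf_continuous[OF Q(3)] Q(1) R(1)] .
  have "Cinf O' (\<lambda>y. k (h y))"
    by (rule Cinf_compose[OF O' R(1) _ Cinf_subset[OF Q(3)] R(3)]) (auto simp: O'_def)
  moreover have "x \<in> O'" using Q R \<open>x \<in> S\<close> by (auto simp: O'_def)
  moreover have "\<forall>y\<in>S \<inter> O'. k (h y) = g (f y)"
    using Q(4) R(4) assms(3) by (auto simp: O'_def)
  ultimately show "\<exists>Q h. open Q \<and> x \<in> Q \<and> Cinf Q h \<and> (\<forall>y\<in>S \<inter> Q. h y = g (f y))"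
    using O' by blast
qed

lemma smooth_on_combine:
  fixes S :: "'a::real_normed_vector set"
  assumes "smooth_on S f" "smooth_on S g"
    and p: "\<And>(Q :: 'a set) h k. open Q \<Longrightarrow> Cinf Q h \<Longrightarrow> Cinf Q k \<Longrightarrow> Cinf Q (\<lambda>x. p (h x) (k x))"
  shows "smooth_on S (\<lambda>x. p (f x) (g x))"
proof (rule smooth_onI)
  fix x assume "x \<in> S"
  obtain Q h where Q: "open Q" "x \<in> Q" "Cinf Q h" "\<And>y. y \<in> S \<Longrightarrow> y \<in> Q \<Longrightarrow> h y = f y"
    using smooth_onE[OF assms(1) \<open>x \<in> S\<close>] by metis
  obtain R k where R: "open R" "x \<in> R" "Cinf R k" "\<And>y. y \<in> S \<Longrightarrow> y \<in> R \<Longrightarrow> k y = g y"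
    using smooth_onE[OF assms(2) \<open>x \<in> S\<close>] by metis
  have "Cinf (Q \<inter> R) (\<lambda>x. p (h x) (k x))"
    by (intro p[OF open_Int[OF Q(1) R(1)]]) (use Cinf_subset[OF Q(3)] Cinf_subset[OF R(3)] in auto)
  then show "\<exists>Q h. open Q \<and> x \<in> Q \<and> Cinf Q h \<and> (\<forall>y\<in>S \<inter> Q. h y = p (f y) (g y))"
    using Q R by (intro exI[of _ "Q \<inter> R"] exI[of _ "\<lambda>x. p (h x) (k x)"]) auto
qed

lemma smooth_on_Pair: "smooth_on S f \<Longrightarrow> smooth_on S g \<Longrightarrow> smooth_on S (\<lambda>x. (f x, g x))"
  by (rule smooth_on_combine[of S f g Pair]) (auto intro: Cinf_Pair)

lemma smooth_on_bilinear:
  "bounded_bilinear p \<Longrightarrow> smooth_on S f \<Longrightarrow> smooth_on S g \<Longrightarrow> smooth_on S (\<lambda>x. p (f x) (g x))"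
  by (rule smooth_on_combine[of S f g p]) (auto intro: Cinf_bilinear)

lemma smooth_on_linear_compose:
  assumes "bounded_linear h" "smooth_on S f" shows "smooth_on S (\<lambda>x. h (f x))"
  by (rule smooth_on_combine[OF assms(2,2), of "\<lambda>y z. h y"])
     (rule Cinf_linear_compose[OF assms(1)])

lemma smooth_on_const: "smooth_on S (\<lambda>x. c)"
  by (rule Cinf_imp_smooth_on[OF Cinf_const open_UNIV subset_UNIV])

lemma smooth_on_bounded_linear: "bounded_linear h \<Longrightarrow> smooth_on S h"
  by (rule Cinf_imp_smooth_on[OF Cinf_bounded_linear open_UNIV subset_UNIV])

section \<open>Charts\<close>

lemma smooth_manifoldD:
  assumes "smooth_manifold N"
  shows "subspace (model N)" "Hausdorff_space (mtop N)"
    "\<And>U \<phi>. (U, \<phi>) \<in> atlas N \<Longrightarrow> local_chart N U \<phi>"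
    "\<And>x. x \<in> topspace (mtop N) \<Longrightarrow> \<exists>U \<phi>. (U, \<phi>) \<in> atlas N \<and> x \<in> U"
    "\<And>c d. c \<in> atlas N \<Longrightarrow> d \<in> atlas N \<Longrightarrow> chart_compat c d"
  using assms unfolding smooth_manifold_def by blast+

lemma atlas_max_atlas: "smooth_manifold N \<Longrightarrow> (U, \<phi>) \<in> atlas N \<Longrightarrow> (U, \<phi>) \<in> max_atlas N"
  unfolding max_atlas_def using smooth_manifoldD(3,5) by fast

lemma max_atlas_local_chart: "(U, \<phi>) \<in> max_atlas N \<Longrightarrow> local_chart N U \<phi>"
  unfolding max_atlas_def by blast

lemma local_chartD:
  assumes "local_chart N U \<phi>"
  shows "openin (mtop N) U" "U \<subseteq> topspace (mtop N)" "inj_on \<phi> U"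
    "openin (top_of_set (model N)) (\<phi> ` U)" "\<phi> ` U \<subseteq> model N"
    "homeomorphic_map (subtopology (mtop N) U) (top_of_set (\<phi> ` U)) \<phi>"
proof -
  show a: "openin (mtop N) U" "openin (top_of_set (model N)) (\<phi> ` U)"
    "homeomorphic_map (subtopology (mtop N) U) (top_of_set (\<phi> ` U)) \<phi>"
    using assms unfolding local_chart_def by blast+
  show b: "U \<subseteq> topspace (mtop N)" using a(1) openin_subset by blast
  show "inj_on \<phi> U" using homeomorphic_imp_injective_map[OF a(3)] b by (simp add: Int_absorb1)
  show "\<phi> ` U \<subseteq> model N" using a(2) openin_imp_subset by blast
qed

lemma local_chart_preimage_open:
  assumes "local_chart N U \<phi>" "open Q"
  shows "openin (mtop N) {u \<in> U. \<phi> u \<in> Q}"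
proof -
  note D = local_chartD[OF assms(1)]
  have "openin (subtopology (mtop N) U) {u \<in> topspace (subtopology (mtop N) U). \<phi> u \<in> \<phi> ` U \<inter> Q}"
    using homeomorphic_imp_continuous_map[OF D(6)] assms(2)
    by (intro openin_continuous_map_preimage) (auto simp: openin_open)
  moreover have "{u \<in> topspace (subtopology (mtop N) U). \<phi> u \<in> \<phi> ` U \<inter> Q} = {u \<in> U. \<phi> u \<in> Q}"
    using D(2) by auto
  ultimately show ?thesis using D(1) by (simp add: openin_open_subtopology)
qed

lemma local_chart_image_open:
  assumes "local_chart N U \<phi>" "openin (mtop N) W"
  obtains Q where "open Q" "\<phi> ` (U \<inter> W) = \<phi> ` U \<inter> Q"
proof -
  note D = local_chartD[OF assms(1)]
  have "openin (subtopology (mtop N) U) (U \<inter> W)"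
    using assms(2) by (metis Int_commute openin_subtopology_Int)
  then have "openin (top_of_set (\<phi> ` U)) (\<phi> ` (U \<inter> W))"
    using homeomorphic_imp_open_map[OF D(6)] by (simp add: open_map_def)
  then show thesis using that by (auto simp: openin_open)
qed

text \<open>Continuity may be tested in charts because their domains form an open cover.\<close>

lemma continuous_map_chartwise:
  assumes N: "smooth_manifold N"
    and c: "\<And>U \<phi>. (U, \<phi>) \<in> atlas N \<Longrightarrow> continuous_map (top_of_set (\<phi> ` U)) Y (F \<circ> inv_into U \<phi>)"
  shows "continuous_map (mtop N) Y F"
  unfolding continuous_map_def
proof (intro conjI funcsetI allI impI)
  fix x assume "x \<in> topspace (mtop N)"
  then obtain U \<phi> where U: "(U, \<phi>) \<in> atlas N" "x \<in> U" using smooth_manifoldD(4)[OF N] by blast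
  have "inv_into U \<phi> (\<phi> x) = x"
    using local_chartD(3)[OF smooth_manifoldD(3)[OF N U(1)]] U(2) by simp
  moreover have "(F \<circ> inv_into U \<phi>) (\<phi> x) \<in> topspace Y"
    using continuous_map_funspace[OF c[OF U(1)]] U(2) by fastforce
  ultimately show "F x \<in> topspace Y" by simp
next
  fix W assume W: "openin Y W"
  show "openin (mtop N) {x \<in> topspace (mtop N). F x \<in> W}"
  proof (subst openin_subopen, intro ballI)
    fix x assume x: "x \<in> {x \<in> topspace (mtop N). F x \<in> W}"
    then obtain U \<phi> where U: "(U, \<phi>) \<in> atlas N" "x \<in> U" using smooth_manifoldD(4)[OF N] by blast
    have lc: "local_chart N U \<phi>" using smooth_manifoldD(3)[OF N U(1)] .
    note D = local_chartD[OF lc]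
    have "openin (top_of_set (\<phi> ` U)) {y \<in> topspace (top_of_set (\<phi> ` U)). (F \<circ> inv_into U \<phi>) y \<in> W}"
      by (rule openin_continuous_map_preimage[OF c[OF U(1)] W])
    then obtain Q where Q: "open Q" "{y \<in> \<phi> ` U. (F \<circ> inv_into U \<phi>) y \<in> W} = \<phi> ` U \<inter> Q"
      by (auto simp: openin_open)
    have "F u \<in> W \<longleftrightarrow> \<phi> u \<in> Q" if "u \<in> U" for u
    proof -
      have "\<phi> u \<in> {y \<in> \<phi> ` U. (F \<circ> inv_into U \<phi>) y \<in> W} \<longleftrightarrow> \<phi> u \<in> \<phi> ` U \<inter> Q"
        using Q(2) by blast
      then show ?thesis using that D(3) by simp
    qed
    then show "\<exists>T. openin (mtop N) T \<and> x \<in> T \<and> T \<subseteq> {x \<in> topspace (mtop N). F x \<in> W}"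
      using local_chart_preimage_open[OF lc Q(1)] U(2) x D(2)
      by (intro exI[of _ "{u \<in> U. \<phi> u \<in> Q}"]) auto
  qed
qed

lemma smooth_fun_continuous:
  assumes "smooth_manifold N" "smooth_fun N f"
  shows "continuous_map (mtop N) euclidean f"
proof (rule continuous_map_chartwise[OF assms(1)])
  fix U \<phi> assume "(U, \<phi>) \<in> atlas N"
  then have "smooth_on (\<phi> ` U) (f \<circ> inv_into U \<phi>)" using assms(2) unfolding smooth_fun_def by blast
  then show "continuous_map (top_of_set (\<phi> ` U)) euclidean (f \<circ> inv_into U \<phi>)"
    by (simp only: continuous_map_iff_continuous smooth_on_imp_continuous_on)
qed

section \<open>Plots\<close>

text \<open>A smooth map from a subset of a Euclidean space to a manifold. Smoothness of charts, group
  operations and actions is expressed by their effect on such maps, so that the smoothness of a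
  composite expression follows by composing plots.\<close>

definition plot ::
  "('a, 'e::euclidean_space) manifold \<Rightarrow> 'f::euclidean_space set \<Rightarrow> ('f \<Rightarrow> 'a) \<Rightarrow> bool" where
  "plot N S c \<longleftrightarrow> (\<forall>x\<in>S. \<exists>U \<phi> Q. (U, \<phi>) \<in> atlas N \<and> open Q \<and> x \<in> Q \<and> c ` (S \<inter> Q) \<subseteq> U \<and>
     smooth_on (S \<inter> Q) (\<phi> \<circ> c))"

lemma plotE:
  assumes "plot N S c" "x \<in> S"
  obtains U \<phi> Q where "(U, \<phi>) \<in> atlas N" "open Q" "x \<in> Q" "c ` (S \<inter> Q) \<subseteq> U" "smooth_on (S \<inter> Q) (\<phi> \<circ> c)"
  using assms unfolding plot_def by blast

lemma plot_topspace: "smooth_manifold N \<Longrightarrow> plot N S c \<Longrightarrow> c ` S \<subseteq> topspace (mtop N)"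
proof
  fix y assume N: "smooth_manifold N" "plot N S c" and "y \<in> c ` S"
  then obtain x where x: "x \<in> S" "y = c x" by blast
  obtain U \<phi> Q where "(U, \<phi>) \<in> atlas N" "open Q" "x \<in> Q" "c ` (S \<inter> Q) \<subseteq> U"
    using plotE[OF N(2) x(1)] by metis
  then show "y \<in> topspace (mtop N)" using x local_chartD(2)[OF smooth_manifoldD(3)[OF N(1)]] by blast
qed

lemma plot_cong:
  fixes N :: "('b, 'c::euclidean_space) manifold"
  assumes eq: "\<And>x. x \<in> S \<Longrightarrow> c x = d x" and c: "plot N S c"
  shows "plot N S d"
proof -
  have "smooth_on (S \<inter> Q) (\<phi> \<circ> c) = smooth_on (S \<inter> Q) (\<phi> \<circ> d)" for Q and \<phi> :: "'b \<Rightarrow> 'c"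
    by (rule smooth_on_cong) (simp add: eq)
  moreover have "c ` (S \<inter> Q) = d ` (S \<inter> Q)" for Q using eq by (auto simp: image_iff)
  ultimately show "plot N S d" using c unfolding plot_def by metis
qed

lemma plot_compose:
  fixes c :: "'f::euclidean_space \<Rightarrow> 'a"
  assumes "plot N S c" "smooth_on T h" "h ` T \<subseteq> S"
  shows "plot N T (\<lambda>x. c (h x))"
  unfolding plot_def
proof
  fix x assume x: "x \<in> T"
  then have "h x \<in> S" using assms(3) by blast
  then obtain U \<phi> Q where Q: "(U, \<phi>) \<in> atlas N" "open Q" "h x \<in> Q" "c ` (S \<inter> Q) \<subseteq> U" "smooth_on (S \<inter> Q) (\<phi> \<circ> c)"
    using plotE[OF assms(1)] by metis
  obtain R where R: "open R" "R \<inter> T = h -` Q \<inter> T"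
    using smooth_on_imp_continuous_on[OF assms(2)] Q(2) unfolding continuous_on_open_invariant by blast
  have "smooth_on (T \<inter> R) (\<lambda>x. (\<phi> \<circ> c) (h x))"
    by (rule smooth_on_compose[OF smooth_on_subset[OF assms(2)] Q(5)]) (use R assms(3) in auto)
  then have "smooth_on (T \<inter> R) (\<phi> \<circ> (\<lambda>x. c (h x)))" by (simp add: o_def)
  moreover have "x \<in> R" using R x Q(3) by blast
  moreover have "(\<lambda>x. c (h x)) ` (T \<inter> R) \<subseteq> U" using R Q(4) assms(3) by blast
  ultimately show "\<exists>U \<phi> Q. (U, \<phi>) \<in> atlas N \<and> open Q \<and> x \<in> Q \<and> (\<lambda>x. c (h x)) ` (T \<inter> Q) \<subseteq> U \<and>
      smooth_on (T \<inter> Q) (\<phi> \<circ> (\<lambda>x. c (h x)))"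
    using Q(1) R(1) by blast
qed

lemma plot_subset: "plot N S c \<Longrightarrow> T \<subseteq> S \<Longrightarrow> plot N T c"
  using plot_compose[of N S c T "\<lambda>x. x"] smooth_on_bounded_linear[OF bounded_linear_ident] by auto

lemma plot_const:
  assumes "smooth_manifold N" "p \<in> topspace (mtop N)" shows "plot N S (\<lambda>_. p)"
proof -
  obtain U \<phi> where "(U, \<phi>) \<in> atlas N" "p \<in> U" using smooth_manifoldD(4)[OF assms] by blast
  then show ?thesis unfolding plot_def
    by (intro ballI exI[of _ U] exI[of _ \<phi>] exI[of _ UNIV]) (auto simp: o_def smooth_on_const)
qed

lemma plot_continuous:
  assumes N: "smooth_manifold N" and c: "plot N S c"
  shows "continuous_map (top_of_set S) (mtop N) c"
  unfolding continuous_map_def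
proof (intro conjI funcsetI allI impI)
  show "c x \<in> topspace (mtop N)" if "x \<in> topspace (top_of_set S)" for x
    using plot_topspace[OF N c] that by auto
next
  fix W assume W: "openin (mtop N) W"
  show "openin (top_of_set S) {x \<in> topspace (top_of_set S). c x \<in> W}"
  proof (subst openin_subopen, intro ballI)
    fix x assume x: "x \<in> {x \<in> topspace (top_of_set S). c x \<in> W}"
    then have "x \<in> S" by simp
    then obtain U \<phi> Q where Q: "(U, \<phi>) \<in> atlas N" "open Q" "x \<in> Q" "c ` (S \<inter> Q) \<subseteq> U" "smooth_on (S \<inter> Q) (\<phi> \<circ> c)"
      using plotE[OF c] by metis
    have lc: "local_chart N U \<phi>" using smooth_manifoldD(3)[OF N Q(1)] .
    obtain R where R: "open R" "\<phi> ` (U \<inter> W) = \<phi> ` U \<inter> R"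
      using local_chart_image_open[OF lc W] .
    obtain T where T: "open T" "T \<inter> (S \<inter> Q) = (\<phi> \<circ> c) -` R \<inter> (S \<inter> Q)"
      using smooth_on_imp_continuous_on[OF Q(5)] R(1) unfolding continuous_on_open_invariant by blast
    have "c y \<in> W \<longleftrightarrow> y \<in> T" if "y \<in> S \<inter> Q" for y
    proof -
      have "c y \<in> U" using Q(4) that by blast
      then have "c y \<in> W \<longleftrightarrow> \<phi> (c y) \<in> \<phi> ` (U \<inter> W)"
        using local_chartD(3)[OF lc] by (auto simp: inj_on_def)
      also have "\<dots> \<longleftrightarrow> \<phi> (c y) \<in> R" using R(2) \<open>c y \<in> U\<close> by auto
      also have "\<dots> \<longleftrightarrow> y \<in> T" using T(2) that by auto
      finally show ?thesis .
    qed
    then show "\<exists>T. openin (top_of_set S) T \<and> x \<in> T \<and> T \<subseteq> {x \<in> topspace (top_of_set S). c x \<in> W}"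
      using x Q(2,3) T(1) by (intro exI[of _ "S \<inter> (Q \<inter> T)"]) (auto intro: openin_open_Int)
  qed
qed

lemma continuous_map_preimage_open:
  assumes "continuous_map (top_of_set S) Y c" "openin Y W"
  obtains Q where "open Q" "{x \<in> S. c x \<in> W} = S \<inter> Q"
  using openin_continuous_map_preimage[OF assms] by (auto simp: openin_open)

lemma plot_chart:
  assumes N: "smooth_manifold N" and c: "plot N S c" and V: "(V, \<psi>) \<in> max_atlas N" "c ` S \<subseteq> V"
  shows "smooth_on S (\<lambda>x. \<psi> (c x))"
proof (rule smooth_on_local)
  fix x assume "x \<in> S"
  then obtain U \<phi> Q where Q: "(U, \<phi>) \<in> atlas N" "open Q" "x \<in> Q" "c ` (S \<inter> Q) \<subseteq> U" "smooth_on (S \<inter> Q) (\<phi> \<circ> c)"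
    using plotE[OF c] by metis
  have inj: "inj_on \<phi> U" using local_chartD(3)[OF smooth_manifoldD(3)[OF N Q(1)]] .
  have 1: "smooth_on (\<phi> ` (V \<inter> U)) (\<psi> \<circ> inv_into U \<phi>)"
    using V(1) Q(1) unfolding max_atlas_def chart_compat_def by blast
  have "smooth_on (S \<inter> Q) (\<lambda>x. (\<psi> \<circ> inv_into U \<phi>) ((\<phi> \<circ> c) x))"
    by (rule smooth_on_compose[OF Q(5) 1]) (use Q(4) V(2) in auto)
  moreover have "(\<psi> \<circ> inv_into U \<phi>) ((\<phi> \<circ> c) y) = \<psi> (c y)" if "y \<in> S \<inter> Q" for y
    using Q(4) that inj by auto
  ultimately have "smooth_on (S \<inter> Q) (\<lambda>x. \<psi> (c x))"
    using smooth_on_cong by (metis (no_types, lifting))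
  then show "\<exists>Q. open Q \<and> x \<in> Q \<and> smooth_on (S \<inter> Q) (\<lambda>x. \<psi> (c x))" using Q by blast
qed

lemma plot_chart_inverse:
  assumes N: "smooth_manifold N" and V: "(V, \<psi>) \<in> max_atlas N"
  shows "plot N (\<psi> ` V) (inv_into V \<psi>)"
  unfolding plot_def
proof
  note lc = max_atlas_local_chart[OF V]
  note D = local_chartD[OF lc]
  fix x assume "x \<in> \<psi> ` V"
  then obtain v where v: "v \<in> V" "x = \<psi> v" by blast
  then obtain U \<phi> where U: "(U, \<phi>) \<in> atlas N" "v \<in> U" using smooth_manifoldD(4)[OF N] D(2) by blast
  note lcU = smooth_manifoldD(3)[OF N U(1)]
  obtain Q where Q: "open Q" "\<psi> ` (V \<inter> U) = \<psi> ` V \<inter> Q"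
    using local_chart_image_open[OF lc local_chartD(1)[OF lcU]] .
  have "smooth_on (\<psi> ` (V \<inter> U)) (\<phi> \<circ> inv_into V \<psi>)"
    using V U(1) unfolding max_atlas_def chart_compat_def by blast
  moreover have "inv_into V \<psi> ` (\<psi> ` (V \<inter> U)) \<subseteq> U" using D(3) by (auto simp: inv_into_f_f)
  moreover have "x \<in> Q" using Q(2) v U(2) by blast
  ultimately show "\<exists>U \<phi> Q. (U, \<phi>) \<in> atlas N \<and> open Q \<and> x \<in> Q \<and> inv_into V \<psi> ` (\<psi> ` V \<inter> Q) \<subseteq> U \<and>
       smooth_on (\<psi> ` V \<inter> Q) (\<phi> \<circ> inv_into V \<psi>)"
    using U(1) Q by metis
qed

lemma plot_smooth_fun:
  assumes N: "smooth_manifold N" and f: "smooth_fun N f" and c: "plot N S c"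
  shows "smooth_on S (\<lambda>x. f (c x))"
proof (rule smooth_on_local)
  fix x assume "x \<in> S"
  then obtain U \<phi> Q where Q: "(U, \<phi>) \<in> atlas N" "open Q" "x \<in> Q" "c ` (S \<inter> Q) \<subseteq> U" "smooth_on (S \<inter> Q) (\<phi> \<circ> c)"
    using plotE[OF c] by metis
  have inj: "inj_on \<phi> U" using local_chartD(3)[OF smooth_manifoldD(3)[OF N Q(1)]] .
  have 1: "smooth_on (\<phi> ` U) (f \<circ> inv_into U \<phi>)"
    using f Q(1) unfolding smooth_fun_def by blast
  have "smooth_on (S \<inter> Q) (\<lambda>x. (f \<circ> inv_into U \<phi>) ((\<phi> \<circ> c) x))"
    by (rule smooth_on_compose[OF Q(5) 1]) (use Q(4) in auto)
  moreover have "(f \<circ> inv_into U \<phi>) ((\<phi> \<circ> c) y) = f (c y)" if "y \<in> S \<inter> Q" for y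
    using Q(4) that inj by auto
  ultimately have "smooth_on (S \<inter> Q) (\<lambda>x. f (c x))"
    using smooth_on_cong by (metis (no_types, lifting))
  then show "\<exists>Q. open Q \<and> x \<in> Q \<and> smooth_on (S \<inter> Q) (\<lambda>x. f (c x))" using Q by blast
qed

text \<open>The hypotheses on the source are chosen such that they are immediate for a product manifold,
  too.\<close>

lemma plot_smooth_map_aux:
  assumes M: "\<And>U \<phi>. (U, \<phi>) \<in> atlas M \<Longrightarrow> inj_on \<phi> U" and N: "smooth_manifold N"
    and F: "smooth_map M N F" and c: "plot M S c" and cc: "continuous_map (top_of_set S) (mtop M) c"
  shows "plot N S (\<lambda>x. F (c x))"
  unfolding plot_def
proof
  fix x assume "x \<in> S"
  then obtain U \<phi> Q where Q: "(U, \<phi>) \<in> atlas M" "open Q" "x \<in> Q" "c ` (S \<inter> Q) \<subseteq> U" "smooth_on (S \<inter> Q) (\<phi> \<circ> c)"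
    using plotE[OF c] by metis
  have cont: "continuous_map (top_of_set S) (mtop N) (F \<circ> c)"
    using F unfolding smooth_map_def by (blast intro: continuous_map_compose[OF cc])
  then have "F (c x) \<in> topspace (mtop N)" using continuous_map_funspace[OF cont] \<open>x \<in> S\<close> by auto
  then obtain V \<psi> where V: "(V, \<psi>) \<in> atlas N" "F (c x) \<in> V" using smooth_manifoldD(4)[OF N] by blast
  obtain R where R: "open R" "{x \<in> S. (F \<circ> c) x \<in> V} = S \<inter> R"
    using continuous_map_preimage_open[OF cont local_chartD(1)[OF smooth_manifoldD(3)[OF N V(1)]]] .
  have 1: "smooth_on (\<phi> ` (U \<inter> F -` V)) (\<psi> \<circ> F \<circ> inv_into U \<phi>)"
    using F Q(1) V(1) unfolding smooth_map_def by blast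
  have "smooth_on (S \<inter> (Q \<inter> R)) (\<lambda>x. (\<psi> \<circ> F \<circ> inv_into U \<phi>) ((\<phi> \<circ> c) x))"
    by (rule smooth_on_compose[OF smooth_on_subset[OF Q(5)] 1]) (use Q(4) R(2) in auto)
  moreover have "(\<psi> \<circ> F \<circ> inv_into U \<phi>) ((\<phi> \<circ> c) y) = (\<psi> \<circ> (\<lambda>x. F (c x))) y" if "y \<in> S \<inter> (Q \<inter> R)" for y
  proof -
    have "c y \<in> U" using Q(4) that by blast
    then show ?thesis using M[OF Q(1)] by simp
  qed
  ultimately have "smooth_on (S \<inter> (Q \<inter> R)) (\<psi> \<circ> (\<lambda>x. F (c x)))"
    using smooth_on_cong by (metis (no_types, lifting))
  moreover have "(\<lambda>x. F (c x)) ` (S \<inter> (Q \<inter> R)) \<subseteq> V" using R(2) by auto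
  moreover have "x \<in> Q \<inter> R" using R(2) Q(3) \<open>x \<in> S\<close> V(2) by auto
  ultimately show "\<exists>U \<phi> Q. (U, \<phi>) \<in> atlas N \<and> open Q \<and> x \<in> Q \<and> (\<lambda>x. F (c x)) ` (S \<inter> Q) \<subseteq> U \<and>
       smooth_on (S \<inter> Q) (\<phi> \<circ> (\<lambda>x. F (c x)))"
    using V(1) Q(2) R(1) by blast
qed

lemma plot_smooth_map:
  assumes M: "smooth_manifold M" and N: "smooth_manifold N"
    and F: "smooth_map M N F" and c: "plot M S c"
  shows "plot N S (\<lambda>x. F (c x))"
  by (rule plot_smooth_map_aux[OF _ N F c plot_continuous[OF M c]])
     (use local_chartD(3)[OF smooth_manifoldD(3)[OF M]] in blast)

lemma plot_smooth_map_prod: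
  assumes M: "smooth_manifold M" and M': "smooth_manifold M'" and N: "smooth_manifold N"
    and F: "smooth_map (prod_manifold M M') N F" and c: "plot M S c" and d: "plot M' S d"
  shows "plot N S (\<lambda>x. F (c x, d x))"
proof (rule plot_smooth_map_aux[OF _ N F, where c = "\<lambda>x. (c x, d x)"])
  fix U \<phi> assume "(U, \<phi>) \<in> atlas (prod_manifold M M')"
  then obtain V \<psi> W \<theta> where "U = V \<times> W" "\<phi> = map_prod \<psi> \<theta>" "(V, \<psi>) \<in> atlas M" "(W, \<theta>) \<in> atlas M'"
    unfolding prod_manifold_def by auto
  then show "inj_on \<phi> U"
    using local_chartD(3)[OF smooth_manifoldD(3)[OF M]] local_chartD(3)[OF smooth_manifoldD(3)[OF M']]
    by (auto intro: map_prod_inj_on)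
next
  show "continuous_map (top_of_set S) (mtop (prod_manifold M M')) (\<lambda>x. (c x, d x))"
    using plot_continuous[OF M c] plot_continuous[OF M' d]
    by (simp add: prod_manifold_def continuous_map_paired)
next
  show "plot (prod_manifold M M') S (\<lambda>x. (c x, d x))"
    unfolding plot_def
  proof
    fix x assume x: "x \<in> S"
    obtain U \<phi> Q where Q: "(U, \<phi>) \<in> atlas M" "open Q" "x \<in> Q" "c ` (S \<inter> Q) \<subseteq> U" "smooth_on (S \<inter> Q) (\<phi> \<circ> c)"
      using plotE[OF c x] by metis
    obtain V \<psi> R where R: "(V, \<psi>) \<in> atlas M'" "open R" "x \<in> R" "d ` (S \<inter> R) \<subseteq> V" "smooth_on (S \<inter> R) (\<psi> \<circ> d)"
      using plotE[OF d x] by metis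
    have "smooth_on (S \<inter> (Q \<inter> R)) (\<lambda>x. ((\<phi> \<circ> c) x, (\<psi> \<circ> d) x))"
      by (intro smooth_on_Pair smooth_on_subset[OF Q(5)] smooth_on_subset[OF R(5)]) auto
    then have "smooth_on (S \<inter> (Q \<inter> R)) (map_prod \<phi> \<psi> \<circ> (\<lambda>x. (c x, d x)))" by (simp add: o_def)
    moreover have "(U \<times> V, map_prod \<phi> \<psi>) \<in> atlas (prod_manifold M M')"
      unfolding prod_manifold_def using Q(1) R(1) by auto
    moreover have "(\<lambda>x. (c x, d x)) ` (S \<inter> (Q \<inter> R)) \<subseteq> U \<times> V" using Q(4) R(4) by auto
    ultimately show "\<exists>U \<phi> Q. (U, \<phi>) \<in> atlas (prod_manifold M M') \<and> open Q \<and> x \<in> Q \<and>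
        (\<lambda>x. (c x, d x)) ` (S \<inter> Q) \<subseteq> U \<and> smooth_on (S \<inter> Q) (\<phi> \<circ> (\<lambda>x. (c x, d x)))"
      using Q(2,3) R(2,3) by (intro exI[of _ "U \<times> V"] exI[of _ "map_prod \<phi> \<psi>"] exI[of _ "Q \<inter> R"]) auto
  qed
qed

section \<open>Charts of the maximal atlas\<close>

text \<open>Inverses of charts of the atlas are plots, so smoothness of \<open>\<phi>\<close> along plots yields both the
  missing half of compatibility and the continuity of \<open>\<phi>\<close>.\<close>

lemma max_atlasI:
  fixes N :: "('a, 'e::euclidean_space) manifold"
  assumes N: "smooth_manifold N" and U: "openin (mtop N) U" and inj: "inj_on \<phi> U"
    and im: "openin (top_of_set (model N)) (\<phi> ` U)"
    and inv: "plot N (\<phi> ` U) (inv_into U \<phi>)"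
    and chart: "\<And>(S :: 'e set) c. plot N S c \<Longrightarrow> c ` S \<subseteq> U \<Longrightarrow> smooth_on S (\<lambda>x. \<phi> (c x))"
  shows "(U, \<phi>) \<in> max_atlas N"
proof -
  have UN: "U \<subseteq> topspace (mtop N)" using U openin_subset by blast
  have inv_chart: "smooth_on (\<psi> ` (U \<inter> V)) (\<phi> \<circ> inv_into V \<psi>)" if V: "(V, \<psi>) \<in> atlas N" for V \<psi>
  proof -
    have injV: "inj_on \<psi> V" using local_chartD(3)[OF smooth_manifoldD(3)[OF N V]] .
    have "plot N (\<psi> ` (U \<inter> V)) (inv_into V \<psi>)"
      by (rule plot_subset[OF plot_chart_inverse[OF N atlas_max_atlas[OF N V]]]) auto
    then show ?thesis
      using chart[of "\<psi> ` (U \<inter> V)" "inv_into V \<psi>"] injV by (auto simp: o_def)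
  qed
  have compat: "chart_compat (U, \<phi>) (V, \<psi>)" if V: "(V, \<psi>) \<in> atlas N" for V \<psi>
  proof -
    have "smooth_on (\<phi> ` (U \<inter> V)) (\<lambda>x. \<psi> (inv_into U \<phi> x))"
      by (rule plot_chart[OF N plot_subset[OF inv] atlas_max_atlas[OF N V]]) (use inj in auto)
    then show ?thesis using inv_chart[OF V] unfolding chart_compat_def by (auto simp: o_def)
  qed
  have cont: "continuous_map (subtopology (mtop N) U) (top_of_set (\<phi> ` U)) \<phi>"
    unfolding continuous_map_in_subtopology
  proof (intro conjI)
    show "\<phi> \<in> topspace (subtopology (mtop N) U) \<rightarrow> \<phi> ` U" by auto
    show "continuous_map (subtopology (mtop N) U) euclidean \<phi>"
      unfolding continuous_map_def
    proof (intro conjI funcsetI allI impI)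
      fix Q :: "'e set" assume "openin euclidean Q"
      then have Q: "open Q" by simp
      have "openin (mtop N) {u \<in> U. \<phi> u \<in> Q}"
      proof (subst openin_subopen, intro ballI)
        fix u assume u: "u \<in> {u \<in> U. \<phi> u \<in> Q}"
        then obtain V \<psi> where V: "(V, \<psi>) \<in> atlas N" "u \<in> V" using smooth_manifoldD(4)[OF N] UN by blast
        note lc = smooth_manifoldD(3)[OF N V(1)]
        note injV = local_chartD(3)[OF lc]
        obtain R where R: "open R" "\<psi> ` (V \<inter> U) = \<psi> ` V \<inter> R" using local_chart_image_open[OF lc U] .
        obtain T where T: "open T" "T \<inter> \<psi> ` (U \<inter> V) = (\<phi> \<circ> inv_into V \<psi>) -` Q \<inter> \<psi> ` (U \<inter> V)"
          using smooth_on_imp_continuous_on[OF inv_chart[OF V(1)]] Q unfolding continuous_on_open_invariant by blast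
        have key: "v \<in> U \<and> (\<phi> v \<in> Q \<longleftrightarrow> \<psi> v \<in> T)" if "v \<in> V" "\<psi> v \<in> R" for v
        proof -
          have "\<psi> v \<in> \<psi> ` (V \<inter> U)" using R(2) that by blast
          then have "v \<in> U" using injV that(1) by (auto simp: inj_on_def)
          moreover have "\<psi> v \<in> T \<longleftrightarrow> (\<phi> \<circ> inv_into V \<psi>) (\<psi> v) \<in> Q"
            using T(2) \<open>\<psi> v \<in> \<psi> ` (V \<inter> U)\<close> by (metis IntI IntD1 Int_commute vimage_eq)
          ultimately show ?thesis using injV that(1) by simp
        qed
        have "\<psi> u \<in> R" using R(2) u V(2) by blast
        then show "\<exists>T. openin (mtop N) T \<and> u \<in> T \<and> T \<subseteq> {u \<in> U. \<phi> u \<in> Q}"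
          using local_chart_preimage_open[OF lc open_Int[OF R(1) T(1)]] key u V(2)
          by (intro exI[of _ "{v \<in> V. \<psi> v \<in> R \<inter> T}"]) auto
      qed
      moreover have "{u \<in> topspace (subtopology (mtop N) U). \<phi> u \<in> Q} = {u \<in> U. \<phi> u \<in> Q}"
        using UN by auto
      ultimately show "openin (subtopology (mtop N) U) {u \<in> topspace (subtopology (mtop N) U). \<phi> u \<in> Q}"
        using U by (simp add: openin_open_subtopology)
    qed simp
  qed
  have "continuous_map (top_of_set (\<phi> ` U)) (subtopology (mtop N) U) (inv_into U \<phi>)"
    using plot_continuous[OF N inv] inj by (auto simp: continuous_map_in_subtopology)
  then have "homeomorphic_maps (subtopology (mtop N) U) (top_of_set (\<phi> ` U)) \<phi> (inv_into U \<phi>)"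
    using cont inj UN by (auto simp: homeomorphic_maps_def f_inv_into_f)
  then have "homeomorphic_map (subtopology (mtop N) U) (top_of_set (\<phi> ` U)) \<phi>"
    using homeomorphic_maps_map by blast
  then show ?thesis
    using U im compat unfolding max_atlas_def local_chart_def by auto
qed

lemma max_atlas_transport:
  fixes N :: "('a, 'e::euclidean_space) manifold"
  assumes N: "smooth_manifold N" and U: "(U, \<phi>) \<in> max_atlas N"
    and F: "\<And>(S :: 'e set) c. plot N S c \<Longrightarrow> plot N S (\<lambda>x. F (c x))"
      "\<And>(S :: 'e set) c. plot N S c \<Longrightarrow> plot N S (\<lambda>x. F' (c x))"
    and FF: "\<And>x. x \<in> topspace (mtop N) \<Longrightarrow> F x \<in> topspace (mtop N) \<and> F' (F x) = x"
      "\<And>x. x \<in> topspace (mtop N) \<Longrightarrow> F' x \<in> topspace (mtop N) \<and> F (F' x) = x"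
  shows "(F ` U, \<phi> \<circ> F') \<in> max_atlas N"
proof -
  note D = local_chartD[OF max_atlas_local_chart[OF U]]
  have cont: "continuous_map (mtop N) (mtop N) F'"
  proof (rule continuous_map_chartwise[OF N])
    fix V \<psi> assume V: "(V, \<psi>) \<in> atlas N"
    show "continuous_map (top_of_set (\<psi> ` V)) (mtop N) (F' \<circ> inv_into V \<psi>)"
      using plot_continuous[OF N F(2)[OF plot_chart_inverse[OF N atlas_max_atlas[OF N V]]]]
      by (simp add: o_def)
  qed
  have FU: "F ` U = {x \<in> topspace (mtop N). F' x \<in> U}"
    using D(2) FF by (auto simp: image_iff) (metis subsetD)+
  have im: "(\<phi> \<circ> F') ` (F ` U) = \<phi> ` U" using D(2) FF(1) by (force simp: image_iff)
  have inj: "inj_on (\<phi> \<circ> F') (F ` U)"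
    using D(2,3) FF(1) by (auto simp: inj_on_def subset_iff)
  have inv: "inv_into (F ` U) (\<phi> \<circ> F') y = F (inv_into U \<phi> y)" if "y \<in> \<phi> ` U" for y
  proof (rule inv_into_f_eq[OF inj])
    show "F (inv_into U \<phi> y) \<in> F ` U" using inv_into_into[OF that] by blast
    show "(\<phi> \<circ> F') (F (inv_into U \<phi> y)) = y"
      using inv_into_into[OF that] D(2) FF(1) f_inv_into_f[OF that] by (auto simp: subset_iff)
  qed
  show ?thesis
  proof (rule max_atlasI[OF N _ inj])
    show "openin (mtop N) (F ` U)" unfolding FU by (rule openin_continuous_map_preimage[OF cont D(1)])
    show "openin (top_of_set (model N)) ((\<phi> \<circ> F') ` (F ` U))" using D(4) im by simp
    show "plot N ((\<phi> \<circ> F') ` F ` U) (inv_into (F ` U) (\<phi> \<circ> F'))"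
      unfolding im using F(1)[OF plot_chart_inverse[OF N U]] by (rule plot_cong[rotated]) (simp add: inv)
    show "smooth_on S (\<lambda>x. (\<phi> \<circ> F') (c x))" if "plot N S c" "c ` S \<subseteq> F ` U" for S :: "'e set" and c
      using plot_chart[OF N F(2)[OF that(1)] U] that(2) FU by auto
  qed
qed

lemma max_atlas_reparametrize:
  fixes N :: "('a, 'e::euclidean_space) manifold"
  assumes N: "smooth_manifold N" and V: "(V, \<psi>) \<in> max_atlas N"
    and P: "open P" and Q: "open Q" and hom: "homeomorphism P Q H g" and smooth: "Cinf P H" "Cinf Q g"
    and model: "\<And>z. z \<in> P \<Longrightarrow> H z \<in> model N \<longleftrightarrow> z \<in> model N"
  shows "({v \<in> V. \<psi> v \<in> Q}, \<lambda>v. g (\<psi> v)) \<in> max_atlas N"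
proof -
  note D = local_chartD[OF max_atlas_local_chart[OF V]]
  let ?U = "{v \<in> V. \<psi> v \<in> Q}" and ?\<chi> = "\<lambda>v. g (\<psi> v)"
  have gP: "g y \<in> P" "H (g y) = y" if "y \<in> Q" for y using hom that by (auto simp: homeomorphism_def)
  have HQ: "H z \<in> Q" "g (H z) = z" if "z \<in> P" for z using hom that by (auto simp: homeomorphism_def)
  have im: "?\<chi> ` ?U = {z \<in> P. H z \<in> \<psi> ` V}"
    using gP HQ by (auto simp: image_iff) metis+
  have inj: "inj_on ?\<chi> ?U"
    using D(3) gP by (auto simp: inj_on_def) metis
  have inv: "inv_into ?U ?\<chi> z = inv_into V \<psi> (H z)" if "z \<in> ?\<chi> ` ?U" for z
  proof (rule inv_into_f_eq[OF inj])
    have z: "z \<in> P" "H z \<in> \<psi> ` V" using that unfolding im by auto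
    show "inv_into V \<psi> (H z) \<in> ?U" using inv_into_into[OF z(2)] f_inv_into_f[OF z(2)] HQ z by auto
    show "g (\<psi> (inv_into V \<psi> (H z))) = z" using f_inv_into_f[OF z(2)] HQ z by auto
  qed
  show ?thesis
  proof (rule max_atlasI[OF N _ inj])
    show "openin (mtop N) ?U" using local_chart_preimage_open[OF max_atlas_local_chart[OF V] Q] .
    show "openin (top_of_set (model N)) (?\<chi> ` ?U)"
    proof -
      obtain R where R: "open R" "\<psi> ` V = model N \<inter> R" using D(4) by (auto simp: openin_open)
      have "open (P \<inter> H -` R)"
        using continuous_open_preimage[OF Cinf_continuous[OF smooth(1)] P R(1)] .
      moreover have "?\<chi> ` ?U = model N \<inter> (P \<inter> H -` R)"
        unfolding im using R(2) model by auto
      ultimately show ?thesis by (auto simp: openin_open)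
    qed
    show "plot N (?\<chi> ` ?U) (inv_into ?U ?\<chi>)"
    proof (rule plot_cong[where c = "\<lambda>z. inv_into V \<psi> (H z)"])
      show "plot N (?\<chi> ` ?U) (\<lambda>z. inv_into V \<psi> (H z))"
        by (rule plot_compose[OF plot_chart_inverse[OF N V] Cinf_imp_smooth_on[OF smooth(1) P]])
           (auto simp: im)
    qed (simp add: inv)
    show "smooth_on S (\<lambda>x. g (\<psi> (c x)))" if "plot N S c" "c ` S \<subseteq> ?U" for S :: "'e set" and c
      by (rule smooth_on_compose[OF plot_chart[OF N that(1) V] Cinf_imp_smooth_on[OF smooth(2) Q subset_refl]])
         (use that(2) in auto)
  qed
qed

section \<open>Linear algebra\<close>

text \<open>On the compact set of coefficient families of total size 1 the norm of the linear combination of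
  a basis attains a positive minimum. The coordinates with respect to the basis are therefore
  bounded functionals, and one of them does not vanish at \<open>v\<close>.\<close>

lemma finite_dim_functional:
  fixes v :: "'v::real_normed_vector"
  assumes "finite B0" "span B0 = (UNIV :: 'v set)" "v \<noteq> 0"
  obtains l :: "'v \<Rightarrow> real" where "bounded_linear l" "l v \<noteq> 0"
proof -
  obtain B where B: "B \<subseteq> B0" "independent B" "span B = (UNIV :: 'v set)"
    using maximal_independent_subset[of B0] assms(2)
    by (metis span_eq span_superset span_span top.extremum_uniqueI subset_UNIV span_mono)
  have fin: "finite B" using B(1) assms(1) finite_subset by blast
  define K :: "('v \<Rightarrow> real) set" where "K = (\<Pi>\<^sub>E b\<in>B. {-1..1})"
  define S where "S = K \<inter> {a. (\<Sum>b\<in>B. \<bar>a b\<bar>) \<in> {1}}"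
  have "compact S"
  proof -
    have "compactin (product_topology (\<lambda>_. euclidean) UNIV) (\<Pi>\<^sub>E b\<in>(UNIV :: 'v set). if b \<in> B then {-1..1} else {undefined :: real})"
      by (subst compactin_PiE) auto
    moreover have "(\<Pi>\<^sub>E b\<in>(UNIV :: 'v set). if b \<in> B then {-1..1} else {undefined :: real}) = K"
      by (auto simp: K_def PiE_def Pi_def extensional_def split: if_splits)
    ultimately have "compact K" by (simp add: euclidean_product_topology)
    moreover have "closed {a :: 'v \<Rightarrow> real. (\<Sum>b\<in>B. \<bar>a b\<bar>) \<in> {1}}"
      by (rule closed_Collect_eq[where g = "\<lambda>_. 1", simplified, of "\<lambda>a. \<Sum>b\<in>B. \<bar>a b\<bar>", folded singleton_iff[of _ 1]])
        (auto intro!: continuous_intros continuous_on_product_coordinates)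
    ultimately show ?thesis unfolding S_def by (rule compact_Int_closed)
  qed
  define comb where "comb a = (\<Sum>b\<in>B. a b *\<^sub>R b)" for a
  have cont: "continuous_on S (\<lambda>a. norm (comb a))"
    unfolding comb_def
    by (intro continuous_intros continuous_on_subset[OF continuous_on_product_coordinates subset_UNIV])
  obtain c where c: "c > 0" "\<And>a. a \<in> S \<Longrightarrow> c \<le> norm (comb a)"
  proof (cases "S = {}")
    case True then show thesis using that[of 1] by simp
  next
    case False
    obtain a where a: "a \<in> S" "\<And>a'. a' \<in> S \<Longrightarrow> norm (comb a) \<le> norm (comb a')"
      using continuous_attains_inf[OF \<open>compact S\<close> False cont] by blast
    have "comb a \<noteq> 0"
    proof
      assume "comb a = 0"
      then have "\<forall>b\<in>B. a b = 0"
        using B(2) fin unfolding comb_def by (metis independentD order_refl)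
      then show False using a(1) by (simp add: S_def)
    qed
    then show thesis using that[of "norm (comb a)"] a by simp
  qed
  have bound: "c * (\<Sum>b\<in>B. \<bar>a b\<bar>) \<le> norm (comb a)" for a
  proof (cases "(\<Sum>b\<in>B. \<bar>a b\<bar>) = 0")
    case True then show ?thesis by simp
  next
    case False
    define s where "s = (\<Sum>b\<in>B. \<bar>a b\<bar>)"
    have s: "s > 0" using False by (simp add: s_def sum_nonneg order_less_le)
    define a' where "a' = restrict (\<lambda>b. a b / s) B"
    have le: "\<bar>a b\<bar> \<le> s" if "b \<in> B" for b
      unfolding s_def using that fin by (intro member_le_sum) auto
    have "a' \<in> K"
    proof -
      have "-1 \<le> a b / s \<and> a b / s \<le> 1" if "b \<in> B" for b
        using le[OF that] s by (auto simp: field_simps abs_le_iff)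
      then show ?thesis unfolding K_def a'_def by (auto simp: PiE_def Pi_def)
    qed
    moreover have "(\<Sum>b\<in>B. \<bar>a' b\<bar>) = 1"
    proof -
      have "(\<Sum>b\<in>B. \<bar>a' b\<bar>) = (\<Sum>b\<in>B. \<bar>a b\<bar> / s)"
        using s by (intro sum.cong) (auto simp: a'_def)
      also have "\<dots> = s / s" unfolding s_def[symmetric] by (simp add: s_def sum_divide_distrib[symmetric])
      finally show ?thesis using s by simp
    qed
    ultimately have "c \<le> norm (comb a')" using c(2) by (simp add: S_def)
    also have "comb a' = (1 / s) *\<^sub>R comb a"
      by (auto simp: comb_def a'_def scaleR_sum_right intro!: sum.cong)
    finally show ?thesis using s by (simp add: s_def[symmetric] field_simps)
  qed
  have comb_rep: "comb (representation B w) = w" for w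
    unfolding comb_def using sum_representation_eq[OF B(2) _ fin order_refl] B(3) by simp
  have lin: "bounded_linear (\<lambda>w. representation B w b)" if "b \<in> B" for b
  proof (rule bounded_linear_intro[where K = "1 / c"])
    show "representation B (x + y) b = representation B x b + representation B y b" for x y
      using representation_add[OF B(2)] B(3) by simp
    show "representation B (r *\<^sub>R x) b = r *\<^sub>R representation B x b" for r x
      using representation_scale[OF B(2)] B(3) by simp
    fix w
    have "c * \<bar>representation B w b\<bar> \<le> c * (\<Sum>b\<in>B. \<bar>representation B w b\<bar>)"
      using that fin c(1) by (intro mult_left_mono member_le_sum) auto
    also have "\<dots> \<le> norm w" using bound[of "representation B w"] comb_rep by simp
    finally show "norm (representation B w b) \<le> norm w * (1 / c)"
      using c(1) by (simp add: field_simps)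
  qed
  have "\<exists>b\<in>B. representation B v b \<noteq> 0"
  proof (rule ccontr)
    assume "\<not> ?thesis"
    then have "comb (representation B v) = 0" by (simp add: comb_def)
    then show False using comb_rep assms(3) by simp
  qed
  then show thesis using that lin by blast
qed

lemma finite_dim_operator_functional:
  fixes A :: "'v::real_normed_vector \<Rightarrow>\<^sub>L 'v"
  assumes "finite B0" "span B0 = (UNIV :: 'v set)" "A \<noteq> 0"
  obtains \<Lambda> :: "('v \<Rightarrow>\<^sub>L 'v) \<Rightarrow> real" where "bounded_linear \<Lambda>" "\<Lambda> A \<noteq> 0"
proof -
  obtain v where v: "blinfun_apply A v \<noteq> 0" using assms(3) by (metis blinfun_eqI zero_blinfun.rep_eq)
  obtain l :: "'v \<Rightarrow> real" where l: "bounded_linear l" "l (blinfun_apply A v) \<noteq> 0"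
    using finite_dim_functional[OF assms(1,2) v] .
  have "bounded_linear (\<lambda>A. l (blinfun_apply A v))"
    by (rule bounded_linear_compose[OF l(1) blinfun.bounded_linear_left])
  then show thesis using that l(2) by blast
qed

text \<open>The functionals \<open>\<Lambda> \<circ> T\<close> are the inner products with vectors of the orthogonal complement of
  the kernel of \<open>T\<close>; an orthonormal basis of that complement assembles them into \<open>R\<close>, and
  \<open>R \<circ> T\<close> is then the orthogonal projection onto it.\<close>

lemma bounded_pseudo_inverse:
  fixes T :: "'e::euclidean_space \<Rightarrow> 'b::real_normed_vector"
  assumes T: "linear T"
    and sep: "\<And>y :: 'b. y \<noteq> 0 \<Longrightarrow> \<exists>\<Lambda> :: 'b \<Rightarrow> real. bounded_linear \<Lambda> \<and> \<Lambda> y \<noteq> 0"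
  obtains R where "bounded_linear R" "\<And>x. T (R (T x)) = T x" "\<And>y k. T k = 0 \<Longrightarrow> R y \<bullet> k = 0"
proof -
  define U where "U = {u. \<exists>\<Lambda> :: 'b \<Rightarrow> real. bounded_linear \<Lambda> \<and> (\<forall>x. \<Lambda> (T x) = u \<bullet> x)}"
  have "subspace U"
    unfolding subspace_def
  proof (intro conjI ballI allI)
    show "0 \<in> U" unfolding U_def by (auto intro!: exI[of _ "\<lambda>_. 0"])
  next
    fix u w assume "u \<in> U" "w \<in> U"
    then obtain \<Lambda> \<Lambda>' :: "'b \<Rightarrow> real" where "bounded_linear \<Lambda>" "bounded_linear \<Lambda>'"
      "\<And>x. \<Lambda> (T x) = u \<bullet> x" "\<And>x. \<Lambda>' (T x) = w \<bullet> x" unfolding U_def by blast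
    then show "u + w \<in> U" unfolding U_def
      by (auto intro!: exI[of _ "\<lambda>x. \<Lambda> x + \<Lambda>' x"] bounded_linear_add simp: inner_add_left)
  next
    fix c :: real and u assume "u \<in> U"
    then obtain \<Lambda> :: "'b \<Rightarrow> real" where "bounded_linear \<Lambda>" "\<And>x. \<Lambda> (T x) = u \<bullet> x" unfolding U_def by blast
    then show "c *\<^sub>R u \<in> U" unfolding U_def
      by (auto intro!: exI[of _ "\<lambda>x. c * \<Lambda> x"] bounded_linear_const_mult)
  qed
  then obtain B where B: "B \<subseteq> U" "pairwise orthogonal B" "\<And>x. x \<in> B \<Longrightarrow> norm x = 1" "independent B" "span B = U"
    using orthonormal_basis_subspace by metis
  have fin: "finite B" using B(4) independent_imp_finite by blast
  have "\<forall>u\<in>B. \<exists>\<Lambda> :: 'b \<Rightarrow> real. bounded_linear \<Lambda> \<and> (\<forall>x. \<Lambda> (T x) = u \<bullet> x)"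
    using B(1) unfolding U_def by blast
  then obtain L :: "'e \<Rightarrow> 'b \<Rightarrow> real" where L: "\<And>u. u \<in> B \<Longrightarrow> bounded_linear (L u)" "\<And>u x. u \<in> B \<Longrightarrow> L u (T x) = u \<bullet> x"
    by metis
  define R where "R y = (\<Sum>u\<in>B. L u y *\<^sub>R u)" for y
  have "bounded_linear R"
    unfolding R_def by (intro bounded_linear_sum bounded_linear_compose[OF bounded_linear_scaleR_left]) (use L in auto)
  moreover have "T (R (T x)) = T x" for x
  proof (rule ccontr)
    assume "T (R (T x)) \<noteq> T x"
    define z where "z = x - R (T x)"
    have "T z \<noteq> 0" using \<open>T (R (T x)) \<noteq> T x\<close> T by (simp add: z_def linear_diff)
    then obtain \<Lambda> :: "'b \<Rightarrow> real" where Lam: "bounded_linear \<Lambda>" "\<Lambda> (T z) \<noteq> 0" using sep by blast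
    define u where "u = (\<Sum>b\<in>Basis. \<Lambda> (T b) *\<^sub>R b)"
    have u: "\<Lambda> (T y) = u \<bullet> y" for y
    proof -
      have lin: "linear (\<lambda>y. \<Lambda> (T y))"
        using linear_compose[OF T bounded_linear.linear[OF Lam(1)]] by (simp add: o_def)
      have "\<Lambda> (T y) = \<Lambda> (T (\<Sum>b\<in>Basis. (y \<bullet> b) *\<^sub>R b))" by (simp add: euclidean_representation)
      also have "\<dots> = (\<Sum>b\<in>Basis. (y \<bullet> b) * \<Lambda> (T b))"
        using linear_sum[OF lin, of "\<lambda>b. (y \<bullet> b) *\<^sub>R b" Basis] linear_scale[OF lin] by simp
      also have "\<dots> = u \<bullet> y" by (simp add: u_def inner_sum_left inner_sum_right inner_commute[of _ y] mult.commute)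
      finally show ?thesis .
    qed
    then have "u \<in> U" using Lam(1) unfolding U_def by blast
    have wz: "w \<bullet> z = 0" if "w \<in> B" for w
    proof -
      have "w \<bullet> R (T x) = (\<Sum>u\<in>B. (u \<bullet> x) * (w \<bullet> u))"
        unfolding R_def by (simp add: inner_sum_right L(2))
      also have "\<dots> = (\<Sum>u\<in>B. if u = w then u \<bullet> x else 0)"
      proof (rule sum.cong[OF refl])
        fix u assume "u \<in> B"
        show "(u \<bullet> x) * (w \<bullet> u) = (if u = w then u \<bullet> x else 0)"
          using B(2,3) \<open>u \<in> B\<close> that by (auto simp: pairwise_def orthogonal_def norm_eq_1)
      qed
      also have "\<dots> = w \<bullet> x" using that fin by simp
      finally show ?thesis by (simp add: z_def inner_diff_right)
    qed
    have "orthogonal z w" if "w \<in> span B" for w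
      by (rule orthogonal_to_span[OF that]) (simp add: orthogonal_def inner_commute wz)
    then have "u \<bullet> z = 0" using \<open>u \<in> U\<close> B(5) by (simp add: orthogonal_def inner_commute)
    then show False using u Lam(2) by simp
  qed
  moreover have "R y \<bullet> k = 0" if "T k = 0" for y k
  proof -
    have "u \<bullet> k = 0" if "u \<in> B" for u
      using L[OF that] \<open>T k = 0\<close> by (metis bounded_linear.linear linear_0)
    then show ?thesis by (simp add: R_def inner_sum_left)
  qed
  ultimately show thesis using that by blast
qed

lemma linear_bounded_below_on_subspace:
  fixes D :: "'e::euclidean_space \<Rightarrow> 'b::real_normed_vector"
  assumes D: "bounded_linear D" and X: "subspace X" and inj: "\<And>x. x \<in> X \<Longrightarrow> D x = 0 \<Longrightarrow> x = 0"
  obtains c where "c > 0" "\<And>x. x \<in> X \<Longrightarrow> c * norm x \<le> norm (D x)"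
proof -
  define S where "S = sphere 0 1 \<inter> X"
  have "compact S" unfolding S_def using closed_subspace[OF X] by (simp add: compact_Int_closed)
  have cont: "continuous_on S (\<lambda>x. norm (D x))"
    by (intro continuous_on_norm linear_continuous_on D)
  obtain c where c: "c > 0" "\<And>x. x \<in> S \<Longrightarrow> c \<le> norm (D x)"
  proof (cases "S = {}")
    case True then show thesis using that[of 1] by simp
  next
    case False
    obtain a where a: "a \<in> S" "\<And>a'. a' \<in> S \<Longrightarrow> norm (D a) \<le> norm (D a')"
      using continuous_attains_inf[OF \<open>compact S\<close> False cont] by blast
    have "D a \<noteq> 0" using a(1) inj unfolding S_def by fastforce
    then show thesis using that[of "norm (D a)"] a by simp
  qed
  have "c * norm x \<le> norm (D x)" if "x \<in> X" for x
  proof (cases "x = 0")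
    case False
    have "(1 / norm x) *\<^sub>R x \<in> S" using False X that by (simp add: S_def subspace_scale)
    then have "c \<le> norm (D ((1 / norm x) *\<^sub>R x))" using c(2) by blast
    also have "\<dots> = norm (D x) / norm x"
      using linear_scale[OF bounded_linear.linear[OF D], of "1 / norm x" x] by simp
    finally show ?thesis using False by (simp add: field_simps)
  qed simp
  then show thesis using that c(1) by blast
qed

text \<open>On \<open>X\<close> the norm of \<open>D x\<close> is at least \<open>c * norm x\<close> for some \<open>c > 0\<close>, and for small \<open>x\<close> the value
  \<open>F (q + x)\<close> differs from \<open>D x\<close> by at most half of that.\<close>

lemma isolated_zero_on_subspace:
  fixes F :: "'e::euclidean_space \<Rightarrow> 'b::real_normed_vector"
  assumes F: "(F has_derivative D) (at q within S)" "F q = 0"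
    and X: "subspace X" and inj: "\<And>x. x \<in> X \<Longrightarrow> D x = 0 \<Longrightarrow> x = 0"
  obtains e where "e > 0" "\<And>x. x \<in> X \<Longrightarrow> q + x \<in> S \<Longrightarrow> norm x < e \<Longrightarrow> F (q + x) = 0 \<Longrightarrow> x = 0"
proof -
  obtain c where c: "c > 0" "\<And>x. x \<in> X \<Longrightarrow> c * norm x \<le> norm (D x)"
    using linear_bounded_below_on_subspace[OF has_derivative_bounded_linear[OF F(1)] X inj] by metis
  have "\<forall>e>0. \<exists>d>0. \<forall>y\<in>S. norm (y - q) < d \<longrightarrow> norm (F y - F q - D (y - q)) \<le> e * norm (y - q)"
    using F(1) unfolding has_derivative_within_alt by blast
  then obtain d where d: "d > 0" "\<And>y. y \<in> S \<Longrightarrow> norm (y - q) < d \<Longrightarrow> norm (F y - F q - D (y - q)) \<le> c / 2 * norm (y - q)"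
    using c(1) half_gt_zero by metis
  have "x = 0" if x: "x \<in> X" "q + x \<in> S" "norm x < d" "F (q + x) = 0" for x
  proof -
    have "norm (D x) \<le> c / 2 * norm x" using d(2)[OF x(2)] x(3,4) F(2) by simp
    then have "c * norm x \<le> c / 2 * norm x" using c(2)[OF x(1)] by linarith
    then show ?thesis using c(1) by (simp add: mult_le_cancel_right)
  qed
  then show thesis using that d(1) by blast
qed

section \<open>Polynomials of operators\<close>

lemma blinfun_compose_assoc: "(A o\<^sub>L B) o\<^sub>L C = A o\<^sub>L (B o\<^sub>L C)"
  by (rule blinfun_eqI) simp

lemma blinfun_compose_simps:
  "(A + B) o\<^sub>L C = (A o\<^sub>L C) + (B o\<^sub>L C)" "A o\<^sub>L (B + C) = (A o\<^sub>L B) + (A o\<^sub>L C)"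
  "(A - B) o\<^sub>L C = (A o\<^sub>L C) - (B o\<^sub>L C)" "A o\<^sub>L (B - C) = (A o\<^sub>L B) - (A o\<^sub>L C)"
  "(c *\<^sub>R A) o\<^sub>L C = c *\<^sub>R (A o\<^sub>L C)" "A o\<^sub>L (c *\<^sub>R C) = c *\<^sub>R (A o\<^sub>L C)"
  "A o\<^sub>L 0 = 0" "0 o\<^sub>L A = 0" "A o\<^sub>L id_blinfun = A" "id_blinfun o\<^sub>L A = A"
  by (auto intro!: blinfun_eqI simp: blinfun.bilinear_simps)

lemma poly_op_0 [simp]: "poly_op 0 A = 0"
  by (simp add: poly_op_def)

lemma poly_op_pCons [simp]: "poly_op (pCons c p) A = c *\<^sub>R id_blinfun + (A o\<^sub>L poly_op p A)"
proof (cases "p = 0")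
  case True
  then show ?thesis by (cases "c = 0") (auto simp: poly_op_def blinfun_compose_simps)
next
  case False
  have "poly_op (pCons c p) A = (\<Sum>i\<le>Suc (degree p). coeff (pCons c p) i *\<^sub>R (((o\<^sub>L) A ^^ i) id_blinfun))"
    using False by (simp add: poly_op_def)
  also have "\<dots> = c *\<^sub>R id_blinfun + (\<Sum>i\<le>degree p. coeff p i *\<^sub>R (A o\<^sub>L (((o\<^sub>L) A ^^ i) id_blinfun)))"
    by (subst sum.atMost_Suc_shift) simp
  also have "(\<Sum>i\<le>degree p. coeff p i *\<^sub>R (A o\<^sub>L (((o\<^sub>L) A ^^ i) id_blinfun))) = (A o\<^sub>L poly_op p A)"
    unfolding poly_op_def by (subst bounded_bilinear.sum_right[OF bounded_bilinear_blinfun_compose])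
       (simp add: blinfun_compose_simps)
  finally show ?thesis .
qed

lemma poly_op_add: "poly_op (p + q) A = poly_op p A + poly_op q A"
  by (induction p q rule: poly_induct2) (auto simp: blinfun_compose_simps algebra_simps)

lemma poly_op_smult: "poly_op (smult c p) A = c *\<^sub>R poly_op p A"
  by (induction p) (auto simp: blinfun_compose_simps algebra_simps)

lemma poly_op_mult: "poly_op (p * q) A = (poly_op p A o\<^sub>L poly_op q A)"
  by (induction p) (auto simp: poly_op_add poly_op_smult blinfun_compose_simps blinfun_compose_assoc algebra_simps)

lemma poly_op_conj:
  fixes g g' A :: "'v::real_normed_vector \<Rightarrow>\<^sub>L 'v"
  assumes "g' o\<^sub>L g = id_blinfun" "g o\<^sub>L g' = id_blinfun"
  shows "poly_op p (g o\<^sub>L A o\<^sub>L g') = (g o\<^sub>L poly_op p A o\<^sub>L g')"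
proof (induction p)
  case (pCons c p)
  have "(g o\<^sub>L A o\<^sub>L g' o\<^sub>L (g o\<^sub>L poly_op p A o\<^sub>L g')) = (g o\<^sub>L A o\<^sub>L (g' o\<^sub>L g) o\<^sub>L poly_op p A o\<^sub>L g')"
    by (simp add: blinfun_compose_assoc)
  then show ?case using pCons.IH assms
    by (simp add: blinfun_compose_simps blinfun_compose_assoc)
qed (simp add: blinfun_compose_simps)

lemma poly_op_commute:
  assumes "B o\<^sub>L A = A o\<^sub>L B" shows "B o\<^sub>L poly_op p A = poly_op p A o\<^sub>L B"
proof (induction p)
  case (pCons c p)
  have "B o\<^sub>L (A o\<^sub>L poly_op p A) = A o\<^sub>L (B o\<^sub>L poly_op p A)"
    using assms by (metis blinfun_compose_assoc)
  also have "\<dots> = (A o\<^sub>L poly_op p A) o\<^sub>L B" using pCons.IH by (simp add: blinfun_compose_assoc)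
  finally show ?case by (simp add: blinfun_compose_simps)
qed (simp add: blinfun_compose_simps)

text \<open>Both the derivative of \<open>A \<mapsto> p A\<close> and the commutator with \<open>p A\<close> reduce to multiplication by
  \<open>p' A\<close> in directions that commute with \<open>A\<close>.\<close>

lemma poly_op_has_derivative:
  "\<exists>D. (poly_op p has_derivative D) (at A) \<and>
     (\<forall>H. H o\<^sub>L A = A o\<^sub>L H \<longrightarrow> D H = (poly_op (pderiv p) A o\<^sub>L H))"
proof (induction p)
  case 0
  have "poly_op 0 = (\<lambda>A. 0)" by auto
  then show ?case by (intro exI[of _ "\<lambda>_. 0"]) (simp add: blinfun_compose_simps)
next
  case (pCons c p)
  then obtain D where D: "(poly_op p has_derivative D) (at A)"
    "\<And>H. H o\<^sub>L A = A o\<^sub>L H \<Longrightarrow> D H = (poly_op (pderiv p) A o\<^sub>L H)" by blast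
  define E where "E H = (A o\<^sub>L D H) + (H o\<^sub>L poly_op p A)" for H
  have "((\<lambda>A. A o\<^sub>L poly_op p A) has_derivative E) (at A)"
    unfolding E_def by (rule bounded_bilinear.FDERIV[OF bounded_bilinear_blinfun_compose has_derivative_ident D(1)])
  then have "((\<lambda>A. c *\<^sub>R id_blinfun + (A o\<^sub>L poly_op p A)) has_derivative (\<lambda>H. 0 + E H)) (at A)"
    by (rule has_derivative_add[OF has_derivative_const])
  then have der: "((\<lambda>A. c *\<^sub>R id_blinfun + (A o\<^sub>L poly_op p A)) has_derivative E) (at A)" by simp
  have eq: "poly_op (pCons c p) = (\<lambda>A. c *\<^sub>R id_blinfun + (A o\<^sub>L poly_op p A))" by auto
  have "(poly_op (pCons c p) has_derivative E) (at A)" unfolding eq by (rule der)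
  moreover have "E H = (poly_op (pderiv (pCons c p)) A o\<^sub>L H)" if "H o\<^sub>L A = A o\<^sub>L H" for H
    using D(2)[OF that] poly_op_commute[OF that, of p]
    by (simp add: E_def pderiv_pCons poly_op_add blinfun_compose_simps blinfun_compose_assoc algebra_simps)
  ultimately show ?case by blast
qed

lemma poly_op_commutator:
  assumes D: "D = (B o\<^sub>L A) - (A o\<^sub>L B)" and comm: "D o\<^sub>L A = A o\<^sub>L D"
  shows "(B o\<^sub>L poly_op p A) - (poly_op p A o\<^sub>L B) = (poly_op (pderiv p) A o\<^sub>L D)"
proof (induction p)
  case (pCons c p)
  let ?P = "poly_op p A" and ?P' = "poly_op (pderiv p) A"
  have BA: "B o\<^sub>L A = (A o\<^sub>L B) + D" by (simp add: D)
  have BP: "B o\<^sub>L ?P = (?P o\<^sub>L B) + (?P' o\<^sub>L D)" using pCons.IH by (simp add: algebra_simps)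
  have "B o\<^sub>L (A o\<^sub>L ?P) = (A o\<^sub>L (B o\<^sub>L ?P)) + (D o\<^sub>L ?P)"
    by (metis BA blinfun_compose_assoc blinfun_compose_simps(1))
  also have "\<dots> = (A o\<^sub>L ?P o\<^sub>L B) + (A o\<^sub>L ?P' o\<^sub>L D) + (?P o\<^sub>L D)"
    using poly_op_commute[OF comm, of p] by (simp add: BP blinfun_compose_simps blinfun_compose_assoc)
  finally show ?case
    by (simp add: pderiv_pCons poly_op_add blinfun_compose_simps blinfun_compose_assoc algebra_simps)
qed (simp add: blinfun_compose_simps)

text \<open>Evaluate the Bezout identity \<open>u f + v f' = 1\<close> at \<open>A\<close>.\<close>

lemma poly_op_pderiv_left_inverse:
  assumes "coprime f (pderiv f)" "poly_op f A = 0"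
  obtains W where "W o\<^sub>L poly_op (pderiv f) A = id_blinfun"
proof -
  obtain u v where "u * f + v * pderiv f = gcd f (pderiv f)"
    using bezout_coefficients_fst_snd by blast
  then have "u * f + v * pderiv f = 1" using assms(1) by simp
  then have "poly_op (u * f + v * pderiv f) A = poly_op 1 A" by simp
  then have "poly_op v A o\<^sub>L poly_op (pderiv f) A = id_blinfun"
    using assms(2) by (simp add: poly_op_add poly_op_mult blinfun_compose_simps one_pCons)
  then show thesis using that by blast
qed

section \<open>Representations with discrete kernel are immersions\<close>

lemma orthogonal_projection_exists:
  fixes m :: "'e::euclidean_space set"
  assumes "subspace m"
  obtains P where "bounded_linear P" "\<And>x. P x \<in> m" "\<And>x. x \<in> m \<Longrightarrow> P x = x"
    "\<And>x k. k \<in> m \<Longrightarrow> (x - P x) \<bullet> k = 0"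
proof -
  obtain B where B: "B \<subseteq> m" "pairwise orthogonal B" "\<And>x. x \<in> B \<Longrightarrow> norm x = 1" "independent B" "span B = m"
    using orthonormal_basis_subspace[OF assms] by metis
  have fin: "finite B" using B(4) independent_imp_finite by blast
  define P where "P x = (\<Sum>u\<in>B. (x \<bullet> u) *\<^sub>R u)" for x
  have bl: "bounded_linear P"
    unfolding P_def by (intro bounded_linear_sum bounded_linear_compose[OF bounded_linear_scaleR_left bounded_linear_inner_left])
  have Pm: "P x \<in> m" for x
    unfolding P_def using B(1) assms by (intro subspace_sum subspace_scale) auto
  have orthB: "(x - P x) \<bullet> w = 0" if w: "w \<in> B" for x w
  proof -
    have "P x \<bullet> w = (\<Sum>u\<in>B. (x \<bullet> u) * (u \<bullet> w))" unfolding P_def by (simp add: inner_sum_left)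
    also have "\<dots> = (\<Sum>u\<in>B. if u = w then x \<bullet> u else 0)"
    proof (rule sum.cong[OF refl])
      fix u assume "u \<in> B"
      then show "(x \<bullet> u) * (u \<bullet> w) = (if u = w then x \<bullet> u else 0)"
        using B(2,3) w by (auto simp: pairwise_def orthogonal_def norm_eq_1)
    qed
    also have "\<dots> = x \<bullet> w" using w fin by simp
    finally show ?thesis by (simp add: inner_diff_left)
  qed
  have orth: "(x - P x) \<bullet> k = 0" if "k \<in> m" for x k
    using orthogonal_to_span[of k B "x - P x"] that B(5) orthB by (simp add: orthogonal_def)
  have "P x = x" if "x \<in> m" for x
  proof -
    have "x - P x \<in> m" using that Pm assms by (simp add: subspace_diff)
    then have "(x - P x) \<bullet> (x - P x) = 0" by (rule orth)
    then show ?thesis by simp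
  qed
  then show thesis using that[OF bl Pm _ orth] by blast
qed

locale lie_rep =
  fixes G :: "('a, 'm) monoid_scheme"
    and M :: "('a, 'e::euclidean_space) manifold"
    and \<rho> :: "'a \<Rightarrow> ('v::real_normed_vector \<Rightarrow>\<^sub>L 'v)"
  assumes lie: "lie_group G M"
    and connected: "connected_space (mtop M)"
    and finite_dim: "\<exists>B :: 'v set. finite B \<and> span B = UNIV"
    and rep: "lie_representation G M \<rho>"
    and discrete: "subtopology (mtop M) (kernel G GL \<rho>) = discrete_topology (kernel G GL \<rho>)"
begin

lemma group_G: "group G" and manifold_M: "smooth_manifold M" and topspace_M: "topspace (mtop M) = carrier G"
  using lie unfolding lie_group_def by auto

lemma subspace_model: "subspace (model M)"
  using smooth_manifoldD(1)[OF manifold_M] .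

lemma separating:
  fixes A :: "'v \<Rightarrow>\<^sub>L 'v"
  assumes "A \<noteq> 0" shows "\<exists>\<Lambda> :: ('v \<Rightarrow>\<^sub>L 'v) \<Rightarrow> real. bounded_linear \<Lambda> \<and> \<Lambda> A \<noteq> 0"
  using finite_dim finite_dim_operator_functional[OF _ _ assms] by metis

lemma plot_mult:
  "plot M S c \<Longrightarrow> plot M S d \<Longrightarrow> plot M S (\<lambda>x. c x \<otimes>\<^bsub>G\<^esub> d x)"
  using plot_smooth_map_prod[OF manifold_M manifold_M manifold_M, of "\<lambda>(g, h). g \<otimes>\<^bsub>G\<^esub> h" S c d]
    lie unfolding lie_group_def by simp

lemma plot_inv: "plot M S c \<Longrightarrow> plot M S (\<lambda>x. inv\<^bsub>G\<^esub> (c x))"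
  using plot_smooth_map[OF manifold_M manifold_M, of "\<lambda>g. inv\<^bsub>G\<^esub> g" S c]
    lie unfolding lie_group_def by simp

lemma plot_constant: "g \<in> carrier G \<Longrightarrow> plot M S (\<lambda>_. g)"
  using plot_const[OF manifold_M] topspace_M by simp

lemma plot_carrier: "plot M S c \<Longrightarrow> x \<in> S \<Longrightarrow> c x \<in> carrier G"
  using plot_topspace[OF manifold_M] topspace_M by blast

lemma plot_conj: "plot M S c \<Longrightarrow> plot M S d \<Longrightarrow> plot M S (\<lambda>x. conj_map G (c x) (d x))"
  unfolding conj_map_def by (intro plot_mult plot_inv)

lemma rho_plot: "plot M S c \<Longrightarrow> smooth_on S (\<lambda>x. \<rho> (c x))"
  using plot_smooth_fun[OF manifold_M] rep unfolding lie_representation_def by blast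

lemma rho_mult: "g \<in> carrier G \<Longrightarrow> h \<in> carrier G \<Longrightarrow> \<rho> (g \<otimes>\<^bsub>G\<^esub> h) = (\<rho> g o\<^sub>L \<rho> h)"
  using rep hom_mult[of \<rho> G GL] unfolding lie_representation_def GL_def by simp

lemma rho_one: "\<rho> \<one>\<^bsub>G\<^esub> = id_blinfun"
proof -
  interpret group G by (rule group_G)
  have "\<rho> \<one>\<^bsub>G\<^esub> \<in> carrier GL"
    using rep unfolding lie_representation_def hom_def by auto
  then obtain B where B: "B o\<^sub>L \<rho> \<one>\<^bsub>G\<^esub> = id_blinfun" by (auto simp: GL_def)
  have "\<rho> \<one>\<^bsub>G\<^esub> = (B o\<^sub>L \<rho> \<one>\<^bsub>G\<^esub>) o\<^sub>L \<rho> \<one>\<^bsub>G\<^esub>" by (simp add: B blinfun_compose_simps)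
  also have "\<dots> = B o\<^sub>L \<rho> \<one>\<^bsub>G\<^esub>"
    using rho_mult[OF one_closed one_closed] by (simp add: blinfun_compose_assoc)
  also have "\<dots> = id_blinfun" by (simp add: B)
  finally show ?thesis .
qed

lemma rho_inv:
  assumes "g \<in> carrier G"
  shows "\<rho> g o\<^sub>L \<rho> (inv\<^bsub>G\<^esub> g) = id_blinfun" "\<rho> (inv\<^bsub>G\<^esub> g) o\<^sub>L \<rho> g = id_blinfun"
proof -
  interpret group G by (rule group_G)
  show "\<rho> g o\<^sub>L \<rho> (inv\<^bsub>G\<^esub> g) = id_blinfun" "\<rho> (inv\<^bsub>G\<^esub> g) o\<^sub>L \<rho> g = id_blinfun"
    using assms by (simp_all add: rho_one flip: rho_mult)
qed

lemma rho_conj: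
  assumes "g \<in> carrier G" "h \<in> carrier G"
  shows "\<rho> (conj_map G g h) = (\<rho> g o\<^sub>L \<rho> h o\<^sub>L \<rho> (inv\<^bsub>G\<^esub> g))"
proof -
  interpret group G by (rule group_G)
  show ?thesis using assms by (simp add: conj_map_def rho_mult)
qed

end

text \<open>A chart \<open>\<phi>\<close> at the identity, a smooth extension \<open>h\<close> of \<open>\<rho>\<close> in this chart, and the
  orthogonal projection \<open>P\<close> onto the model space. The projection extends maps between model spaces
  to the whole Euclidean space, where the inverse function theorem applies.\<close>

locale lie_rep_chart = lie_rep G M \<rho>
  for G :: "('a, 'm) monoid_scheme"
    and M :: "('a, 'e::euclidean_space) manifold"
    and \<rho> :: "'a \<Rightarrow> ('v::real_normed_vector \<Rightarrow>\<^sub>L 'v)" +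
  fixes U \<phi> Q and h :: "'e \<Rightarrow> ('v \<Rightarrow>\<^sub>L 'v)" and P :: "'e \<Rightarrow> 'e"
  assumes chart: "(U, \<phi>) \<in> max_atlas M" "\<one>\<^bsub>G\<^esub> \<in> U"
    and h: "open Q" "\<phi> \<one>\<^bsub>G\<^esub> \<in> Q" "Cinf Q h" "\<And>x. x \<in> \<phi> ` U \<Longrightarrow> x \<in> Q \<Longrightarrow> h x = \<rho> (inv_into U \<phi> x)"
    and P: "bounded_linear P" "\<And>x. P x \<in> model M" "\<And>x. x \<in> model M \<Longrightarrow> P x = x"
      "\<And>x k. k \<in> model M \<Longrightarrow> (x - P x) \<bullet> k = 0"
begin

definition a where "a = \<phi> \<one>\<^bsub>G\<^esub>"

abbreviation (input) "par \<equiv> inv_into U \<phi>"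

text \<open>The differential of \<open>\<rho>\<close> at the identity in the chart, extended by 0 to the orthogonal
  complement of the model space.\<close>

definition T where "T u = frechet_derivative h (at a) (P u)"

lemmas lc = max_atlas_local_chart[OF chart(1)]
lemmas lcD = local_chartD[OF lc]

lemma a_in: "a \<in> \<phi> ` U" "a \<in> model M" "a \<in> Q"
  unfolding a_def using chart(2) lcD(5) h(2) by auto

lemma par: "par (\<phi> u) = u" if "u \<in> U" for u
  using lcD(3) that by simp

lemma par_a: "par a = \<one>\<^bsub>G\<^esub>"
  unfolding a_def using par chart(2) .

lemma par_plot: "plot M (\<phi> ` U) par"
  by (rule plot_chart_inverse[OF manifold_M chart(1)])

lemma par_carrier: "x \<in> \<phi> ` U \<Longrightarrow> par x \<in> carrier G"
  by (rule plot_carrier[OF par_plot])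

lemma h_derivative: "(h has_derivative frechet_derivative h (at a)) (at a)"
  by (rule Cinf_has_derivative[OF h(3) a_in(3)])

lemma bounded_linear_T: "bounded_linear T"
  unfolding T_def by (rule bounded_linear_compose[OF has_derivative_bounded_linear[OF h_derivative] P(1)])

lemma linear_T: "linear T" using bounded_linear_T bounded_linear.linear by blast

lemma T_P: "T (P u) = T u"
  unfolding T_def using P(2,3) by simp

lemma rho_derivative: "((\<lambda>x. \<rho> (par x)) has_derivative T) (at a within \<phi> ` U)"
proof -
  have "(h has_derivative T) (at a within \<phi> ` U)"
    unfolding has_derivative_within_alt
  proof (intro conjI allI impI)
    show "bounded_linear T" by (rule bounded_linear_T)
    fix e :: real assume "e > 0"
    then obtain d where d: "d > 0" "\<And>y. norm (y - a) < d \<Longrightarrow>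
        norm (h y - h a - frechet_derivative h (at a) (y - a)) \<le> e * norm (y - a)"
      using h_derivative unfolding has_derivative_at_alt by blast
    have "T (y - a) = frechet_derivative h (at a) (y - a)" if "y \<in> \<phi> ` U" for y
      unfolding T_def using P(3)[of "y - a"] that lcD(5) a_in(2) subspace_diff[OF subspace_model] by auto
    then show "\<exists>d>0. \<forall>y\<in>\<phi> ` U. norm (y - a) < d \<longrightarrow> norm (h y - h a - T (y - a)) \<le> e * norm (y - a)"
      using d by auto
  qed
  moreover obtain r where "r > 0" "ball a r \<subseteq> Q" using h(1) a_in(3) open_contains_ball by blast
  ultimately show ?thesis
    using has_derivative_transform_within[of h T a "\<phi> ` U" r "\<lambda>x. \<rho> (par x)"] a_in(1) h(4)
    by (simp add: subset_iff dist_commute)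
qed

text \<open>Left translation carries the derivative of \<open>\<rho>\<close> from the identity to every point of the
  chart; hence the rank of \<open>\<rho>\<close> is constant.\<close>

lemma rho_derivative_translated:
  assumes x0: "x0 \<in> \<phi> ` U"
  obtains J where "((\<lambda>x. \<rho> (par x)) has_derivative (\<lambda>u. \<rho> (par x0) o\<^sub>L T (J u))) (at x0 within \<phi> ` U)"
proof -
  interpret group G by (rule group_G)
  define k where "k = par x0"
  have k: "k \<in> carrier G" unfolding k_def by (rule par_carrier[OF x0])
  define c where "c x = inv\<^bsub>G\<^esub> k \<otimes>\<^bsub>G\<^esub> par x" for x
  have c: "plot M (\<phi> ` U) c"
    unfolding c_def by (intro plot_mult plot_constant par_plot inv_closed k)
  obtain R where R: "open R" "{x \<in> \<phi> ` U. c x \<in> U} = \<phi> ` U \<inter> R"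
    using continuous_map_preimage_open[OF plot_continuous[OF manifold_M c] lcD(1)] .
  have c0: "c x0 = \<one>\<^bsub>G\<^esub>" using k by (simp add: c_def k_def)
  then have "x0 \<in> {x \<in> \<phi> ` U. c x \<in> U}" using x0 chart(2) by simp
  then have x0R: "x0 \<in> R" unfolding R(2) by blast
  have sm: "smooth_on (\<phi> ` U \<inter> R) (\<lambda>x. \<phi> (c x))"
    by (rule plot_chart[OF manifold_M plot_subset[OF c] chart(1)]) (use R(2) in auto)
  obtain O1 j where j: "open O1" "x0 \<in> O1" "Cinf O1 j" "\<And>y. y \<in> \<phi> ` U \<inter> R \<Longrightarrow> y \<in> O1 \<Longrightarrow> j y = \<phi> (c y)"
    using smooth_onE[OF sm] x0 x0R by (metis Int_iff)
  define S where "S = \<phi> ` U \<inter> (R \<inter> O1)"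
  have jS: "j y = \<phi> (c y)" "c y \<in> U" if "y \<in> S" for y
    using j(4) that R(2) unfolding S_def by auto
  have x0S: "x0 \<in> S" using x0 x0R j(2) by (simp add: S_def)
  have j0: "j x0 = a" using jS(1)[OF x0S] c0 by (simp add: a_def)
  define J where "J = frechet_derivative j (at x0)"
  have dj: "(j has_derivative J) (at x0 within S)"
    unfolding J_def using Cinf_has_derivative[OF j(3,2)] has_derivative_at_withinI by blast
  have "((\<lambda>x. \<rho> (par x)) has_derivative T) (at (j x0) within j ` S)"
    unfolding j0 by (rule has_derivative_subset[OF rho_derivative]) (use jS in auto)
  then have "((\<lambda>x. \<rho> (par (j x))) has_derivative (\<lambda>u. T (J u))) (at x0 within S)"
    by (rule has_derivative_in_compose[OF dj])
  then have d1: "((\<lambda>x. \<rho> k o\<^sub>L \<rho> (par (j x))) has_derivative (\<lambda>u. \<rho> k o\<^sub>L T (J u))) (at x0 within S)"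
    by (rule bounded_linear.has_derivative[OF bounded_bilinear.bounded_linear_right[OF bounded_bilinear_blinfun_compose]])
  have eq1: "\<rho> k o\<^sub>L \<rho> (par (j x)) = \<rho> (par x)" if "x \<in> S" for x
  proof -
    have px: "par x \<in> carrier G" using par_carrier that S_def by blast
    have "\<rho> k o\<^sub>L \<rho> (par (j x)) = \<rho> k o\<^sub>L \<rho> (c x)" using jS[OF that] par by simp
    also have "\<dots> = \<rho> (k \<otimes>\<^bsub>G\<^esub> c x)" using k px by (simp add: rho_mult c_def)
    also have "k \<otimes>\<^bsub>G\<^esub> c x = par x" unfolding c_def using k px by (simp flip: m_assoc)
    finally show ?thesis .
  qed
  have "((\<lambda>x. \<rho> (par x)) has_derivative (\<lambda>u. \<rho> k o\<^sub>L T (J u))) (at x0 within S)"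
    by (rule has_derivative_transform_within[OF d1 zero_less_one x0S]) (use eq1 in auto)
  moreover have "at x0 within S = at x0 within \<phi> ` U"
    by (rule at_within_nhd[of _ "R \<inter> O1"]) (use x0R j R in \<open>auto simp: S_def\<close>)
  ultimately show thesis using that by (simp add: k_def)
qed

text \<open>Let \<open>T v = 0\<close>. The component of \<open>x - a\<close> in the kernel of \<open>T\<close> together with \<open>R (\<rho> - 1)\<close>, where \<open>R\<close>
  is a pseudo-inverse of \<open>T\<close>, are new coordinates near \<open>a\<close>. Along the curve that corresponds to the
  line in direction \<open>v\<close> the coordinate \<open>R (\<rho> - 1)\<close> is constant, so \<open>R\<close> kills the derivative of \<open>\<rho>\<close>,
  which then vanishes because the rank is constant. The curve stays in the kernel of \<open>\<rho>\<close>, and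
  discreteness makes it constant.\<close>

theorem T_injective:
  assumes v: "v \<in> model M" "T v = 0"
  shows "v = 0"
proof -
  obtain R where R: "bounded_linear R" "\<And>x. T (R (T x)) = T x" "\<And>y k. T k = 0 \<Longrightarrow> R y \<bullet> k = 0"
    using bounded_pseudo_inverse[OF linear_T separating] by metis
  have linR: "linear R" and linP: "linear P" using R(1) P(1) bounded_linear.linear by blast+
  have R_model: "R y \<in> model M" for y
  proof -
    have "T (R y - P (R y)) = 0" using T_P linear_T by (simp add: linear_diff)
    then have "R y \<bullet> (R y - P (R y)) = 0" by (rule R(3))
    moreover have "(R y - P (R y)) \<bullet> P (R y) = 0" by (rule P(4)[OF P(2)])
    ultimately have "(R y - P (R y)) \<bullet> (R y - P (R y)) = 0"
      by (simp add: inner_diff_right inner_commute)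
    then show ?thesis using P(2)[of "R y"] by simp
  qed
  define S0 where "S0 = (\<lambda>x. a + P (x - a)) -` Q"
  have aff: "Cinf UNIV (\<lambda>x. a + P (x - a))"
  proof -
    have "Cinf UNIV (\<lambda>x. x + - a)"
      by (rule Cinf_add[OF open_UNIV Cinf_bounded_linear[OF bounded_linear_ident] Cinf_const])
    then have "Cinf UNIV (\<lambda>x. P (x + - a))" by (rule Cinf_linear_compose[OF P(1) open_UNIV])
    then have "Cinf UNIV (\<lambda>x. a + P (x + - a))" by (rule Cinf_add[OF open_UNIV Cinf_const])
    then show ?thesis by simp
  qed
  have S0: "open S0" unfolding S0_def
    using open_vimage[OF h(1)] Cinf_continuous[OF aff] by blast
  have aS0: "a \<in> S0" using a_in(3) linear_0[OF linP] by (simp add: S0_def)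
  \<comment> \<open>The derivative of \<open>h (a + P (x - a))\<close> at \<open>a\<close> is \<open>T\<close>, so the terms with \<open>R\<close> cancel to first order
    and \<open>H\<close> has the identity as derivative.\<close>
  define H where "H x = ((x + - a) + - R (T (x + - a))) + R (h (a + P (x - a)) + - id_blinfun)" for x
  have smoothH: "Cinf S0 H"
  proof -
    have 1: "Cinf S0 (\<lambda>x. x + - a)"
      by (rule Cinf_add[OF S0 Cinf_bounded_linear[OF bounded_linear_ident] Cinf_const])
    have 2: "Cinf S0 (\<lambda>x. - R (T (x + - a)))"
      by (rule Cinf_linear_compose[OF bounded_linear_minus[OF bounded_linear_compose[OF R(1) bounded_linear_T]] S0 1])
    have "Cinf S0 (\<lambda>x. h (a + P (x - a)))"
      by (rule Cinf_compose[OF S0 h(1) _ Cinf_subset[OF aff] h(3)]) (auto simp: S0_def)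
    then have "Cinf S0 (\<lambda>x. h (a + P (x - a)) + - id_blinfun)"
      by (rule Cinf_add[OF S0 _ Cinf_const])
    then have "Cinf S0 (\<lambda>x. R (h (a + P (x - a)) + - id_blinfun))"
      by (rule Cinf_linear_compose[OF R(1) S0])
    then show ?thesis unfolding H_def by (intro Cinf_add[OF S0] 1 2)
  qed
  have derH: "(H has_derivative (\<lambda>u. u)) (at a)"
  proof -
    have "((\<lambda>x. a + P (x - a)) has_derivative (\<lambda>u. 0 + P (u - 0))) (at a)"
      by (intro has_derivative_add has_derivative_const bounded_linear.has_derivative[OF P(1)]
          has_derivative_diff has_derivative_ident)
    moreover have "(h has_derivative frechet_derivative h (at a)) (at (a + P (a - a)))"
      using h_derivative linear_0[OF linP] by simp
    ultimately have "((\<lambda>x. h (a + P (x - a))) has_derivative (\<lambda>u. frechet_derivative h (at a) (0 + P (u - 0)))) (at a)"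
      by (rule has_derivative_compose)
    then have hT: "((\<lambda>x. h (a + P (x - a))) has_derivative T) (at a)" by (simp add: T_def[abs_def])
    have 1: "((\<lambda>x. x + - a) has_derivative (\<lambda>u. u + 0)) (at a)"
      by (intro has_derivative_add has_derivative_const has_derivative_ident)
    have "(H has_derivative (\<lambda>u. ((u + 0) + - R (T (u + 0))) + R (T u + 0))) (at a)"
      unfolding H_def
      by (intro has_derivative_add has_derivative_minus bounded_linear.has_derivative[OF R(1)]
         bounded_linear.has_derivative[OF bounded_linear_T] has_derivative_const has_derivative_ident hT)
    then show ?thesis by simp
  qed
  have Ha: "H a = 0"
    using linear_0[OF linR] linear_0[OF linear_T] linear_0[OF linP] h(4)[OF a_in(1,3)] par_a rho_one
    by (simp add: H_def)
  obtain P0 Q0 g where g: "open P0" "P0 \<subseteq> S0" "a \<in> P0" "open Q0" "H a \<in> Q0" "homeomorphism P0 Q0 H g" "Cinf Q0 g"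
    by (rule smooth_inverse_function[OF S0 smoothH aS0 derH]) auto
  have g0: "g 0 = a" using g(3,6) Ha by (metis homeomorphism_apply1)
  obtain KR where KR: "KR > 0" "\<And>x. norm (R x) \<le> norm x * KR" using bounded_linear.pos_bounded[OF R(1)] by blast
  obtain KT where KT: "KT > 0" "\<And>x. norm (T x) \<le> norm x * KT" using bounded_linear.pos_bounded[OF bounded_linear_T] by blast
  \<comment> \<open>As long as \<open>\<rho> g\<close> differs from the identity by less than \<open>e\<close>, the map \<open>R\<close> is injective on
    \<open>\<rho> g\<close> composed with the range of \<open>T\<close>.\<close>
  define e where "e = 1 / (KR * KT)"
  have e: "e > 0" using KR KT by (simp add: e_def)
  obtain Om where Om: "open Om" "\<phi> ` U = model M \<inter> Om" using lcD(4) by (auto simp: openin_open)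
  \<comment> \<open>Discreteness of the kernel enters through \<open>W\<close>.\<close>
  obtain W where W: "openin (mtop M) W" "W \<inter> kernel G GL \<rho> = {\<one>\<^bsub>G\<^esub>}"
  proof -
    interpret group G by (rule group_G)
    have "\<one>\<^bsub>G\<^esub> \<in> kernel G GL \<rho>" using rho_one by (simp add: kernel_def GL_def)
    then have "openin (subtopology (mtop M) (kernel G GL \<rho>)) {\<one>\<^bsub>G\<^esub>}" by (simp add: discrete)
    then show thesis using that by (auto simp: openin_subtopology)
  qed
  obtain OW where OW: "open OW" "\<phi> ` (U \<inter> W) = \<phi> ` U \<inter> OW" using local_chart_image_open[OF lc W(1)] .
  define O2 where "O2 = {x \<in> Q \<inter> Om \<inter> OW. norm (h x - id_blinfun) < e}"
  have O2: "open O2"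
  proof -
    have "continuous_on (Q \<inter> Om \<inter> OW) (\<lambda>x. norm (h x - id_blinfun))"
      by (intro continuous_intros continuous_on_subset[OF Cinf_continuous[OF h(3)]]) auto
    then have "open ((Q \<inter> Om \<inter> OW) \<inter> (\<lambda>x. norm (h x - id_blinfun)) -` {..<e})"
      by (rule continuous_open_preimage[OF _ _ open_lessThan]) (intro open_Int h(1) Om(1) OW(1))
    moreover have "(Q \<inter> Om \<inter> OW) \<inter> (\<lambda>x. norm (h x - id_blinfun)) -` {..<e} = O2"
      unfolding O2_def by blast
    ultimately show ?thesis by simp
  qed
  have aO2: "a \<in> O2"
  proof -
    have "\<one>\<^bsub>G\<^esub> \<in> W" using W(2) by blast
    then have "a \<in> \<phi> ` (U \<inter> W)" unfolding a_def using chart(2) by blast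
    then show ?thesis using OW(2) a_in Om(2) h(4)[OF a_in(1,3)] par_a rho_one e by (auto simp: O2_def)
  qed
  have "open ((\<lambda>t. t *\<^sub>R v) -` (Q0 \<inter> g -` O2))"
    by (intro open_vimage continuous_open_preimage[OF Cinf_continuous[OF g(7)] g(4) O2] continuous_intros)
  moreover have "0 \<in> (\<lambda>t. t *\<^sub>R v) -` (Q0 \<inter> g -` O2)" using g(5) Ha g0 aO2 by simp
  ultimately obtain \<delta> where \<delta>: "\<delta> > 0" "ball 0 \<delta> \<subseteq> (\<lambda>t. t *\<^sub>R v) -` (Q0 \<inter> g -` O2)"
    using open_contains_ball by blast
  define I where "I = ball (0::real) \<delta>"
  define c where "c t = g (t *\<^sub>R v)" for t
  have cQ: "t *\<^sub>R v \<in> Q0" "c t \<in> O2" if "t \<in> I" for t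
    using \<delta>(2) that by (auto simp: c_def I_def subset_iff)
  have Hc: "H (c t) = t *\<^sub>R v" if "t \<in> I" for t
    unfolding c_def using g(6) cQ(1)[OF that] by (simp add: homeomorphism_apply2)
  have cm: "c t - a \<in> model M" if "t \<in> I" for t
  proof -
    have "c t - a = t *\<^sub>R v + R (T (c t - a)) - R (h (a + P (c t - a)) - id_blinfun)"
      using Hc[OF that] by (simp add: H_def algebra_simps)
    then show ?thesis
      using subspace_add[OF subspace_model] subspace_diff[OF subspace_model] R_model
        subspace_scale[OF subspace_model v(1)] by metis
  qed
  have cU: "c t \<in> \<phi> ` U" "c t \<in> Q" if "t \<in> I" for t
  proof -
    have "c t = a + (c t - a)" by simp
    then have "c t \<in> model M" using subspace_add[OF subspace_model a_in(2) cm[OF that]] by simp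
    then show "c t \<in> \<phi> ` U" "c t \<in> Q" using Om(2) cQ(2)[OF that] by (auto simp: O2_def)
  qed
  define F where "F x = \<rho> (par x)" for x
  have hF: "h (a + P (c t - a)) = F (c t)" if "t \<in> I" for t
    using P(3)[OF cm[OF that]] h(4)[OF cU[OF that]] by (simp add: F_def)
  have zero: "((\<lambda>t. F (c t)) has_derivative (\<lambda>s. 0)) (at t within I)" if t: "t \<in> I" for t
  proof -
    define c' where "c' s = frechet_derivative g (at (t *\<^sub>R v)) (s *\<^sub>R v)" for s
    have dc: "(c has_derivative c') (at t within I)"
    proof -
      have "((\<lambda>t. t *\<^sub>R v) has_derivative (\<lambda>s. s *\<^sub>R v)) (at t within I)"
        by (auto intro!: derivative_eq_intros)
      then show ?thesis unfolding c_def[abs_def] c'_def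
        by (rule has_derivative_compose[where g = g and f = "\<lambda>t. t *\<^sub>R v", OF _ Cinf_has_derivative[OF g(7) cQ(1)[OF t]]])
    qed
    obtain J where J: "(F has_derivative (\<lambda>u. \<rho> (par (c t)) o\<^sub>L T (J u))) (at (c t) within \<phi> ` U)"
      using rho_derivative_translated[OF cU(1)[OF t]] unfolding F_def by blast
    define w where "w s = (\<rho> (par (c t)) o\<^sub>L T (J (c' s)))" for s
    have dF: "((\<lambda>t. F (c t)) has_derivative w) (at t within I)"
      unfolding w_def by (rule has_derivative_in_compose[OF dc has_derivative_subset[OF J]]) (use cU in auto)
    \<comment> \<open>Differentiate \<open>H (c t) = t v\<close>; applying \<open>T\<close> to the result leaves \<open>T (R (w s)) = 0\<close>.\<close>
    have "((\<lambda>t. ((c t + - a) + - R (T (c t + - a))) + R (F (c t) + - id_blinfun)) has_derivative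
        (\<lambda>s. ((c' s + 0) + - R (T (c' s + 0))) + R (w s + 0))) (at t within I)"
      by (intro has_derivative_add has_derivative_minus bounded_linear.has_derivative[OF R(1)]
         bounded_linear.has_derivative[OF bounded_linear_T] has_derivative_const dc dF)
    then have "((\<lambda>t. t *\<^sub>R v) has_derivative (\<lambda>s. ((c' s + 0) + - R (T (c' s + 0))) + R (w s + 0))) (at t within I)"
      by (rule has_derivative_transform_within[OF _ zero_less_one t]) (use Hc hF in \<open>auto simp: H_def\<close>)
    then have d1: "((\<lambda>t. t *\<^sub>R v) has_derivative (\<lambda>s. ((c' s + 0) + - R (T (c' s + 0))) + R (w s + 0))) (at t)"
      using t by (simp add: I_def at_within_open[OF _ open_ball])
    have d2: "((\<lambda>t. t *\<^sub>R v) has_derivative (\<lambda>s. s *\<^sub>R v)) (at t)"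
      by (auto intro!: derivative_eq_intros)
    have eq: "(\<lambda>s. c' s - R (T (c' s)) + R (w s)) = (\<lambda>s. s *\<^sub>R v)"
      using has_derivative_unique[OF d1 d2] by simp
    have "w s = 0" for s
    proof -
      have "c' s - R (T (c' s)) + R (w s) = s *\<^sub>R v" using eq by (rule fun_cong)
      then have "T (c' s - R (T (c' s)) + R (w s)) = T (s *\<^sub>R v)" by simp
      then have "T (c' s) - T (R (T (c' s))) + T (R (w s)) = s *\<^sub>R T v"
        by (simp only: linear_add[OF linear_T] linear_diff[OF linear_T] linear_scale[OF linear_T])
      then have "T (R (w s)) = 0" using R(2) v(2) by simp
      then have "R (w s) \<bullet> R (w s) = 0" by (rule R(3))
      then have Rw: "R (w s) = 0" by simp
      define y where "y = R (T (J (c' s)))"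
      have Ty: "T y = T (J (c' s))" and RTy: "R (T y) = y" by (simp_all add: y_def R(2))
      have wy: "w s = \<rho> (par (c t)) o\<^sub>L T y" by (simp add: w_def Ty)
      have "y = 0"
      proof (rule ccontr)
        assume "y \<noteq> 0"
        have "R ((\<rho> (par (c t)) - id_blinfun) o\<^sub>L T y) = R (w s) - R (T y)"
          by (simp add: wy blinfun_compose_simps linear_diff[OF linR])
        then have "norm y = norm (R ((\<rho> (par (c t)) - id_blinfun) o\<^sub>L T y))" by (simp add: Rw RTy)
        also have "\<dots> \<le> norm ((\<rho> (par (c t)) - id_blinfun) o\<^sub>L T y) * KR" by (rule KR(2))
        also have "\<dots> \<le> (norm (\<rho> (par (c t)) - id_blinfun) * norm (T y)) * KR"
          using KR(1) by (intro mult_right_mono norm_blinfun_compose) simp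
        also have "\<dots> \<le> (norm (\<rho> (par (c t)) - id_blinfun) * (norm y * KT)) * KR"
          using KR(1) KT(2) by (intro mult_right_mono mult_left_mono) auto
        also have "\<dots> < (e * (norm y * KT)) * KR"
        proof -
          have "norm (h (c t) - id_blinfun) < e" using cQ(2)[OF t] by (simp add: O2_def)
          then have "norm (\<rho> (par (c t)) - id_blinfun) < e" using h(4)[OF cU[OF t]] by simp
          then show ?thesis using \<open>y \<noteq> 0\<close> KT(1) KR(1) by (intro mult_strict_right_mono) auto
        qed
        also have "\<dots> = norm y" using KT(1) KR(1) by (simp add: e_def)
        finally show False by simp
      qed
      then show "w s = 0" using wy linear_0[OF linear_T] by (simp add: blinfun_compose_simps)
    qed
    then have "w = (\<lambda>s. 0)" by blast
    then show ?thesis using dF by simp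
  qed
  have "convex I" by (simp add: I_def)
  then obtain A where A: "\<And>t. t \<in> I \<Longrightarrow> F (c t) = A"
    using has_derivative_zero_constant[OF _ zero] by blast
  have 0: "0 \<in> I" using \<delta>(1) by (simp add: I_def)
  have "F (c 0) = id_blinfun" using par_a rho_one g0 by (simp add: F_def c_def)
  then have A1: "A = id_blinfun" using A[OF 0] by simp
  have half: "\<delta> / 2 \<in> I" using \<delta>(1) by (simp add: I_def)
  let ?x = "c (\<delta> / 2)"
  have "par ?x \<in> kernel G GL \<rho>"
    using A[OF half] A1 par_carrier[OF cU(1)[OF half]] by (simp add: kernel_def GL_def F_def)
  moreover have "par ?x \<in> W"
  proof -
    have "?x \<in> \<phi> ` (U \<inter> W)" using OW(2) cU(1)[OF half] cQ(2)[OF half] by (auto simp: O2_def)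
    then show ?thesis using par by auto
  qed
  ultimately have "par ?x \<in> W \<inter> kernel G GL \<rho>" by (rule IntI[rotated])
  then have "par ?x = par a" using W(2) par_a by simp
  then have "?x = a" using inv_into_injective[OF _ cU(1)[OF half] a_in(1)] by blast
  then have "(\<delta> / 2) *\<^sub>R v = 0" using Hc[OF half] Ha by simp
  then show ?thesis using \<delta>(1) by simp
qed

end

section \<open>Slices\<close>

lemma injective_endomorphism_onto:
  fixes K :: "'e::euclidean_space \<Rightarrow> 'e"
  assumes K: "linear K" and I: "subspace I" and KI: "K ` I \<subseteq> I" and inj: "inj_on K I"
  shows "K ` I = I"
proof -
  have "dim (K ` I) = dim I"
    using dim_image_eq[OF K, of I] inj by (simp add: span_eq_iff[THEN iffD2, OF I])
  then show ?thesis
    using subspace_dim_equal[OF linear_subspace_image[OF K I] I KI] by simp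
qed

context lie_rep_chart
begin

text \<open>Near \<open>p\<close> every point is \<open>y \<cdot> x\<close> with \<open>y\<close> near the identity, from a complement of the
  stabilizer directions, and \<open>x\<close> in the directions \<open>ker K\<close> transversal to the orbit, where \<open>K\<close>
  is the derivative of the orbit map in coordinates. As \<open>E\<close> is equivariant,
  \<open>T (K u) S\<close> is the commutator of \<open>T u\<close> with \<open>A = E p\<close>. Since \<open>f A = 0\<close> and
  \<open>f' A\<close> is invertible, a commutator with \<open>A\<close> that commutes with \<open>A\<close> vanishes; hence \<open>ker K\<close> is
  indeed a complement of the image of \<open>K\<close>. The derivative of \<open>f \<circ> E\<close> along \<open>ker K\<close> is
  multiplication by \<open>f' A\<close>, so \<open>x = p\<close> is the only zero of \<open>f \<circ> E\<close> on the slice.\<close>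

theorem slice:
  fixes N :: "('b, 'e) manifold" and act :: "'a \<Rightarrow> 'b \<Rightarrow> 'b" and E :: "'b \<Rightarrow> ('v \<Rightarrow>\<^sub>L 'v)"
    and S :: "'v \<Rightarrow>\<^sub>L 'v"
  assumes N: "smooth_manifold N" and model_N: "model N = model M"
    and act_plot: "\<And>(D :: ('e \<times> 'e) set) c d. plot M D c \<Longrightarrow> plot N D d \<Longrightarrow> plot N D (\<lambda>x. act (c x) (d x))"
    and act_one: "\<And>q. q \<in> topspace (mtop N) \<Longrightarrow> act \<one>\<^bsub>G\<^esub> q = q"
    and equivariant: "\<And>g q. g \<in> carrier G \<Longrightarrow> q \<in> topspace (mtop N) \<Longrightarrow>
        E (act g q) = (\<rho> g o\<^sub>L E q o\<^sub>L \<rho> (inv\<^bsub>G\<^esub> g))"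
    and V: "(V, \<psi>) \<in> max_atlas N" "p \<in> V"
    and E_derivative: "((\<lambda>x. E (inv_into V \<psi> x)) has_derivative (\<lambda>u. T u o\<^sub>L S)) (at (\<psi> p) within \<psi> ` V)"
    and S: "S o\<^sub>L S' = id_blinfun" "S o\<^sub>L E p = E p o\<^sub>L S"
    and f: "coprime f (pderiv f)" "poly_op f (E p) = 0"
  obtains V' \<theta> L where "(V', \<theta>) \<in> max_atlas N" "p \<in> V'" "subspace L" "L \<subseteq> model N"
    "\<And>v. v \<in> V' \<Longrightarrow> \<theta> v \<in> L \<longleftrightarrow> poly_op f (E v) = 0"
    "\<And>v. v \<in> V' \<Longrightarrow> poly_op f (E v) = 0 \<Longrightarrow> \<exists>g\<in>carrier G. v = act g p"
proof -
  define A where "A = E p"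
  define q where "q = \<psi> p"
  note lcV = max_atlas_local_chart[OF V(1)]
  note VD = local_chartD[OF lcV]
  have q: "q \<in> \<psi> ` V" "q \<in> model M" using V(2) VD(5) model_N by (auto simp: q_def)
  have inv_V: "inv_into V \<psi> (\<psi> v) = v" if "v \<in> V" for v using VD(3) that by simp
  have inv_q: "inv_into V \<psi> q = p" unfolding q_def using inv_V V(2) .
  have linP: "linear P" using P(1) bounded_linear.linear by blast
  obtain O1 where O1: "open O1" "\<phi> ` U = model M \<inter> O1" using lcD(4) by (auto simp: openin_open)
  obtain O2 where O2: "open O2" "\<psi> ` V = model M \<inter> O2" using VD(4) model_N by (auto simp: openin_open)

  define D0 where "D0 = \<phi> ` U \<times> \<psi> ` V"
  define \<kappa> where "\<kappa> z = act (par (fst z)) (inv_into V \<psi> (snd z))" for z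
  have plot_fst: "plot M D0 (\<lambda>z. par (fst z))"
    by (rule plot_compose[OF par_plot smooth_on_bounded_linear[OF bounded_linear_fst]]) (auto simp: D0_def)
  have plot_snd: "plot N D0 (\<lambda>z. inv_into V \<psi> (snd z))"
    by (rule plot_compose[OF plot_chart_inverse[OF N V(1)] smooth_on_bounded_linear[OF bounded_linear_snd]])
       (auto simp: D0_def)
  have plot_\<kappa>: "plot N D0 \<kappa>"
    unfolding \<kappa>_def by (rule act_plot[OF plot_fst plot_snd])
  obtain QV where QV: "open QV" "{z \<in> D0. \<kappa> z \<in> V} = D0 \<inter> QV"
    using continuous_map_preimage_open[OF plot_continuous[OF N plot_\<kappa>] VD(1)] .
  have aq: "(a, q) \<in> D0" "\<kappa> (a, q) = p"
    using a_in(1) q(1) act_one V(2) VD(2) by (auto simp: D0_def \<kappa>_def par_a inv_q)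
  have "(a, q) \<in> {z \<in> D0. \<kappa> z \<in> V}" using aq V(2) by simp
  then have aqQ: "(a, q) \<in> D0 \<inter> QV" using QV(2) by blast
  have "smooth_on (D0 \<inter> QV) (\<lambda>z. \<psi> (\<kappa> z))"
    by (rule plot_chart[OF N plot_subset[OF plot_\<kappa>] V(1)]) (use QV(2) in auto)
  then obtain QK k0 where k0: "open QK" "(a, q) \<in> QK" "Cinf QK k0"
    "\<And>z. z \<in> D0 \<inter> QV \<Longrightarrow> z \<in> QK \<Longrightarrow> k0 z = \<psi> (\<kappa> z)"
    using smooth_onE[OF _ aqQ] by metis
  \<comment> \<open>The action in the charts, extended smoothly off the model space; \<open>P\<close> keeps the values of the
    extension in the model.\<close>
  define k where "k z = P (k0 z)" for z
  have k_smooth: "Cinf QK k" unfolding k_def by (rule Cinf_linear_compose[OF P(1) k0(1,3)])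
  define Om where "Om = QK \<inter> QV \<inter> (O1 \<times> O2)"
  have Om: "open Om" "(a, q) \<in> Om"
    unfolding Om_def using k0(1,2) QV(1) O1 O2 aqQ by (auto simp: D0_def intro!: open_Times open_Int)
  have inOO: "z \<in> D0" "\<kappa> z \<in> V" "k z = \<psi> (\<kappa> z)" "k z \<in> \<psi> ` V"
    if "z \<in> Om" "fst z \<in> model M" "snd z \<in> model M" for z
  proof -
    show z: "z \<in> D0" using that O1(2) O2(2) by (auto simp: Om_def D0_def mem_Times_iff)
    then show zV: "\<kappa> z \<in> V" using QV(2) that(1) by (auto simp: Om_def)
    have "k0 z = \<psi> (\<kappa> z)" using k0(4) z that(1) by (auto simp: Om_def)
    moreover have "\<psi> (\<kappa> z) \<in> model M" using zV VD(5) model_N by blast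
    ultimately show "k z = \<psi> (\<kappa> z)" using P(3) by (simp add: k_def)
    then show "k z \<in> \<psi> ` V" using zV by simp
  qed
  have k_aq: "k (a, q) = q" using inOO(3)[OF Om(2)] a_in(2) q(2) aq(2) by (simp add: q_def)

  define D where "D = frechet_derivative k (at (a, q))"
  have derk: "(k has_derivative D) (at (a, q))"
    unfolding D_def by (rule Cinf_has_derivative[OF k_smooth k0(2)])
  have linD: "linear D" using derk has_derivative_linear by blast
  have D_model: "D z \<in> model M" for z
  proof -
    have "(k0 has_derivative frechet_derivative k0 (at (a, q))) (at (a, q))"
      by (rule Cinf_has_derivative[OF k0(3,2)])
    from bounded_linear.has_derivative[OF P(1) this] have
      "(k has_derivative (\<lambda>z. P (frechet_derivative k0 (at (a, q)) z))) (at (a, q))"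
      by (simp add: k_def[abs_def])
    then have "D = (\<lambda>z. P (frechet_derivative k0 (at (a, q)) z))" using has_derivative_unique derk by blast
    then show ?thesis using P(2) by simp
  qed
  define K where "K u = D (u, 0)" for u
  have linK: "linear K"
    unfolding K_def by (rule linearI) (use linD in \<open>simp_all flip: linear_add linear_scale\<close>)
  have K_model: "K u \<in> model M" for u by (simp add: K_def D_model)
  have line: "\<exists>\<delta>>0. \<forall>t. \<bar>t\<bar> < \<delta> \<longrightarrow> (a, q) + t *\<^sub>R z \<in> Om" for z :: "'e \<times> 'e"
  proof -
    have "open ((\<lambda>t. (a, q) + t *\<^sub>R z) -` Om)"
      by (rule open_vimage[OF Om(1)]) (intro continuous_intros)
    moreover have "0 \<in> (\<lambda>t. (a, q) + t *\<^sub>R z) -` Om" using Om(2) by simp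
    ultimately obtain \<delta> where "\<delta> > 0" "ball 0 \<delta> \<subseteq> (\<lambda>t. (a, q) + t *\<^sub>R z) -` Om"
      using open_contains_ball by blast
    then show ?thesis by (intro exI[of _ \<delta>]) (auto simp: subset_iff dist_norm)
  qed
  have der_line: "((\<lambda>t. k ((a, q) + t *\<^sub>R z)) has_derivative (\<lambda>t. D (t *\<^sub>R z))) (at 0 within I)" for z I
  proof -
    have "((\<lambda>t. (a, q) + t *\<^sub>R z) has_derivative (\<lambda>t. t *\<^sub>R z)) (at 0 within I)"
      by (auto intro!: derivative_eq_intros)
    then show ?thesis
      by (rule has_derivative_compose[where f = "\<lambda>t. (a, q) + t *\<^sub>R z" and g = k]) (use derk in simp)
  qed
  have D_snd: "D (0, w) = w" if w: "w \<in> model M" for w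
  proof -
    obtain \<delta> where \<delta>: "\<delta> > 0" "\<And>t. \<bar>t\<bar> < \<delta> \<Longrightarrow> (a, q) + t *\<^sub>R (0, w) \<in> Om" using line by metis
    have kline: "k ((a, q) + t *\<^sub>R (0, w)) = q + t *\<^sub>R w" if "\<bar>t\<bar> < \<delta>" for t
    proof -
      have m: "q + t *\<^sub>R w \<in> model M"
        using subspace_add[OF subspace_model q(2) subspace_scale[OF subspace_model w]] .
      let ?z = "(a, q) + t *\<^sub>R (0, w)"
      have z: "?z = (a, q + t *\<^sub>R w)" by simp
      have *: "?z \<in> D0" "\<kappa> ?z \<in> V" "k ?z = \<psi> (\<kappa> ?z)"
        using inOO[OF \<delta>(2)[OF that]] m a_in(2) by (simp_all add: z)
      have xV: "q + t *\<^sub>R w \<in> \<psi> ` V" using *(1) by (simp add: D0_def)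
      define v where "v = inv_into V \<psi> (q + t *\<^sub>R w)"
      have v: "v \<in> V" "\<psi> v = q + t *\<^sub>R w"
        unfolding v_def using inv_into_into[OF xV] f_inv_into_f[OF xV] by auto
      have "\<kappa> ?z = v" using act_one v(1) VD(2) by (auto simp: \<kappa>_def v_def par_a)
      then show ?thesis using *(3) v(2) by simp
    qed
    have 1: "((\<lambda>t. k ((a, q) + t *\<^sub>R (0, w))) has_derivative (\<lambda>t. D (t *\<^sub>R (0, w)))) (at 0)"
      by (rule der_line)
    have 2: "((\<lambda>t. q + t *\<^sub>R w) has_derivative (\<lambda>t. D (t *\<^sub>R (0, w)))) (at 0)"
      by (rule has_derivative_transform_within[OF 1 \<delta>(1)]) (use kline in \<open>auto simp: dist_norm\<close>)
    have 3: "((\<lambda>t. q + t *\<^sub>R w) has_derivative (\<lambda>t. t *\<^sub>R w)) (at 0)"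
      by (auto intro!: derivative_eq_intros)
    show ?thesis using fun_cong[OF has_derivative_unique[OF 2 3], of 1] by simp
  qed

  \<comment> \<open>Differentiate \<open>E (y \<cdot> p) \<rho> y = \<rho> y E p\<close> at \<open>y = 1\<close>.\<close>
  define e where "e x = E (inv_into V \<psi> x)" for x
  have der_e: "(e has_derivative (\<lambda>u. T u o\<^sub>L S)) (at q within \<psi> ` V)"
    using E_derivative by (simp add: e_def[abs_def] q_def)
  have e_q: "e q = A" by (simp add: e_def inv_q A_def)
  have e_\<kappa>: "e (\<psi> (\<kappa> z)) = (\<rho> (par (fst z)) o\<^sub>L e (snd z) o\<^sub>L \<rho> (inv\<^bsub>G\<^esub> (par (fst z))))"
    if z: "z \<in> D0" "\<kappa> z \<in> V" for z
  proof -
    have "fst z \<in> \<phi> ` U" and x: "snd z \<in> \<psi> ` V" using z(1) by (auto simp: D0_def)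
    then have "par (fst z) \<in> carrier G" using par_carrier by blast
    moreover have "inv_into V \<psi> (snd z) \<in> topspace (mtop N)" using inv_into_into[OF x] VD(2) by blast
    ultimately show ?thesis using inv_V[OF z(2)] equivariant by (simp add: e_def \<kappa>_def)
  qed
  have commutator: "(T (K u) o\<^sub>L S) = (T u o\<^sub>L A) - (A o\<^sub>L T u)" if u: "u \<in> model M" for u
  proof -
    obtain \<delta> where \<delta>: "\<delta> > 0" "\<And>t. \<bar>t\<bar> < \<delta> \<Longrightarrow> (a, q) + t *\<^sub>R (u, 0) \<in> Om" using line by metis
    define I where "I = ball (0::real) \<delta>"
    define c1 where "c1 t = a + t *\<^sub>R u" for t
    define c2 where "c2 t = k ((a, q) + t *\<^sub>R (u, 0))" for t
    have z: "(a, q) + t *\<^sub>R (u, 0) = (c1 t, q)" for t by (simp add: c1_def)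
    have c1m: "c1 t \<in> model M" for t
      unfolding c1_def using subspace_add[OF subspace_model a_in(2) subspace_scale[OF subspace_model u]] .
    have *: "(c1 t, q) \<in> D0" "\<kappa> (c1 t, q) \<in> V" "c2 t = \<psi> (\<kappa> (c1 t, q))" "c2 t \<in> \<psi> ` V" if "t \<in> I" for t
    proof -
      have "(c1 t, q) \<in> Om" using \<delta>(2)[of t] that by (simp add: z I_def dist_norm del: add_Pair scaleR_Pair)
      then show "(c1 t, q) \<in> D0" "\<kappa> (c1 t, q) \<in> V" "c2 t = \<psi> (\<kappa> (c1 t, q))" "c2 t \<in> \<psi> ` V"
        using inOO[of "(c1 t, q)"] c1m q(2) by (simp_all add: c2_def z del: add_Pair scaleR_Pair)
    qed
    have 0: "0 \<in> I" using \<delta>(1) by (simp add: I_def)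
    have c20: "c2 0 = q" using k_aq by (simp add: c2_def)
    have d1: "(c1 has_derivative (\<lambda>t. t *\<^sub>R u)) (at 0 within I)"
      unfolding c1_def by (auto intro!: derivative_eq_intros)
    have d2: "(c2 has_derivative (\<lambda>t. D (t *\<^sub>R (u, 0)))) (at 0 within I)"
      unfolding c2_def by (rule der_line)
    have c1U: "c1 ` I \<subseteq> \<phi> ` U" using *(1) by (auto simp: D0_def)
    have c2V: "c2 ` I \<subseteq> \<psi> ` V" using *(4) by blast
    have F1: "((\<lambda>x. \<rho> (par x)) has_derivative T) (at (c1 0) within c1 ` I)"
      using has_derivative_subset[OF rho_derivative c1U] by (simp add: c1_def)
    have F: "((\<lambda>t. \<rho> (par (c1 t))) has_derivative (\<lambda>t. T (t *\<^sub>R u))) (at 0 within I)"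
      by (rule has_derivative_in_compose[OF d1 F1])
    have E1: "(e has_derivative (\<lambda>u. T u o\<^sub>L S)) (at (c2 0) within c2 ` I)"
      using has_derivative_subset[OF der_e c2V] by (simp add: c20)
    have EE: "((\<lambda>t. e (c2 t)) has_derivative (\<lambda>t. T (D (t *\<^sub>R (u, 0))) o\<^sub>L S)) (at 0 within I)"
      by (rule has_derivative_in_compose[OF d2 E1])
    have L: "((\<lambda>t. e (c2 t) o\<^sub>L \<rho> (par (c1 t))) has_derivative
       (\<lambda>t. (e (c2 0) o\<^sub>L T (t *\<^sub>R u)) + ((T (D (t *\<^sub>R (u, 0))) o\<^sub>L S) o\<^sub>L \<rho> (par (c1 0))))) (at 0 within I)"
      by (rule bounded_bilinear.FDERIV[OF bounded_bilinear_blinfun_compose EE F])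
    have R: "((\<lambda>t. \<rho> (par (c1 t)) o\<^sub>L A) has_derivative (\<lambda>t. T (t *\<^sub>R u) o\<^sub>L A)) (at 0 within I)"
      by (rule bounded_linear.has_derivative[OF bounded_bilinear.bounded_linear_left[OF bounded_bilinear_blinfun_compose] F])
    have eq: "e (c2 t) o\<^sub>L \<rho> (par (c1 t)) = \<rho> (par (c1 t)) o\<^sub>L A" if t: "t \<in> I" for t
    proof -
      have g: "par (c1 t) \<in> carrier G" using par_carrier c1U t by blast
      have "e (c2 t) = (\<rho> (par (c1 t)) o\<^sub>L A o\<^sub>L \<rho> (inv\<^bsub>G\<^esub> (par (c1 t))))"
        using e_\<kappa>[OF *(1,2)[OF t]] *(3)[OF t] e_q by simp
      then have "e (c2 t) o\<^sub>L \<rho> (par (c1 t)) =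
          \<rho> (par (c1 t)) o\<^sub>L (A o\<^sub>L (\<rho> (inv\<^bsub>G\<^esub> (par (c1 t))) o\<^sub>L \<rho> (par (c1 t))))"
        by (simp only: blinfun_compose_assoc)
      then show ?thesis using rho_inv[OF g] by (simp add: blinfun_compose_simps)
    qed
    have L': "((\<lambda>t. \<rho> (par (c1 t)) o\<^sub>L A) has_derivative
       (\<lambda>t. (e (c2 0) o\<^sub>L T (t *\<^sub>R u)) + ((T (D (t *\<^sub>R (u, 0))) o\<^sub>L S) o\<^sub>L \<rho> (par (c1 0))))) (at 0 within I)"
      by (rule has_derivative_transform_within[OF L zero_less_one 0]) (use eq in auto)
    have "at 0 within I = at 0" using 0 by (simp add: I_def at_within_open[OF _ open_ball])
    then have "(\<lambda>t. (e (c2 0) o\<^sub>L T (t *\<^sub>R u)) + ((T (D (t *\<^sub>R (u, 0))) o\<^sub>L S) o\<^sub>L \<rho> (par (c1 0)))) = (\<lambda>t. T (t *\<^sub>R u) o\<^sub>L A)"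
      using has_derivative_unique[of "\<lambda>t. \<rho> (par (c1 t)) o\<^sub>L A" _ 0] L' R by simp
    from fun_cong[OF this, of 1] have "(A o\<^sub>L T u) + (T (K u) o\<^sub>L S) = T u o\<^sub>L A"
      by (simp add: c20 e_q c1_def par_a rho_one K_def blinfun_compose_simps)
    then show ?thesis by (simp add: algebra_simps)
  qed

  \<comment> \<open>The model space is the direct sum of the image and the kernel of \<open>K\<close>.\<close>
  obtain W where W: "W o\<^sub>L poly_op (pderiv f) A = id_blinfun"
    using poly_op_pderiv_left_inverse[OF f(1)] f(2) by (auto simp: A_def)
  have fA: "poly_op f A = 0" using f(2) by (simp add: A_def)
  have SA: "S o\<^sub>L A = A o\<^sub>L S" using S(2) by (simp add: A_def)
  have cancel_S: "u = 0" if "u \<in> model M" "T u o\<^sub>L S = 0" for u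
  proof -
    have "T u = (T u o\<^sub>L S) o\<^sub>L S'" by (simp add: blinfun_compose_assoc S(1) blinfun_compose_simps)
    then show ?thesis using T_injective[OF that(1)] that(2) by (simp add: blinfun_compose_simps)
  qed
  have T0: "T 0 = 0" using linear_0[OF linear_T] .
  have ker: "T u o\<^sub>L A = A o\<^sub>L T u" if "u \<in> model M" "K u = 0" for u
    using commutator[OF that(1)] that(2) by (simp add: T0 blinfun_compose_simps)
  have KK: "K u = 0" if u: "u \<in> model M" and "K (K u) = 0" for u
  proof -
    define B where "B = (T (K u) o\<^sub>L S)"
    have B: "B = (T u o\<^sub>L A) - (A o\<^sub>L T u)" unfolding B_def by (rule commutator[OF u])
    have "B o\<^sub>L A = A o\<^sub>L B"
      using ker[OF K_model that(2)] SA unfolding B_def by (metis blinfun_compose_assoc)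
    from poly_op_commutator[OF B this, of f] have "poly_op (pderiv f) A o\<^sub>L B = 0"
      by (simp add: fA blinfun_compose_simps)
    then have "(W o\<^sub>L poly_op (pderiv f) A) o\<^sub>L B = 0" by (simp add: blinfun_compose_assoc blinfun_compose_simps)
    then have "B = 0" by (simp add: W blinfun_compose_simps)
    then show ?thesis using cancel_S[OF K_model] by (simp add: B_def)
  qed
  define I where "I = K ` model M"
  have subI: "subspace I" unfolding I_def by (rule linear_subspace_image[OF linK subspace_model])
  have I_model: "I \<subseteq> model M" using K_model by (auto simp: I_def)
  have K0: "v = 0" if "v \<in> I" "K v = 0" for v using that KK by (auto simp: I_def)
  have injK: "inj_on K I"
    by (rule inj_onI) (use K0 subspace_diff[OF subI] linear_diff[OF linK] in \<open>metis eq_iff_diff_eq_0\<close>)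
  have KI: "K ` I = I"
    by (rule injective_endomorphism_onto[OF linK subI _ injK]) (use I_model in \<open>auto simp: I_def\<close>)
  obtain gK where gK: "gK ` UNIV \<subseteq> I" "linear gK" "\<And>v. v \<in> I \<Longrightarrow> gK (K v) = v"
    using linear_exists_left_inverse_on[OF linK subI injK] by blast
  define \<pi> where "\<pi> z = gK (K z)" for z
  have lin\<pi>: "linear \<pi>" unfolding \<pi>_def using linear_compose[OF linK gK(2)] by (simp add: o_def)
  have \<pi>_I: "\<pi> z \<in> I" for z using gK(1) by (auto simp: \<pi>_def)
  have \<pi>_model: "\<pi> z \<in> model M" for z using \<pi>_I I_model by blast
  have \<pi>_id: "\<pi> z = z" if "z \<in> I" for z using gK(3)[OF that] by (simp add: \<pi>_def)
  have K\<pi>: "K (\<pi> z) = K z" if "z \<in> model M" for z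
  proof -
    have "K z \<in> K ` I" using KI that by (auto simp: I_def)
    then obtain i where "i \<in> I" "K z = K i" by blast
    then show ?thesis using gK(3) by (simp add: \<pi>_def)
  qed

  define X where "X = {w \<in> model M. K w = 0}"
  have subX: "subspace X"
    unfolding X_def subspace_def
    using linear_0[OF linK] linear_add[OF linK] linear_scale[OF linK] subspace_0[OF subspace_model]
      subspace_add[OF subspace_model] subspace_scale[OF subspace_model] by simp
  obtain Dp where Dp: "(poly_op f has_derivative Dp) (at A)"
    "\<And>H. H o\<^sub>L A = A o\<^sub>L H \<Longrightarrow> Dp H = (poly_op (pderiv f) A o\<^sub>L H)"
    using poly_op_has_derivative by blast
  have der_fe: "((\<lambda>x. poly_op f (e x)) has_derivative (\<lambda>u. Dp (T u o\<^sub>L S))) (at q within \<psi> ` V)"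
    by (rule has_derivative_compose[OF der_e]) (use Dp(1) e_q in simp)
  have inj_fe: "w = 0" if w: "w \<in> X" "Dp (T w o\<^sub>L S) = 0" for w
  proof -
    have wm: "w \<in> model M" "K w = 0" using w(1) by (auto simp: X_def)
    have "(T w o\<^sub>L S) o\<^sub>L A = A o\<^sub>L (T w o\<^sub>L S)" using ker[OF wm] SA by (metis blinfun_compose_assoc)
    then have "poly_op (pderiv f) A o\<^sub>L (T w o\<^sub>L S) = 0" using Dp(2) w(2) by metis
    then have "(W o\<^sub>L poly_op (pderiv f) A) o\<^sub>L (T w o\<^sub>L S) = 0" by (simp add: blinfun_compose_assoc blinfun_compose_simps)
    then have "T w o\<^sub>L S = 0" by (simp add: W blinfun_compose_simps)
    then show ?thesis using cancel_S wm(1) by blast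
  qed
  have fe_q: "poly_op f (e q) = 0" using fA e_q by simp
  obtain \<epsilon> where \<epsilon>: "\<epsilon> > 0"
    "\<And>x. x \<in> X \<Longrightarrow> q + x \<in> \<psi> ` V \<Longrightarrow> norm x < \<epsilon> \<Longrightarrow> poly_op f (e (q + x)) = 0 \<Longrightarrow> x = 0"
    using isolated_zero_on_subspace[OF der_fe fe_q subX inj_fe] by metis

  \<comment> \<open>The slice coordinates; the summand \<open>z - P z\<close> only serves to define them off the model space.\<close>
  define J where "J z = (\<pi> (P z), P z + - \<pi> (P z))" for z
  have blJ: "bounded_linear J"
  proof -
    have "linear (\<lambda>z. \<pi> (P z))" using linear_compose[OF linP lin\<pi>] by (simp add: o_def)
    then have "bounded_linear (\<lambda>z. \<pi> (P z))" by (simp add: linear_conv_bounded_linear)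
    then show ?thesis unfolding J_def
      by (intro bounded_linear_Pair bounded_linear_add bounded_linear_minus P(1))
  qed
  define S0 where "S0 = {z. (a, q) + J z \<in> Om} \<inter> {z. norm (P z + - \<pi> (P z)) < \<epsilon>}"
  define H where "H z = k ((a, q) + J z) + (z + - P z)" for z
  have affJ: "Cinf UNIV (\<lambda>z. (a, q) + J z)"
    by (rule Cinf_add[OF open_UNIV Cinf_const Cinf_bounded_linear[OF blJ]])
  have J0: "J 0 = 0" using linear_0[OF bounded_linear.linear[OF blJ]] .
  have openS0: "open S0"
  proof -
    have "open ((\<lambda>z. (a, q) + J z) -` Om)"
      by (rule open_vimage[OF Om(1)]) (use Cinf_continuous[OF affJ] in simp)
    moreover have "open ((\<lambda>z. norm (snd (J z))) -` {..<\<epsilon>})"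
      by (rule open_vimage[OF open_lessThan]) (intro continuous_intros linear_continuous_on blJ)
    ultimately show ?thesis by (auto simp: S0_def J_def vimage_def intro!: open_Int)
  qed
  have S0_OO: "(a, q) + J z \<in> Om" if "z \<in> S0" for z using that by (simp add: S0_def)
  have 0: "0 \<in> S0" using Om(2) \<epsilon>(1) J0 by (auto simp: S0_def J_def zero_prod_def)
  have smoothH: "Cinf S0 H"
  proof -
    have "Cinf S0 (\<lambda>z. k ((a, q) + J z))"
      by (rule Cinf_compose[OF openS0 k0(1) _ Cinf_subset[OF affJ subset_UNIV] k_smooth])
         (use S0_OO in \<open>auto simp: Om_def\<close>)
    moreover have "Cinf S0 (\<lambda>z. z + - P z)"
      by (rule Cinf_bounded_linear) (intro bounded_linear_add bounded_linear_ident bounded_linear_minus P(1))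
    ultimately show ?thesis unfolding H_def by (rule Cinf_add[OF openS0])
  qed
  have derH: "(H has_derivative (\<lambda>z. D (J z) + (z + - P z))) (at 0)"
  proof -
    have "((\<lambda>z. (a, q) + J z) has_derivative (\<lambda>z. 0 + J z)) (at 0)"
      by (intro has_derivative_add has_derivative_const bounded_linear_imp_has_derivative blJ)
    then have 1: "((\<lambda>z. (a, q) + J z) has_derivative J) (at 0)" by simp
    have "((\<lambda>z. k ((a, q) + J z)) has_derivative (\<lambda>z. D (J z))) (at 0)"
      by (rule has_derivative_compose[where g = k, OF 1]) (use derk J0 in simp)
    then show ?thesis unfolding H_def
      by (intro has_derivative_add has_derivative_minus has_derivative_ident bounded_linear_imp_has_derivative P(1))
  qed
  have DJ: "D (J z) = K (P z) + (P z - \<pi> (P z))" for z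
  proof -
    have "J z = (\<pi> (P z), 0) + (0, P z - \<pi> (P z))" by (simp add: J_def)
    then have "D (J z) = K (\<pi> (P z)) + D (0, P z - \<pi> (P z))"
      using linear_add[OF linD] by (simp only: K_def)
    then show ?thesis
      using D_snd[OF subspace_diff[OF subspace_model P(2) \<pi>_model]] K\<pi>[OF P(2)] by simp
  qed
  have injH: "z = 0" if "D (J z) + (z + - P z) = 0" for z
  proof -
    have z: "z = \<pi> (P z) - K (P z)" using that by (simp add: DJ algebra_simps)
    then have "z \<in> model M" using subspace_diff[OF subspace_model \<pi>_model K_model] by metis
    then have Pz: "P z = z" by (rule P(3))
    have "K z \<in> I" using \<open>z \<in> model M\<close> by (auto simp: I_def)
    then have "z \<in> I" using z subspace_diff[OF subI \<pi>_I] Pz by metis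
    then have "K z = 0" using z \<pi>_id Pz by simp
    then show ?thesis using K0 \<open>z \<in> I\<close> by blast
  qed
  obtain P1 Q1 g where g: "open P1" "P1 \<subseteq> S0" "0 \<in> P1" "open Q1" "H 0 \<in> Q1" "homeomorphism P1 Q1 H g" "Cinf Q1 g"
    using smooth_inverse_function[OF openS0 smoothH 0 derH injH] by metis
  have H0: "H 0 = q" using J0 k_aq linear_0[OF linP] by (simp add: H_def)
  have zJ: "fst ((a, q) + J z) \<in> model M" "snd ((a, q) + J z) \<in> model M" for z
    using subspace_add[OF subspace_model a_in(2) \<pi>_model]
      subspace_add[OF subspace_model q(2) subspace_diff[OF subspace_model P(2) \<pi>_model]]
    by (simp_all add: J_def)
  have k_model: "k z \<in> model M" for z by (simp add: k_def P(2))
  have H_model: "H z \<in> model M \<longleftrightarrow> z \<in> model M" for z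
  proof
    assume "H z \<in> model M"
    then have "H z - k ((a, q) + J z) \<in> model M" using subspace_diff[OF subspace_model _ k_model] by blast
    then have m: "z - P z \<in> model M" by (simp add: H_def)
    have "z = (z - P z) + P z" by simp
    then show "z \<in> model M" using subspace_add[OF subspace_model m P(2)] by metis
  next
    assume "z \<in> model M"
    then show "H z \<in> model M" using k_model P(3) by (simp add: H_def)
  qed
  define V' where "V' = {v \<in> V. \<psi> v \<in> Q1}"
  define \<theta> where "\<theta> v = g (\<psi> v)" for v
  have chart': "(V', \<theta>) \<in> max_atlas N"
    unfolding V'_def \<theta>_def
    by (rule max_atlas_reparametrize[OF N V(1) g(1,4,6) Cinf_subset[OF smoothH g(2)] g(7)])
       (simp add: H_model model_N)
  have pV': "p \<in> V'" using V(2) g(5) H0 by (simp add: V'_def q_def)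
  have key: "(\<theta> v \<in> I \<longleftrightarrow> poly_op f (E v) = 0) \<and> (poly_op f (E v) = 0 \<longrightarrow> (\<exists>g\<in>carrier G. v = act g p))"
    if v: "v \<in> V'" for v
  proof -
    define z where "z = \<theta> v"
    have vV: "v \<in> V" "\<psi> v \<in> Q1" using v by (auto simp: V'_def)
    have zP1: "z \<in> P1" and Hz: "H z = \<psi> v"
      using g(6) vV(2) by (auto simp: z_def \<theta>_def homeomorphism_def)
    have zS0: "z \<in> S0" using zP1 g(2) by blast
    have "\<psi> v \<in> model M" using vV(1) VD(5) model_N by blast
    then have zm: "z \<in> model M" using H_model Hz by metis
    then have Pz: "P z = z" by (rule P(3))
    define y x where "y = a + \<pi> z" and "x = z - \<pi> z"
    have yx: "(a, q) + J z = (y, q + x)" by (simp add: J_def y_def x_def Pz)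
    have OOz: "(y, q + x) \<in> Om" using S0_OO[OF zS0] by (simp add: yx)
    have D0z: "(y, q + x) \<in> D0" "\<kappa> (y, q + x) \<in> V" "k (y, q + x) = \<psi> (\<kappa> (y, q + x))"
      using inOO[OF OOz] zJ[of z] by (simp_all add: yx)
    have "\<psi> v = \<psi> (\<kappa> (y, q + x))" using Hz D0z(3) by (simp add: H_def yx Pz)
    then have v\<kappa>: "v = \<kappa> (y, q + x)" using inv_V vV(1) D0z(2) by metis
    have yU: "y \<in> \<phi> ` U" and xV: "q + x \<in> \<psi> ` V" using D0z(1) by (auto simp: D0_def)
    have gy: "par y \<in> carrier G" using par_carrier[OF yU] .
    have "E v = e (\<psi> (\<kappa> (y, q + x)))" using inv_V[OF D0z(2)] by (simp add: e_def v\<kappa>)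
    also have "\<dots> = (\<rho> (par y) o\<^sub>L e (q + x) o\<^sub>L \<rho> (inv\<^bsub>G\<^esub> (par y)))"
      using e_\<kappa>[OF D0z(1,2)] by simp
    finally have Ev: "poly_op f (E v) = (\<rho> (par y) o\<^sub>L poly_op f (e (q + x)) o\<^sub>L \<rho> (inv\<^bsub>G\<^esub> (par y)))"
      using poly_op_conj[OF rho_inv(2,1)[OF gy]] by simp
    have zero_iff: "poly_op f (E v) = 0 \<longleftrightarrow> poly_op f (e (q + x)) = 0"
    proof
      assume "poly_op f (E v) = 0"
      then have "\<rho> (inv\<^bsub>G\<^esub> (par y)) o\<^sub>L (\<rho> (par y) o\<^sub>L poly_op f (e (q + x)) o\<^sub>L \<rho> (inv\<^bsub>G\<^esub> (par y))) o\<^sub>L \<rho> (par y) = 0"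
        using Ev by (simp add: blinfun_compose_simps)
      moreover have "\<rho> (inv\<^bsub>G\<^esub> (par y)) o\<^sub>L (\<rho> (par y) o\<^sub>L poly_op f (e (q + x)) o\<^sub>L \<rho> (inv\<^bsub>G\<^esub> (par y))) o\<^sub>L \<rho> (par y)
         = (\<rho> (inv\<^bsub>G\<^esub> (par y)) o\<^sub>L \<rho> (par y)) o\<^sub>L poly_op f (e (q + x)) o\<^sub>L (\<rho> (inv\<^bsub>G\<^esub> (par y)) o\<^sub>L \<rho> (par y))"
        by (simp only: blinfun_compose_assoc)
      ultimately show "poly_op f (e (q + x)) = 0" using rho_inv[OF gy] by (simp add: blinfun_compose_simps)
    qed (simp add: Ev blinfun_compose_simps)
    have xX: "x \<in> X" unfolding X_def x_def
      using subspace_diff[OF subspace_model zm \<pi>_model] K\<pi>[OF zm] by (simp add: linear_diff[OF linK])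
    have "norm x < \<epsilon>" using zS0 by (simp add: S0_def Pz x_def)
    then have x_iff: "poly_op f (e (q + x)) = 0 \<longleftrightarrow> x = 0"
      using \<epsilon>(2)[OF xX xV] fA e_q by auto
    have z_iff: "z \<in> I \<longleftrightarrow> x = 0" using \<pi>_I[of z] \<pi>_id[of z] by (auto simp: x_def)
    have "v = act (par y) p" if "x = 0" using v\<kappa> that by (simp add: \<kappa>_def inv_q)
    then show ?thesis using zero_iff x_iff z_iff gy by (auto simp: z_def)
  qed
  show thesis
  proof (rule that[OF chart' pV' subI])
    show "I \<subseteq> model N" using I_model model_N by simp
  qed (use key in blast)+
qed

end

section \<open>Orbits and connected components\<close>

context lie_rep
begin

text \<open>The orbits of a connected group are connected. If they are also relatively open in an
  invariant closed set, then they are its connected components. A slice chart at one point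
  of an orbit is moved to any other point of it by the group.\<close>

theorem components_are_orbits:
  fixes N :: "('b, 'e) manifold" and act :: "'a \<Rightarrow> 'b \<Rightarrow> 'b"
  assumes N: "smooth_manifold N"
    and act_closed: "\<And>g q. g \<in> carrier G \<Longrightarrow> q \<in> topspace (mtop N) \<Longrightarrow> act g q \<in> topspace (mtop N)"
    and act_one: "\<And>q. q \<in> topspace (mtop N) \<Longrightarrow> act \<one>\<^bsub>G\<^esub> q = q"
    and act_mult: "\<And>g h q. g \<in> carrier G \<Longrightarrow> h \<in> carrier G \<Longrightarrow> q \<in> topspace (mtop N) \<Longrightarrow>
        act (g \<otimes>\<^bsub>G\<^esub> h) q = act g (act h q)"
    and act_plot: "\<And>(D :: 'e set) c d. plot M D c \<Longrightarrow> plot N D d \<Longrightarrow> plot N D (\<lambda>x. act (c x) (d x))"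
    and Z: "closedin (mtop N) Z" "\<And>g q. g \<in> carrier G \<Longrightarrow> q \<in> Z \<Longrightarrow> act g q \<in> Z"
    and slice: "\<And>p. p \<in> Z \<Longrightarrow> \<exists>V \<theta> L. (V, \<theta>) \<in> max_atlas N \<and> p \<in> V \<and> subspace L \<and> L \<subseteq> model N \<and>
        (\<forall>v\<in>V. \<theta> v \<in> L \<longleftrightarrow> v \<in> Z) \<and> (\<forall>v\<in>V. v \<in> Z \<longrightarrow> (\<exists>g\<in>carrier G. v = act g p))"
    and C: "C \<in> connected_components_of (subtopology (mtop N) Z)"
  shows "closedin (mtop N) C \<and> embedded_submanifold N C \<and> C \<in> orbits G (topspace (mtop N)) act"
proof -
  interpret group G by (rule group_G)
  have ZN: "Z \<subseteq> topspace (mtop N)" using Z(1) closedin_subset by blast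
  have topZ: "topspace (subtopology (mtop N) Z) = Z" using ZN by auto
  define orb where "orb p = (\<lambda>g. act g p) ` carrier G" for p
  have act_inv: "act (inv\<^bsub>G\<^esub> g) (act g q) = q" "act g (act (inv\<^bsub>G\<^esub> g) q) = q"
    if "g \<in> carrier G" "q \<in> topspace (mtop N)" for g q
    using that act_one by (simp_all flip: act_mult)
  have orbZ: "orb p \<subseteq> Z" if "p \<in> Z" for p using Z(2) that by (auto simp: orb_def)
  have self: "p \<in> orb p" if "p \<in> Z" for p
    unfolding orb_def using act_one[of p] that ZN by (metis image_eqI one_closed subsetD)
  have same: "orb p' = orb p" if p: "p \<in> Z" and p': "p' \<in> orb p" for p p'
  proof -
    obtain g where g: "g \<in> carrier G" "p' = act g p" using p' by (auto simp: orb_def)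
    have pN: "p \<in> topspace (mtop N)" using p ZN by blast
    show ?thesis
    proof
      show "orb p' \<subseteq> orb p" using g pN by (auto simp: orb_def simp flip: act_mult)
      show "orb p \<subseteq> orb p'"
      proof
        fix x assume "x \<in> orb p"
        then obtain k where k: "k \<in> carrier G" "x = act k p" by (auto simp: orb_def)
        have "act (k \<otimes>\<^bsub>G\<^esub> inv\<^bsub>G\<^esub> g) p' = x"
          using k g pN by (simp add: m_assoc flip: act_mult)
        then show "x \<in> orb p'" using k g unfolding orb_def by (metis image_eqI inv_closed m_closed)
      qed
    qed
  qed
  have plot_act: "plot N D (\<lambda>x. act g (c x))" if "g \<in> carrier G" "plot N D c" for g and D :: "'e set" and c
    using act_plot[OF plot_constant[OF that(1)] that(2)] .
  have transport: "(act g ` V, \<theta> \<circ> act (inv\<^bsub>G\<^esub> g)) \<in> max_atlas N"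
    if "g \<in> carrier G" "(V, \<theta>) \<in> max_atlas N" for g V \<theta>
    by (rule max_atlas_transport[OF N that(2) plot_act[OF that(1)] plot_act[OF inv_closed[OF that(1)]]])
       (use that act_closed act_inv in auto)
  have conn_orb: "connectedin (mtop N) (orb p)" if p: "p \<in> Z" for p
  proof -
    have cont: "continuous_map (mtop M) (mtop N) (\<lambda>g. act g p)"
    proof (rule continuous_map_chartwise[OF manifold_M])
      fix U \<phi> assume U: "(U, \<phi>) \<in> atlas M"
      have "plot N (\<phi> ` U) (\<lambda>x. act (inv_into U \<phi> x) p)"
        by (rule act_plot[OF plot_chart_inverse[OF manifold_M atlas_max_atlas[OF manifold_M U]] plot_const[OF N]])
           (use p ZN in blast)
      then show "continuous_map (top_of_set (\<phi> ` U)) (mtop N) ((\<lambda>g. act g p) \<circ> inv_into U \<phi>)"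
        using plot_continuous[OF N] by (simp add: o_def)
    qed
    have "connectedin (mtop M) (carrier G)"
      using connected topspace_M by (metis connectedin_topspace)
    then show ?thesis unfolding orb_def by (rule connectedin_continuous_map_image[OF cont])
  qed
  have open_orb: "openin (subtopology (mtop N) Z) (orb p)" if p: "p \<in> Z" for p
  proof (subst openin_subopen, intro ballI)
    fix p' assume p': "p' \<in> orb p"
    then have "p' \<in> Z" using orbZ p by blast
    obtain V \<theta> L where V: "(V, \<theta>) \<in> max_atlas N" "p' \<in> V" "\<And>v. v \<in> V \<Longrightarrow> v \<in> Z \<Longrightarrow> \<exists>g\<in>carrier G. v = act g p'"
      using slice[OF \<open>p' \<in> Z\<close>] by blast
    have "openin (subtopology (mtop N) Z) (V \<inter> Z)"
      using local_chartD(1)[OF max_atlas_local_chart[OF V(1)]] by (auto simp: openin_subtopology)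
    moreover have "V \<inter> Z \<subseteq> orb p'" using V(3) by (auto simp: orb_def)
    then have "V \<inter> Z \<subseteq> orb p" using same[OF p p'] by simp
    ultimately show "\<exists>T. openin (subtopology (mtop N) Z) T \<and> p' \<in> T \<and> T \<subseteq> orb p"
      using V(2) \<open>p' \<in> Z\<close> by blast
  qed
  have Csub: "C \<subseteq> Z" using connected_components_of_subset[OF C] topZ by simp
  obtain p where pC: "p \<in> C" using nonempty_connected_components_of[OF C] by blast
  then have p: "p \<in> Z" using Csub by blast
  have "connectedin (subtopology (mtop N) Z) (orb p)"
    using conn_orb[OF p] orbZ[OF p] by (simp add: connectedin_subtopology)
  then have sub1: "orb p \<subseteq> C"
    using connected_components_of_maximal[OF C] pC self[OF p] by (metis disjnt_iff)
  have "C \<subseteq> orb p"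
  proof -
    have "openin (subtopology (mtop N) Z) (\<Union>x\<in>Z - orb p. orb x)"
      using open_orb by blast
    moreover have "(\<Union>x\<in>Z - orb p. orb x) = Z - orb p"
    proof
      show "Z - orb p \<subseteq> (\<Union>x\<in>Z - orb p. orb x)" using self by blast
      show "(\<Union>x\<in>Z - orb p. orb x) \<subseteq> Z - orb p"
      proof
        fix y assume "y \<in> (\<Union>x\<in>Z - orb p. orb x)"
        then obtain x where x: "x \<in> Z" "x \<notin> orb p" "y \<in> orb x" by blast
        have "y \<notin> orb p"
        proof
          assume "y \<in> orb p"
          then have "orb x = orb p" using same[OF p] same[OF x(1,3)] by simp
          then show False using self[OF x(1)] x(2) by simp
        qed
        then show "y \<in> Z - orb p" using orbZ[OF x(1)] x(3) by blast
      qed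
    qed
    ultimately have "closedin (subtopology (mtop N) Z) (orb p)"
      using orbZ[OF p] unfolding closedin_def topZ by simp
    then have "C \<subseteq> orb p \<or> disjnt C (orb p)"
      using connectedin_clopen_cases[OF connectedin_connected_components_of[OF C] _ open_orb[OF p]] by blast
    then show ?thesis using pC self[OF p] by (auto simp: disjnt_iff)
  qed
  then have C_eq: "C = orb p" using sub1 by blast
  have "closedin (mtop N) C"
    using closedin_connected_components_of[OF C] closedin_closed_subtopology[OF Z(1)] by blast
  moreover have "C \<in> orbits G (topspace (mtop N)) act"
    using C_eq p ZN unfolding orbits_def orbit_def orb_def by blast
  moreover have "embedded_submanifold N C"
  proof -
    obtain V \<theta> L where V: "(V, \<theta>) \<in> max_atlas N" "p \<in> V" "subspace L" "L \<subseteq> model N"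
      "\<And>v. v \<in> V \<Longrightarrow> \<theta> v \<in> L \<longleftrightarrow> v \<in> Z" "\<And>v. v \<in> V \<Longrightarrow> v \<in> Z \<Longrightarrow> v \<in> orb p"
      using slice[OF p] unfolding orb_def by blast
    have VC: "\<theta> ` (V \<inter> C) = \<theta> ` V \<inter> L" using V(5,6) orbZ[OF p] C_eq by auto
    have VN: "V \<subseteq> topspace (mtop N)" using local_chartD(2)[OF max_atlas_local_chart[OF V(1)]] .
    have "\<exists>W \<eta> L'. (W, \<eta>) \<in> max_atlas N \<and> p' \<in> W \<and> subspace L' \<and> L' \<subseteq> model N \<and> dim L' = dim L \<and>
       \<eta> ` (W \<inter> C) = \<eta> ` W \<inter> L'" if p': "p' \<in> C" for p'
    proof -
      obtain g where g: "g \<in> carrier G" "p' = act g p" using p' C_eq by (auto simp: orb_def)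
      have gC: "act g v \<in> C \<longleftrightarrow> v \<in> C" if v: "v \<in> V" for v
      proof
        assume "act g v \<in> C"
        then obtain k where "k \<in> carrier G" "act g v = act k p" using C_eq by (auto simp: orb_def)
        then have "v = act (inv\<^bsub>G\<^esub> g \<otimes>\<^bsub>G\<^esub> k) p"
          using act_inv(1)[OF g(1)] v VN p ZN g(1) act_mult by (metis inv_closed subsetD)
        then show "v \<in> C" using g(1) \<open>k \<in> carrier G\<close> C_eq unfolding orb_def by (metis image_eqI inv_closed m_closed)
      next
        assume "v \<in> C"
        then obtain k where "k \<in> carrier G" "v = act k p" using C_eq by (auto simp: orb_def)
        then have "act g v = act (g \<otimes>\<^bsub>G\<^esub> k) p" using g(1) p ZN act_mult by (metis subsetD)
        then show "act g v \<in> C" using g(1) \<open>k \<in> carrier G\<close> C_eq unfolding orb_def by (metis image_eqI m_closed)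
      qed
      have pull: "(\<theta> \<circ> act (inv\<^bsub>G\<^esub> g)) (act g v) = \<theta> v" if "v \<in> V" for v
        using act_inv(1)[OF g(1)] VN that by auto
      have "act g ` V \<inter> C = act g ` (V \<inter> C)" using gC by blast
      then have "(\<theta> \<circ> act (inv\<^bsub>G\<^esub> g)) ` (act g ` V \<inter> C) = \<theta> ` (V \<inter> C)"
        using pull by (simp add: image_image cong: image_cong_simp)
      moreover have "(\<theta> \<circ> act (inv\<^bsub>G\<^esub> g)) ` (act g ` V) = \<theta> ` V"
        using pull by (simp add: image_image cong: image_cong_simp)
      ultimately show ?thesis
        using transport[OF g(1) V(1)] V(2-4) VC g(2)
        by (intro exI[of _ "act g ` V"] exI[of _ "\<theta> \<circ> act (inv\<^bsub>G\<^esub> g)"] exI[of _ L]) auto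
    qed
    then show ?thesis unfolding embedded_submanifold_def using Csub ZN by blast
  qed
  ultimately show ?thesis by blast
qed

end

context lie_rep
begin

lemma chart_at_one:
  obtains U \<phi> Q h P where "lie_rep_chart G M \<rho> U \<phi> Q h P"
proof -
  interpret group G by (rule group_G)
  obtain U \<phi> where U: "(U, \<phi>) \<in> atlas M" "\<one>\<^bsub>G\<^esub> \<in> U"
    using smooth_manifoldD(4)[OF manifold_M, of "\<one>\<^bsub>G\<^esub>"] topspace_M by auto
  have max: "(U, \<phi>) \<in> max_atlas M" by (rule atlas_max_atlas[OF manifold_M U(1)])
  obtain Q h where "open Q" "\<phi> \<one>\<^bsub>G\<^esub> \<in> Q" "Cinf Q h"
    "\<And>x. x \<in> \<phi> ` U \<Longrightarrow> x \<in> Q \<Longrightarrow> h x = \<rho> (inv_into U \<phi> x)"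
    using smooth_onE[OF rho_plot[OF plot_chart_inverse[OF manifold_M max]], of "\<phi> \<one>\<^bsub>G\<^esub>"] U(2)
    by (metis imageI)
  moreover obtain P where "bounded_linear P" "\<And>x. P x \<in> model M" "\<And>x. x \<in> model M \<Longrightarrow> P x = x"
    "\<And>x k. k \<in> model M \<Longrightarrow> (x - P x) \<bullet> k = 0"
    using orthogonal_projection_exists[OF subspace_model] by metis
  ultimately have "lie_rep_chart G M \<rho> U \<phi> Q h P"
    using max U(2) lie_rep_axioms by (simp add: lie_rep_chart_def lie_rep_chart_axioms_def)
  then show thesis by (rule that)
qed

lemma smooth_rho: "smooth_fun M \<rho>"
  using rep unfolding lie_representation_def by blast

lemma poly_op_rho_conj:
  assumes "g \<in> carrier G" "poly_op f A = 0"
  shows "poly_op f (\<rho> g o\<^sub>L A o\<^sub>L \<rho> (inv\<^bsub>G\<^esub> g)) = 0"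
  using poly_op_conj[OF rho_inv(2,1)[OF assms(1)], of f A] assms(2) by (simp add: blinfun_compose_simps)

end

lemma closedin_poly_op_zeros:
  fixes E :: "'b \<Rightarrow> ('v::real_normed_vector \<Rightarrow>\<^sub>L 'v)"
  assumes "continuous_map X euclidean E"
  shows "closedin X {q \<in> topspace X. poly_op f (E q) = 0}"
proof -
  have "isCont (poly_op f) A" for A :: "'v \<Rightarrow>\<^sub>L 'v"
    using poly_op_has_derivative[of f A] has_derivative_continuous by blast
  then have "continuous_map euclidean euclidean (poly_op f :: ('v \<Rightarrow>\<^sub>L 'v) \<Rightarrow> _)"
    by (simp add: continuous_at_imp_continuous_on)
  then have "continuous_map X euclidean (poly_op f \<circ> E)"
    by (rule continuous_map_compose[OF assms])
  then have "closedin X {q \<in> topspace X. (poly_op f \<circ> E) q \<in> {0}}"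
    by (rule closedin_continuous_map_preimage) simp
  then show ?thesis by simp
qed

section \<open>Conjugacy classes\<close>

theorem (in lie_rep) group_components:
  assumes f: "coprime f (pderiv f)"
    and C: "C \<in> connected_components_of (subtopology (mtop M) (Z_group G \<rho> f))"
  shows "closedin (mtop M) C \<and> embedded_submanifold M C \<and> C \<in> conjugacy_classes G"
proof -
  interpret group G by (rule group_G)
  obtain U \<phi> Q h P where "lie_rep_chart G M \<rho> U \<phi> Q h P" using chart_at_one .
  then interpret lie_rep_chart G M \<rho> U \<phi> Q h P .
  have Z: "Z_group G \<rho> f = {g \<in> topspace (mtop M). poly_op f (\<rho> g) = 0}"
    by (simp add: Z_group_def topspace_M)
  have one: "conj_map G \<one>\<^bsub>G\<^esub> q = q" if "q \<in> carrier G" for q using that by (simp add: conj_map_def)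
  have "closedin (mtop M) C \<and> embedded_submanifold M C \<and> C \<in> orbits G (topspace (mtop M)) (conj_map G)"
  proof (rule components_are_orbits[OF manifold_M _ _ _ plot_conj _ _ _ C])
    show "conj_map G g q \<in> topspace (mtop M)" if "g \<in> carrier G" "q \<in> topspace (mtop M)" for g q
      using that by (simp add: conj_map_def topspace_M)
    show "conj_map G \<one>\<^bsub>G\<^esub> q = q" if "q \<in> topspace (mtop M)" for q using one that topspace_M by simp
    show "conj_map G (g \<otimes>\<^bsub>G\<^esub> k) q = conj_map G g (conj_map G k q)"
      if "g \<in> carrier G" "k \<in> carrier G" "q \<in> topspace (mtop M)" for g k q
      using that by (simp add: conj_map_def topspace_M m_assoc inv_mult_group)
    show "closedin (mtop M) (Z_group G \<rho> f)"
      unfolding Z by (rule closedin_poly_op_zeros[OF smooth_fun_continuous[OF manifold_M smooth_rho]])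
    show "conj_map G g q \<in> Z_group G \<rho> f" if "g \<in> carrier G" "q \<in> Z_group G \<rho> f" for g q
      using that poly_op_rho_conj rho_conj by (simp add: Z_group_def conj_map_def)
  next
    fix p assume "p \<in> Z_group G \<rho> f"
    then have p: "p \<in> carrier G" "poly_op f (\<rho> p) = 0" by (auto simp: Z_group_def)
    \<comment> \<open>In the right translate of the chart, \<open>\<rho>\<close> is \<open>x \<mapsto> \<rho> x \<circ> \<rho> p\<close>.\<close>
    define F where "F x = x \<otimes>\<^bsub>G\<^esub> p" for x
    define F' where "F' x = x \<otimes>\<^bsub>G\<^esub> inv\<^bsub>G\<^esub> p" for x
    define V where "V = F ` U"
    define \<psi> where "\<psi> = \<phi> \<circ> F'"
    have UG: "U \<subseteq> carrier G" using lcD(2) topspace_M by simp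
    have FF: "F' (F x) = x" "F (F' x) = x" if "x \<in> carrier G" for x
      using that p(1) by (simp_all add: F_def F'_def m_assoc)
    have V: "(V, \<psi>) \<in> max_atlas M"
      unfolding V_def \<psi>_def
    proof (rule max_atlas_transport[OF manifold_M chart(1)])
      show "plot M D (\<lambda>x. F (c x))" if "plot M D c" for D :: "'e set" and c
        unfolding F_def by (rule plot_mult[OF that plot_constant[OF p(1)]])
      show "plot M D (\<lambda>x. F' (c x))" if "plot M D c" for D :: "'e set" and c
        unfolding F'_def by (rule plot_mult[OF that plot_constant[OF inv_closed[OF p(1)]]])
    qed (use FF p(1) in \<open>simp_all add: topspace_M F_def F'_def\<close>)
    have pV: "p \<in> V" unfolding V_def F_def using chart(2) p(1) by (metis image_eqI l_one)
    have injV: "inj_on \<psi> V" using local_chartD(3)[OF max_atlas_local_chart[OF V]] .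
    have \<psi>p: "\<psi> p = a" using p(1) by (simp add: \<psi>_def F'_def a_def)
    have \<psi>V: "\<psi> ` V = \<phi> ` U"
    proof -
      have "\<psi> (F u) = \<phi> u" if "u \<in> U" for u using FF(1) UG that by (auto simp: \<psi>_def)
      then show ?thesis unfolding V_def image_image by (rule image_cong[OF refl])
    qed
    have inv_\<psi>: "inv_into V \<psi> x = par x \<otimes>\<^bsub>G\<^esub> p" if x: "x \<in> \<phi> ` U" for x
    proof (rule inv_into_f_eq[OF injV])
      show "par x \<otimes>\<^bsub>G\<^esub> p \<in> V" using inv_into_into[OF x] by (auto simp: V_def F_def)
      show "\<psi> (par x \<otimes>\<^bsub>G\<^esub> p) = x"
        using FF(1)[of "par x"] par_carrier[OF x] f_inv_into_f[OF x] by (simp add: \<psi>_def F_def)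
    qed
    have d: "((\<lambda>x. \<rho> (par x) o\<^sub>L \<rho> p) has_derivative (\<lambda>u. T u o\<^sub>L \<rho> p)) (at a within \<phi> ` U)"
      by (rule bounded_linear.has_derivative[OF
            bounded_bilinear.bounded_linear_left[OF bounded_bilinear_blinfun_compose] rho_derivative])
    have "((\<lambda>x. \<rho> (inv_into V \<psi> x)) has_derivative (\<lambda>u. T u o\<^sub>L \<rho> p)) (at a within \<phi> ` U)"
      by (rule has_derivative_transform_within[OF d zero_less_one a_in(1)])
         (use inv_\<psi> rho_mult par_carrier p(1) in simp)
    then have d': "((\<lambda>x. \<rho> (inv_into V \<psi> x)) has_derivative (\<lambda>u. T u o\<^sub>L \<rho> p)) (at (\<psi> p) within \<psi> ` V)"
      by (simp add: \<psi>p \<psi>V)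
    obtain V' \<theta> L where "(V', \<theta>) \<in> max_atlas M" "p \<in> V'" "subspace L" "L \<subseteq> model M"
      "\<And>v. v \<in> V' \<Longrightarrow> \<theta> v \<in> L \<longleftrightarrow> poly_op f (\<rho> v) = 0"
      "\<And>v. v \<in> V' \<Longrightarrow> poly_op f (\<rho> v) = 0 \<Longrightarrow> \<exists>g\<in>carrier G. v = conj_map G g p"
    proof (rule slice[OF manifold_M refl plot_conj _ _ V pV d' rho_inv(1)[OF p(1)] refl f p(2)])
      show "conj_map G \<one>\<^bsub>G\<^esub> q = q" if "q \<in> topspace (mtop M)" for q using one that topspace_M by simp
      show "\<rho> (conj_map G g q) = (\<rho> g o\<^sub>L \<rho> q o\<^sub>L \<rho> (inv\<^bsub>G\<^esub> g))"
        if "g \<in> carrier G" "q \<in> topspace (mtop M)" for g q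
        using rho_conj that by (simp add: topspace_M)
    qed (assumption | rule that)+
    moreover have "v \<in> Z_group G \<rho> f \<longleftrightarrow> poly_op f (\<rho> v) = 0" if "v \<in> V'" for v
      using that local_chartD(2)[OF max_atlas_local_chart[OF calculation(1)]] topspace_M
      by (auto simp: Z_group_def)
    ultimately show "\<exists>V \<theta> L. (V, \<theta>) \<in> max_atlas M \<and> p \<in> V \<and> subspace L \<and> L \<subseteq> model M \<and>
        (\<forall>v\<in>V. \<theta> v \<in> L \<longleftrightarrow> v \<in> Z_group G \<rho> f) \<and>
        (\<forall>v\<in>V. v \<in> Z_group G \<rho> f \<longrightarrow> (\<exists>g\<in>carrier G. v = conj_map G g p))"
      by (intro exI[of _ V'] exI[of _ \<theta>] exI[of _ L]) simp
  qed
  then show ?thesis by (simp add: conjugacy_classes_def topspace_M)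
qed

section \<open>Tangent vectors\<close>

lemma smooth_funI:
  assumes "\<And>U \<phi>. (U, \<phi>) \<in> atlas M \<Longrightarrow> smooth_on (\<phi> ` U) (\<lambda>x. f (inv_into U \<phi> x))"
  shows "smooth_fun M f"
  using assms unfolding smooth_fun_def by (auto simp: o_def)

lemma smooth_fun_chart:
  "smooth_fun M f \<Longrightarrow> (U, \<phi>) \<in> atlas M \<Longrightarrow> smooth_on (\<phi> ` U) (\<lambda>x. f (inv_into U \<phi> x))"
  unfolding smooth_fun_def by (auto simp: o_def)

lemma smooth_fun_add: "smooth_fun M f \<Longrightarrow> smooth_fun M g \<Longrightarrow> smooth_fun M (\<lambda>x. f x + g x)"
  by (rule smooth_funI, rule smooth_on_combine[where p = "(+)"]) (auto intro: smooth_fun_chart Cinf_add)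

lemma smooth_fun_bilinear:
  assumes "bounded_bilinear p" "smooth_fun M f" "smooth_fun M g"
  shows "smooth_fun M (\<lambda>x. p (f x) (g x))"
  by (rule smooth_funI, rule smooth_on_bilinear[OF assms(1)]) (auto intro: smooth_fun_chart assms)

lemma smooth_fun_mult: "smooth_fun M f \<Longrightarrow> smooth_fun M g \<Longrightarrow> smooth_fun M (\<lambda>x. f x * g x :: real)"
  by (rule smooth_fun_bilinear[OF bounded_bilinear_mult])

lemma smooth_fun_linear_compose:
  assumes "bounded_linear l" "smooth_fun M f" shows "smooth_fun M (\<lambda>x. l (f x))"
  by (rule smooth_funI, rule smooth_on_linear_compose[OF assms(1)]) (auto intro: smooth_fun_chart assms)

lemma smooth_fun_const: "smooth_fun M (\<lambda>x. c)"
  by (rule smooth_funI) (rule smooth_on_const)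

lemma smooth_fun_sum:
  assumes "\<And>i. i \<in> I \<Longrightarrow> smooth_fun M (F i)" shows "smooth_fun M (\<lambda>x. \<Sum>i\<in>I. F i x)"
  using assms
proof (induction I rule: infinite_finite_induct)
  case (insert i I)
  have "(\<lambda>x. \<Sum>i\<in>insert i I. F i x) = (\<lambda>x. F i x + (\<Sum>i\<in>I. F i x))" using insert by auto
  then show ?case using smooth_fun_add[of M "F i"] insert by simp
qed (simp_all add: smooth_fun_const)

lemma smooth_fun_cong:
  fixes M :: "('a, 'e::euclidean_space) manifold"
  assumes M: "smooth_manifold M" and eq: "\<And>x. x \<in> topspace (mtop M) \<Longrightarrow> f x = g x"
  shows "smooth_fun M f \<longleftrightarrow> smooth_fun M g"
proof -
  have *: "smooth_on (\<phi> ` U) (\<lambda>x. f (inv_into U \<phi> x)) = smooth_on (\<phi> ` U) (\<lambda>x. g (inv_into U \<phi> x))"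
    if "(U, \<phi>) \<in> atlas M" for U and \<phi> :: "'a \<Rightarrow> 'e"
  proof (rule smooth_on_cong)
    fix x assume "x \<in> \<phi> ` U"
    then have "inv_into U \<phi> x \<in> topspace (mtop M)"
      by (intro subsetD[OF local_chartD(2)[OF smooth_manifoldD(3)[OF M that]] inv_into_into])
    then show "f (inv_into U \<phi> x) = g (inv_into U \<phi> x)" by (rule eq)
  qed
  show ?thesis
  proof
    assume f: "smooth_fun M f"
    show "smooth_fun M g"
      by (rule smooth_funI) (simp only: smooth_fun_chart[OF f] flip: *)
  next
    assume g: "smooth_fun M g"
    show "smooth_fun M f"
      by (rule smooth_funI) (simp only: smooth_fun_chart[OF g] *)
  qed
qed

lemma tangentD:
  assumes "X \<in> tangent_space M p"
  shows "\<not> smooth_fun M f \<Longrightarrow> X f = 0"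
    "smooth_fun M f \<Longrightarrow> smooth_fun M g \<Longrightarrow> X (\<lambda>x. f x + g x) = X f + X g"
    "smooth_fun M f \<Longrightarrow> X (\<lambda>x. c * f x) = c * X f"
    "smooth_fun M f \<Longrightarrow> smooth_fun M g \<Longrightarrow> X (\<lambda>x. f x * g x) = f p * X g + g p * X f"
  using assms unfolding tangent_space_def by auto

lemma tangent_const:
  assumes "X \<in> tangent_space M p" shows "X (\<lambda>x. c) = 0"
proof -
  have "X (\<lambda>x. 1) = 0" using tangentD(4)[OF assms smooth_fun_const[of M 1] smooth_fun_const[of M 1]] by simp
  then show ?thesis using tangentD(3)[OF assms smooth_fun_const[of M 1], of c] by simp
qed

lemma tangent_sum:
  assumes "X \<in> tangent_space M p" "\<And>i. i \<in> I \<Longrightarrow> smooth_fun M (F i)"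
  shows "X (\<lambda>x. \<Sum>i\<in>I. F i x) = (\<Sum>i\<in>I. X (F i))"
  using assms(2)
proof (induction I rule: infinite_finite_induct)
  case (insert i I)
  have "(\<lambda>x. \<Sum>i\<in>insert i I. F i x) = (\<lambda>x. F i x + (\<Sum>i\<in>I. F i x))" using insert by auto
  then show ?case
    using tangentD(2)[OF assms(1), of "F i" "\<lambda>x. \<Sum>i\<in>I. F i x"] insert smooth_fun_sum[of I M F] by simp
qed (simp_all add: tangent_const[OF assms(1)])

text \<open>The closed support lies over a compact set of the chart, so the extension is 0 near every
  point outside of the chart.\<close>

lemma smooth_fun_extend_by_zero:
  fixes M :: "('a, 'e::euclidean_space) manifold" and s :: "'e \<Rightarrow> real"
  assumes M: "smooth_manifold M" and U: "(U, \<phi>) \<in> max_atlas M"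
    and s: "Cinf (ball a r) s" "\<And>x. x \<in> ball a r \<Longrightarrow> \<epsilon> \<le> dist a x \<Longrightarrow> s x = 0" and "\<epsilon> < r"
    and r: "model M \<inter> ball a r \<subseteq> \<phi> ` U"
  shows "smooth_fun M (\<lambda>g. if g \<in> U \<and> \<phi> g \<in> ball a r then s (\<phi> g) else 0)" (is "smooth_fun M ?F")
proof (rule smooth_funI)
  note lcU = max_atlas_local_chart[OF U]
  note D = local_chartD[OF lcU]
  fix V \<psi> assume V: "(V, \<psi>) \<in> atlas M"
  define c where "c = inv_into V \<psi>"
  have c: "plot M (\<psi> ` V) c"
    unfolding c_def by (rule plot_chart_inverse[OF M atlas_max_atlas[OF M V]])
  note cont = plot_continuous[OF M c]
  define W where "W = {u \<in> U. \<phi> u \<in> ball a r}"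
  have W: "openin (mtop M) W" unfolding W_def by (rule local_chart_preimage_open[OF lcU open_ball])
  define K where "K = inv_into U \<phi> ` (model M \<inter> cball a \<epsilon>)"
  have sub: "model M \<inter> cball a \<epsilon> \<subseteq> \<phi> ` U" using r \<open>\<epsilon> < r\<close> by (auto simp: subset_iff)
  have K: "closedin (mtop M) K"
  proof -
    have "compact (model M \<inter> cball a \<epsilon>)"
      using closed_subspace[OF smooth_manifoldD(1)[OF M]] by (simp add: closed_Int_compact)
    then have "compactin (top_of_set (\<phi> ` U)) (model M \<inter> cball a \<epsilon>)"
      using sub by (simp add: compactin_subtopology)
    then have "compactin (mtop M) K"
      unfolding K_def by (rule image_compactin[OF _ plot_continuous[OF M plot_chart_inverse[OF M U]]])
    then show ?thesis by (rule compactin_imp_closedin[OF smooth_manifoldD(2)[OF M]])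
  qed
  have zero: "?F g = 0" if "g \<notin> K" for g
  proof (cases "g \<in> W")
    case True
    then have g: "g \<in> U" "\<phi> g \<in> ball a r" by (auto simp: W_def)
    have "\<phi> g \<notin> cball a \<epsilon>"
    proof
      assume "\<phi> g \<in> cball a \<epsilon>"
      then have "\<phi> g \<in> model M \<inter> cball a \<epsilon>" using g(1) D(5) by blast
      then have "inv_into U \<phi> (\<phi> g) \<in> K" unfolding K_def by blast
      then show False using that g(1) D(3) by simp
    qed
    then show ?thesis using s(2)[OF g(2)] by (simp add: less_imp_le)
  qed (auto simp: W_def)
  show "smooth_on (\<psi> ` V) (\<lambda>x. ?F (inv_into V \<psi> x))"
    unfolding c_def[symmetric]
  proof (rule smooth_on_local)
    fix x assume x: "x \<in> \<psi> ` V"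
    show "\<exists>Q. open Q \<and> x \<in> Q \<and> smooth_on (\<psi> ` V \<inter> Q) (\<lambda>x. ?F (c x))"
    proof (cases "c x \<in> W")
      case True
      obtain R where R: "open R" "{y \<in> \<psi> ` V. c y \<in> W} = \<psi> ` V \<inter> R"
        using continuous_map_preimage_open[OF cont W] .
      have cW: "c y \<in> U" "\<phi> (c y) \<in> ball a r" if "y \<in> \<psi> ` V \<inter> R" for y
        using that unfolding R(2)[symmetric] W_def by auto
      have "smooth_on (\<psi> ` V \<inter> R) (\<lambda>x. \<phi> (c x))"
        by (rule plot_chart[OF M plot_subset[OF c] U]) (use cW in auto)
      then have "smooth_on (\<psi> ` V \<inter> R) (\<lambda>x. s (\<phi> (c x)))"
        by (rule smooth_on_compose[OF _ Cinf_imp_smooth_on[OF s(1) open_ball subset_refl]]) (use cW in auto)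
      moreover have "smooth_on (\<psi> ` V \<inter> R) (\<lambda>x. s (\<phi> (c x))) = smooth_on (\<psi> ` V \<inter> R) (\<lambda>x. ?F (c x))"
        by (rule smooth_on_cong) (use cW in simp)
      moreover have "x \<in> \<psi> ` V \<inter> R" using R(2) x True by blast
      ultimately show ?thesis using R(1) by blast
    next
      case False
      have "c x \<notin> K"
      proof
        assume "c x \<in> K"
        then obtain y where y: "y \<in> model M \<inter> cball a \<epsilon>" "c x = inv_into U \<phi> y" by (auto simp: K_def)
        have "y \<in> \<phi> ` U" using y(1) sub by blast
        then have "c x \<in> U" "\<phi> (c x) = y" using y(2) by (simp_all add: inv_into_into f_inv_into_f)
        then show False using False y(1) \<open>\<epsilon> < r\<close> by (auto simp: W_def)
      qed
      obtain R where R: "open R" "{y \<in> \<psi> ` V. c y \<in> topspace (mtop M) - K} = \<psi> ` V \<inter> R"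
        using continuous_map_preimage_open[OF cont openin_diff[OF openin_topspace K]] .
      have "smooth_on (\<psi> ` V \<inter> R) (\<lambda>x. ?F (c x)) = smooth_on (\<psi> ` V \<inter> R) (\<lambda>x. 0 :: real)"
      proof (rule smooth_on_cong)
        fix y assume "y \<in> \<psi> ` V \<inter> R"
        then have "c y \<notin> K" unfolding R(2)[symmetric] by blast
        then show "?F (c y) = 0" by (rule zero)
      qed
      then have "smooth_on (\<psi> ` V \<inter> R) (\<lambda>x. ?F (c x))" by (simp add: smooth_on_const)
      moreover have "c x \<in> topspace (mtop M)" using plot_topspace[OF M c] x by blast
      then have "x \<in> \<psi> ` V \<inter> R" using R(2) x \<open>c x \<notin> K\<close> by blast
      ultimately show ?thesis using R(1) by blast
    qed
  qed
qed

context lie_rep_chart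
begin

lemma near_a: "\<exists>r>0. model M \<inter> ball a r \<subseteq> \<phi> ` U"
proof -
  obtain O1 where O1: "open O1" "\<phi> ` U = model M \<inter> O1" using lcD(4) by (auto simp: openin_open)
  then obtain r where "r > 0" "ball a r \<subseteq> O1" using a_in(1) open_contains_ball by blast
  then show ?thesis using O1(2) by blast
qed

text \<open>Totalised by 0 in the same way as the elements of the tangent space.\<close>

definition dir :: "'e \<Rightarrow> ('a \<Rightarrow> real) \<Rightarrow> real" where
  "dir v f = (if smooth_fun M f then deriv (\<lambda>t. f (par (a + t *\<^sub>R v))) 0 else 0)"

text \<open>Any extension of \<open>f\<close> in the chart may be used, because the line in direction \<open>v\<close> runs inside the
  model space.\<close>

lemma dir_eq:
  fixes k :: "'e \<Rightarrow> real"
  assumes f: "smooth_fun M f" and k: "open Q'" "a \<in> Q'" "(k has_derivative D) (at a)"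
    "\<And>x. x \<in> \<phi> ` U \<Longrightarrow> x \<in> Q' \<Longrightarrow> k x = f (par x)" and v: "v \<in> model M"
  shows "dir v f = D v"
proof -
  obtain r where r: "r > 0" "model M \<inter> ball a r \<subseteq> \<phi> ` U" using near_a by blast
  have "((\<lambda>t. a + t *\<^sub>R v) has_derivative (\<lambda>t. t *\<^sub>R v)) (at 0)"
    by (auto intro!: derivative_eq_intros)
  then have "((\<lambda>t. k (a + t *\<^sub>R v)) has_derivative (\<lambda>t. D (t *\<^sub>R v))) (at 0)"
    by (rule has_derivative_compose[where g = k]) (use k(3) in simp)
  then have d: "((\<lambda>t. k (a + t *\<^sub>R v)) has_real_derivative D v) (at 0)"
    using linear_scale[OF has_derivative_linear[OF k(3)]]
    by (simp add: has_field_derivative_def mult.commute[of _ "D v"])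
  define S where "S = (\<lambda>t. a + t *\<^sub>R v) -` (Q' \<inter> ball a r)"
  have S: "open S" unfolding S_def
    by (rule open_vimage[OF open_Int[OF k(1) open_ball]]) (intro continuous_intros)
  have "0 \<in> S" using k(2) r(1) by (simp add: S_def)
  have eq: "k (a + t *\<^sub>R v) = f (par (a + t *\<^sub>R v))" if "t \<in> S" for t
  proof -
    have "a + t *\<^sub>R v \<in> model M" using subspace_add[OF subspace_model a_in(2) subspace_scale[OF subspace_model v]] .
    then show ?thesis using that r(2) by (intro k(4)) (auto simp: S_def)
  qed
  have "((\<lambda>t. f (par (a + t *\<^sub>R v))) has_real_derivative D v) (at 0)"
    by (rule has_field_derivative_transform_within_open[OF d S \<open>0 \<in> S\<close> eq])
  then show ?thesis using f by (simp add: dir_def DERIV_imp_deriv)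
qed

lemma local_extension:
  fixes f :: "'a \<Rightarrow> real"
  assumes "smooth_fun M f"
  obtains Q' k where "open Q'" "a \<in> Q'" "Cinf Q' k" "(k has_derivative frechet_derivative k (at a)) (at a)"
    "\<And>x. x \<in> \<phi> ` U \<Longrightarrow> x \<in> Q' \<Longrightarrow> k x = f (par x)"
proof -
  have "smooth_on (\<phi> ` U) (\<lambda>x. f (par x))" by (rule plot_smooth_fun[OF manifold_M assms par_plot])
  from smooth_onE[OF this a_in(1)] show thesis using that Cinf_has_derivative by metis
qed

lemma dir_tangent:
  assumes v: "v \<in> model M" shows "dir v \<in> lie_algebra G M"
  unfolding lie_algebra_def tangent_space_def
proof (intro CollectI conjI allI impI)
  show "dir v f = 0" if "\<not> smooth_fun M f" for f using that by (simp add: dir_def)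
next
  fix f g :: "'a \<Rightarrow> real" assume f: "smooth_fun M f" and g: "smooth_fun M g"
  obtain Qf kf where kf: "open Qf" "a \<in> Qf" "Cinf Qf kf" "(kf has_derivative frechet_derivative kf (at a)) (at a)"
    "\<And>x. x \<in> \<phi> ` U \<Longrightarrow> x \<in> Qf \<Longrightarrow> kf x = f (par x)" using local_extension[OF f] by metis
  obtain Qg kg where kg: "open Qg" "a \<in> Qg" "Cinf Qg kg" "(kg has_derivative frechet_derivative kg (at a)) (at a)"
    "\<And>x. x \<in> \<phi> ` U \<Longrightarrow> x \<in> Qg \<Longrightarrow> kg x = g (par x)" using local_extension[OF g] by metis
  have df: "dir v f = frechet_derivative kf (at a) v" by (rule dir_eq[OF f kf(1,2,4,5) v])
  have dg: "dir v g = frechet_derivative kg (at a) v" by (rule dir_eq[OF g kg(1,2,4,5) v])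
  have Qfg: "open (Qf \<inter> Qg)" "a \<in> Qf \<inter> Qg" using kf kg by auto
  show "dir v (\<lambda>x. f x + g x) = dir v f + dir v g"
    unfolding df dg
    by (rule dir_eq[OF smooth_fun_add[OF f g] Qfg has_derivative_add[OF kf(4) kg(4)] _ v]) (use kf(5) kg(5) in simp)
  have fa: "kf a = f \<one>\<^bsub>G\<^esub>" "kg a = g \<one>\<^bsub>G\<^esub>" using kf(5) kg(5) kf(2) kg(2) a_in(1) par_a by simp_all
  have "dir v (\<lambda>x. f x * g x) = kf a * frechet_derivative kg (at a) v + frechet_derivative kf (at a) v * kg a"
    by (rule dir_eq[OF smooth_fun_mult[OF f g] Qfg has_derivative_mult[OF kf(4) kg(4)] _ v]) (use kf(5) kg(5) in simp)
  then show "dir v (\<lambda>x. f x * g x) = f \<one>\<^bsub>G\<^esub> * dir v g + g \<one>\<^bsub>G\<^esub> * dir v f"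
    by (simp add: df dg fa)
next
  fix c and f :: "'a \<Rightarrow> real" assume f: "smooth_fun M f"
  obtain Qf kf where kf: "open Qf" "a \<in> Qf" "Cinf Qf kf" "(kf has_derivative frechet_derivative kf (at a)) (at a)"
    "\<And>x. x \<in> \<phi> ` U \<Longrightarrow> x \<in> Qf \<Longrightarrow> kf x = f (par x)" using local_extension[OF f] by metis
  have df: "dir v f = frechet_derivative kf (at a) v" by (rule dir_eq[OF f kf(1,2,4,5) v])
  show "dir v (\<lambda>x. c * f x) = c * dir v f"
    unfolding df
    by (rule dir_eq[OF smooth_fun_linear_compose[OF bounded_linear_mult_right f] kf(1,2)
          has_derivative_mult_right[OF kf(4)] _ v]) (use kf(5) in simp)
qed

lemma dir_linear:
  assumes "v \<in> model M" "w \<in> model M"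
  shows "dir (\<alpha> *\<^sub>R v + \<beta> *\<^sub>R w) f = \<alpha> * dir v f + \<beta> * dir w f"
proof (cases "smooth_fun M f")
  case f: True
  obtain Qf kf where kf: "open Qf" "a \<in> Qf" "Cinf Qf kf" "(kf has_derivative frechet_derivative kf (at a)) (at a)"
    "\<And>x. x \<in> \<phi> ` U \<Longrightarrow> x \<in> Qf \<Longrightarrow> kf x = f (par x)" using local_extension[OF f] by metis
  note df = dir_eq[OF f kf(1,2,4,5)]
  have "\<alpha> *\<^sub>R v + \<beta> *\<^sub>R w \<in> model M"
    using assms by (intro subspace_add[OF subspace_model] subspace_scale[OF subspace_model])
  then show ?thesis
    using df assms has_derivative_linear[OF kf(4)] by (simp add: linear_add linear_scale)
qed (simp add: dir_def)

lemma dir_cong: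
  assumes "v \<in> model M" "\<And>x. x \<in> carrier G \<Longrightarrow> f x = g x"
  shows "dir v f = dir v g"
proof (cases "smooth_fun M f")
  case f: True
  have g: "smooth_fun M g"
    using f smooth_fun_cong[OF manifold_M, of f g] assms(2) topspace_M by simp
  obtain Qf kf where kf: "open Qf" "a \<in> Qf" "Cinf Qf kf" "(kf has_derivative frechet_derivative kf (at a)) (at a)"
    "\<And>x. x \<in> \<phi> ` U \<Longrightarrow> x \<in> Qf \<Longrightarrow> kf x = f (par x)" using local_extension[OF f] by metis
  have "dir v g = frechet_derivative kf (at a) v"
    by (rule dir_eq[OF g kf(1,2,4) _ assms(1)]) (use kf(5) par_carrier assms(2) in simp)
  then show ?thesis using dir_eq[OF f kf(1,2,4,5) assms(1)] by simp
next
  case False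
  then have "\<not> smooth_fun M g"
    using smooth_fun_cong[OF manifold_M, of f g] assms(2) topspace_M by simp
  then show ?thesis using False by (simp add: dir_def)
qed

text \<open>Globally smooth functions whose differentials at the identity are those of the linear
  coordinates of the chart, and whose values under a derivation are the components of a vector
  that induces the derivation.\<close>

definition coordinate_system :: "('e \<Rightarrow> 'a \<Rightarrow> real) \<Rightarrow> bool" where
  "coordinate_system \<xi> \<longleftrightarrow> (\<forall>b. smooth_fun M (\<xi> b)) \<and> (\<forall>v\<in>model M. \<forall>b. dir v (\<xi> b) = v \<bullet> b) \<and>
     (\<forall>X\<in>lie_algebra G M. \<exists>v\<in>model M. X = dir v \<and> (\<forall>b\<in>Basis. X (\<xi> b) = v \<bullet> b))"

text \<open>By Hadamard's lemma a smooth function is, near the identity, a constant plus a combination of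
  the coordinates with smooth coefficients; multiplied by bump functions this becomes an
  identity between global functions, to which the Leibniz rule applies.\<close>

theorem coordinate_system_exists: "\<exists>\<xi>. coordinate_system \<xi>"
proof -
  obtain r where r: "r > 0" "model M \<inter> ball a r \<subseteq> \<phi> ` U" using near_a by blast
  obtain \<beta>0 :: "'e \<Rightarrow> real" where \<beta>0: "Cinf UNIV \<beta>0" "\<beta>0 a = 1" "\<And>x. r / 2 \<le> dist a x \<Longrightarrow> \<beta>0 x = 0"
    using smooth_bump[of "r / 2" a] r(1) by auto
  define ext where "ext \<rho> s g = (if g \<in> U \<and> \<phi> g \<in> ball a \<rho> then s (\<phi> g) else 0)" for \<rho> :: real and s :: "'e \<Rightarrow> real" and g
  have ext_smooth: "smooth_fun M (ext \<rho> s)"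
    if "\<rho> > 0" "\<rho> \<le> r" "Cinf (ball a \<rho>) s" "\<And>x. x \<in> ball a \<rho> \<Longrightarrow> \<rho> / 2 \<le> dist a x \<Longrightarrow> s x = 0" for \<rho> s
    unfolding ext_def
    by (rule smooth_fun_extend_by_zero[where \<epsilon> = "\<rho> / 2", OF manifold_M chart(1) that(3,4)]) (use that(1,2) r(2) in auto)
  have ext_one: "ext \<rho> s \<one>\<^bsub>G\<^esub> = s a" if "\<rho> > 0" for \<rho> s
    using chart(2) that by (simp add: ext_def a_def)
  have ext_par: "ext \<rho> s (par x) = s x" if "x \<in> \<phi> ` U" "x \<in> ball a \<rho>" for \<rho> s x
    using that inv_into_into[OF that(1)] f_inv_into_f[OF that(1)] by (simp add: ext_def)
  define s where "s b x = \<beta>0 x * ((x + - a) \<bullet> b)" for b x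
  have s_smooth: "Cinf UNIV (s b)" for b
  proof -
    have "Cinf UNIV (\<lambda>x. x + - a)"
      by (rule Cinf_add[OF open_UNIV Cinf_bounded_linear[OF bounded_linear_ident] Cinf_const])
    then have "Cinf UNIV (\<lambda>x. (x + - a) \<bullet> b)" by (rule Cinf_linear_compose[OF bounded_linear_inner_left open_UNIV])
    then show ?thesis unfolding s_def by (rule Cinf_bilinear[OF bounded_bilinear_mult open_UNIV \<beta>0(1)])
  qed
  define \<xi> where "\<xi> b = ext r (s b)" for b
  have \<xi>: "smooth_fun M (\<xi> b)" for b
    unfolding \<xi>_def by (rule ext_smooth[OF r(1) order_refl Cinf_subset[OF s_smooth subset_UNIV]]) (simp add: s_def \<beta>0(3))
  have \<xi>_one: "\<xi> b \<one>\<^bsub>G\<^esub> = 0" for b by (simp add: \<xi>_def ext_one r(1) s_def)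
  have dir_\<xi>: "dir v (\<xi> b) = v \<bullet> b" if "v \<in> model M" for v b
  proof -
    have d0: "(\<beta>0 has_derivative frechet_derivative \<beta>0 (at a)) (at a)"
      by (rule Cinf_has_derivative[OF \<beta>0(1) UNIV_I])
    have d1: "((\<lambda>x. (x + - a) \<bullet> b) has_derivative (\<lambda>v. v \<bullet> b)) (at a)"
      by (auto intro!: derivative_eq_intros)
    have "(s b has_derivative (\<lambda>v. \<beta>0 a * (v \<bullet> b) + frechet_derivative \<beta>0 (at a) v * ((a + - a) \<bullet> b))) (at a)"
      unfolding s_def by (rule has_derivative_mult[OF d0 d1])
    then have d: "(s b has_derivative (\<lambda>v. v \<bullet> b)) (at a)" by (simp add: \<beta>0(2))
    show ?thesis
      by (rule dir_eq[OF \<xi> open_ball[of a r] _ d _ that]) (use r(1) ext_par in \<open>simp_all add: \<xi>_def\<close>)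
  qed
  have "\<exists>v\<in>model M. X = dir v \<and> (\<forall>b\<in>Basis. X (\<xi> b) = v \<bullet> b)" if "X \<in> lie_algebra G M" for X
  proof -
    have X: "X \<in> tangent_space M \<one>\<^bsub>G\<^esub>" using that by (simp add: lie_algebra_def)
    note XD = tangentD[OF X]
    define v where "v = (\<Sum>b\<in>Basis. X (\<xi> b) *\<^sub>R b)"
    have vb: "v \<bullet> b = X (\<xi> b)" if "b \<in> Basis" for b
      using that by (simp add: v_def inner_sum_left inner_Basis if_distrib cong: if_cong)
    \<comment> \<open>A vector \<open>w\<close> orthogonal to the model space gives the trivial relation \<open>\<Sum> (w \<bullet> b) \<xi> b = 0\<close>.\<close>
    have "v - P v = 0"
    proof -
      define w where "w = v - P v"
      have w: "w \<bullet> k = 0" if "k \<in> model M" for k using P(4)[OF that] by (simp add: w_def)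
      have "(\<Sum>b\<in>Basis. (w \<bullet> b) * \<xi> b g) = 0" for g
      proof (cases "g \<in> U \<and> \<phi> g \<in> ball a r")
        case True
        have "\<phi> g + - a \<in> model M" using subspace_diff[OF subspace_model _ a_in(2)] True lcD(5) by auto
        then have "w \<bullet> (\<phi> g + - a) = 0" by (rule w)
        have "(\<Sum>b\<in>Basis. (w \<bullet> b) * \<xi> b g) = \<beta>0 (\<phi> g) * (\<Sum>b\<in>Basis. (w \<bullet> b) * ((\<phi> g + - a) \<bullet> b))"
          using True by (simp add: \<xi>_def ext_def s_def sum_distrib_left mult_ac)
        also have "\<dots> = \<beta>0 (\<phi> g) * (w \<bullet> (\<phi> g + - a))"
          by (subst euclidean_inner[of w "\<phi> g + - a"]) (rule refl)
        finally show ?thesis using \<open>w \<bullet> (\<phi> g + - a) = 0\<close> by simp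
      qed (auto simp: \<xi>_def ext_def)
      then have "X (\<lambda>g. \<Sum>b\<in>Basis. (w \<bullet> b) * \<xi> b g) = 0" using tangent_const[OF X, of 0] by simp
      moreover have "X (\<lambda>g. \<Sum>b\<in>Basis. (w \<bullet> b) * \<xi> b g) = (\<Sum>b\<in>Basis. X (\<lambda>g. (w \<bullet> b) * \<xi> b g))"
        by (rule tangent_sum[OF X]) (rule smooth_fun_linear_compose[OF bounded_linear_mult_right \<xi>])
      moreover have "\<dots> = (\<Sum>b\<in>Basis. (w \<bullet> b) * (v \<bullet> b))" by (simp add: XD(3)[OF \<xi>] vb)
      moreover have "\<dots> = w \<bullet> v" by (rule euclidean_inner[symmetric])
      ultimately have "w \<bullet> v = 0" by simp
      then have "w \<bullet> w = 0" using w[OF P(2)[of v]] by (simp add: w_def inner_diff_right)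
      then show ?thesis by (simp add: w_def)
    qed
    then have vm: "v \<in> model M" using P(2)[of v] by simp
    have "X f = dir v f" for f
    proof (cases "smooth_fun M f")
      case False
      then show ?thesis using XD(1) by (simp add: dir_def)
    next
      case f: True
      obtain Q' k where k: "open Q'" "a \<in> Q'" "Cinf Q' k" "(k has_derivative frechet_derivative k (at a)) (at a)"
        "\<And>x. x \<in> \<phi> ` U \<Longrightarrow> x \<in> Q' \<Longrightarrow> k x = f (par x)" using local_extension[OF f] by metis
      obtain d where d: "d > 0" "ball a d \<subseteq> Q'" using k(1,2) open_contains_ball by blast
      define r' where "r' = min d r"
      have r': "r' > 0" "r' \<le> r" "ball a r' \<subseteq> Q'" using d r(1) by (auto simp: r'_def subset_iff)
      obtain H where H: "\<And>b. Cinf (ball a r') (H b)" "\<And>b. H b a = frechet_derivative k (at a) b"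
        "\<And>x. x \<in> ball a r' \<Longrightarrow> k x = k a + (\<Sum>b\<in>Basis. ((x - a) \<bullet> b) * H b x)"
        by (rule Hadamard[OF Cinf_subset[OF k(3) r'(3)] r'(1)], rule that)
      obtain \<beta> :: "'e \<Rightarrow> real" where \<beta>: "Cinf UNIV \<beta>" "\<beta> a = 1" "\<And>x. r' / 2 \<le> dist a x \<Longrightarrow> \<beta> x = 0"
        using smooth_bump[of "r' / 2" a] r'(1) by auto
      define B where "B = ext r' \<beta>"
      define B0 where "B0 = ext r \<beta>0"
      define Gb where "Gb b = ext r' (\<lambda>x. \<beta> x * H b x)" for b
      define u where "u g = f g + - f \<one>\<^bsub>G\<^esub>" for g
      have sB: "smooth_fun M B" unfolding B_def
        by (rule ext_smooth[OF r'(1,2) Cinf_subset[OF \<beta>(1) subset_UNIV] \<beta>(3)])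
      have sB0: "smooth_fun M B0" unfolding B0_def
        by (rule ext_smooth[OF r(1) order_refl Cinf_subset[OF \<beta>0(1) subset_UNIV] \<beta>0(3)])
      have sG: "smooth_fun M (Gb b)" for b unfolding Gb_def
        by (rule ext_smooth[OF r'(1,2) Cinf_bilinear[OF bounded_bilinear_mult open_ball Cinf_subset[OF \<beta>(1) subset_UNIV] H(1)]])
           (simp add: \<beta>(3))
      have su: "smooth_fun M u" unfolding u_def by (rule smooth_fun_add[OF f smooth_fun_const])
      have ka: "k a = f \<one>\<^bsub>G\<^esub>" using k(5)[OF a_in(1) k(2)] par_a by simp
      \<comment> \<open>The factor \<open>B0\<close> matches the bump function contained in \<open>\<xi>\<close>; it does not affect \<open>X u\<close> because
        it is 1 at the identity, where \<open>u\<close> vanishes.\<close>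
      have id: "(\<lambda>g. B g * B0 g * u g) = (\<lambda>g. \<Sum>b\<in>Basis. \<xi> b g * Gb b g)"
      proof
        fix g
        show "B g * B0 g * u g = (\<Sum>b\<in>Basis. \<xi> b g * Gb b g)"
        proof (cases "g \<in> U \<and> \<phi> g \<in> ball a r'")
          case True
          then have g: "g \<in> U" "\<phi> g \<in> ball a r'" "\<phi> g \<in> ball a r" using r'(2) by auto
          have "f g = k (\<phi> g)" using k(5)[of "\<phi> g"] g r'(3) par by auto
          then have "u g = (\<Sum>b\<in>Basis. ((\<phi> g - a) \<bullet> b) * H b (\<phi> g))" using H(3)[OF g(2)] ka by (simp add: u_def)
          then show ?thesis using g
            by (simp add: B_def B0_def \<xi>_def Gb_def ext_def s_def sum_distrib_left mult_ac)
        qed (auto simp: B_def Gb_def ext_def)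
      qed
      have "X (\<lambda>g. B g * B0 g * u g) = X u"
        using XD(4)[OF smooth_fun_mult[OF sB sB0] su] by (simp add: u_def B_def B0_def ext_one r(1) r'(1) \<beta>(2) \<beta>0(2))
      moreover have "X (\<lambda>g. \<Sum>b\<in>Basis. \<xi> b g * Gb b g) = (\<Sum>b\<in>Basis. X (\<lambda>g. \<xi> b g * Gb b g))"
        by (rule tangent_sum[OF X]) (rule smooth_fun_mult[OF \<xi> sG])
      moreover have "\<dots> = (\<Sum>b\<in>Basis. (v \<bullet> b) *\<^sub>R frechet_derivative k (at a) b)"
        using XD(4)[OF \<xi> sG] \<xi>_one by (intro sum.cong) (simp_all add: vb Gb_def ext_one r'(1) \<beta>(2) H(2))
      moreover have "\<dots> = frechet_derivative k (at a) (\<Sum>b\<in>Basis. (v \<bullet> b) *\<^sub>R b)"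
        using has_derivative_linear[OF k(4)] by (simp only: linear_sum linear_scale)
      moreover have "\<dots> = frechet_derivative k (at a) v" by (simp only: euclidean_representation)
      moreover have "\<dots> = dir v f" using dir_eq[OF f k(1,2,4,5) vm] by simp
      moreover have "X u = X f" unfolding u_def
        using XD(2)[OF f smooth_fun_const[of M "- f \<one>\<^bsub>G\<^esub>"]] tangent_const[OF X, of "- f \<one>\<^bsub>G\<^esub>"] by simp
      ultimately show ?thesis using id by simp
    qed
    then show ?thesis using vm vb by (intro bexI[of _ v]) auto
  qed
  then have "coordinate_system \<xi>" unfolding coordinate_system_def using \<xi> dir_\<xi> by blast
  then show ?thesis by blast
qed

end

section \<open>The Lie algebra as a manifold\<close>

lemma second_countable_subset: "second_countable (top_of_set (S :: 'e::euclidean_space set))"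
proof -
  obtain \<B> :: "'e set set" where \<B>: "countable \<B>" "\<And>C. C \<in> \<B> \<Longrightarrow> open C"
    "\<And>S. open S \<Longrightarrow> \<exists>U. U \<subseteq> \<B> \<and> S = \<Union>U"
    using univ_second_countable by metis
  have "second_countable (euclidean :: 'e topology)"
    unfolding second_countable_def
  proof (intro exI[of _ \<B>] conjI allI impI)
    show "countable \<B>" by (rule \<B>(1))
    show "\<forall>V\<in>\<B>. openin euclidean V" using \<B>(2) by simp
    show "\<exists>V\<in>\<B>. x \<in> V \<and> V \<subseteq> U" if "openin euclidean U \<and> x \<in> U" for U x
      using \<B>(3)[of U] that by auto
  qed
  then show ?thesis by (rule second_countable_subtopology)
qed

context lie_rep_chart
begin

abbreviation (input) "\<gg> \<equiv> lie_algebra G M"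
abbreviation (input) "LA \<equiv> lie_algebra_manifold G M"

definition "coord = (SOME \<xi>. coordinate_system \<xi>)"

text \<open>The standard linear chart of the Lie algebra, inverse to \<open>dir\<close>.\<close>

definition L0 :: "(('a \<Rightarrow> real) \<Rightarrow> real) \<Rightarrow> 'e" where
  "L0 X = (\<Sum>b\<in>Basis. X (coord b) *\<^sub>R b)"

lemma coord: "coordinate_system coord"
  unfolding coord_def using coordinate_system_exists by (rule someI_ex)

lemma L0_dir: "v \<in> model M \<Longrightarrow> L0 (dir v) = v"
  using coord unfolding coordinate_system_def L0_def by (simp add: euclidean_representation)

lemma dir_L0:
  assumes "X \<in> \<gg>" shows "L0 X \<in> model M" "dir (L0 X) = X"
proof -
  obtain v where "v \<in> model M" "X = dir v"
    using coord assms unfolding coordinate_system_def by blast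
  then show "L0 X \<in> model M" "dir (L0 X) = X" using L0_dir by simp_all
qed

lemma dir_combination:
  assumes "v \<in> model M" "w \<in> model M"
  shows "dir (\<alpha> *\<^sub>R v + \<beta> *\<^sub>R w) = (\<lambda>f. \<alpha> * dir v f + \<beta> * dir w f)"
  using dir_linear[OF assms] by blast

lemma L0_combination: "L0 (\<lambda>f. \<alpha> * X f + \<beta> * Y f) = \<alpha> *\<^sub>R L0 X + \<beta> *\<^sub>R L0 Y"
  by (simp add: L0_def scaleR_add_left sum.distrib scaleR_sum_right)

lemma model_combination: "v \<in> model M \<Longrightarrow> w \<in> model M \<Longrightarrow> \<alpha> *\<^sub>R v + \<beta> *\<^sub>R w \<in> model M"
  by (intro subspace_add[OF subspace_model] subspace_scale[OF subspace_model])

lemma lie_algebra_combination: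
  assumes "X \<in> \<gg>" "Y \<in> \<gg>" shows "(\<lambda>f. \<alpha> * X f + \<beta> * Y f) \<in> \<gg>"
proof -
  have "(\<lambda>f. \<alpha> * X f + \<beta> * Y f) = dir (\<alpha> *\<^sub>R L0 X + \<beta> *\<^sub>R L0 Y)"
    using dir_combination[OF dir_L0(1)[OF assms(1)] dir_L0(1)[OF assms(2)]] dir_L0(2) assms by simp
  then show ?thesis using dir_tangent[OF model_combination] dir_L0(1) assms by metis
qed

lemma L0_image: "L0 ` \<gg> = model M"
  using dir_L0(1) L0_dir dir_tangent by (force simp: image_iff)

lemma L0_inj: "inj_on L0 \<gg>"
  by (rule inj_onI) (metis dir_L0(2))

lemma L0_inverse: "x \<in> model M \<Longrightarrow> inv_into \<gg> L0 x = dir x"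
  by (rule inv_into_f_eq[OF L0_inj]) (simp_all add: dir_tangent L0_dir)

lemma LA_simps: "mtop LA = top_of_set \<gg>" "model LA = model M" "topspace (mtop LA) = \<gg>"
  by (simp_all add: lie_algebra_manifold_def)

lemma L0_atlas: "(\<gg>, L0) \<in> atlas LA"
  unfolding lie_algebra_manifold_def
  using L0_image L0_inj L0_combination by (auto simp: bij_betw_def)

lemma linear_on_model:
  fixes g :: "'e \<Rightarrow> 'c::real_normed_vector"
  assumes "\<And>x y \<alpha> \<beta>. x \<in> model M \<Longrightarrow> y \<in> model M \<Longrightarrow> g (\<alpha> *\<^sub>R x + \<beta> *\<^sub>R y) = \<alpha> *\<^sub>R g x + \<beta> *\<^sub>R g y"
  shows "bounded_linear (\<lambda>x. g (P x))"
proof -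
  have linP: "linear P" using P(1) bounded_linear.linear by blast
  have "linear (\<lambda>x. g (P x))"
  proof (rule linearI)
    show "g (P (x + y)) = g (P x) + g (P y)" for x y
      using assms[OF P(2) P(2), of 1 x 1 y] linear_add[OF linP] by simp
    show "g (P (c *\<^sub>R x)) = c *\<^sub>R g (P x)" for c x
      using assms[OF P(2) P(2), of c x 0 x] linear_scale[OF linP] by simp
  qed
  then show ?thesis by (simp add: linear_conv_bounded_linear)
qed

lemma continuous_L0: "continuous_on \<gg> L0"
  unfolding L0_def
  by (intro continuous_intros continuous_on_subset[OF continuous_on_product_coordinates subset_UNIV])

lemma continuous_dir: "continuous_on (model M) dir"
proof (rule continuous_on_coordinatewise_then_product)
  fix f
  have "bounded_linear (\<lambda>x. dir (P x) f)"
    by (rule linear_on_model) (simp add: dir_linear)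
  then have "continuous_on (model M) (\<lambda>x. dir (P x) f)" by (rule linear_continuous_on)
  then show "continuous_on (model M) (\<lambda>v. dir v f)" using P(3) by (simp cong: continuous_on_cong)
qed

text \<open>Any linear chart differs from \<open>L0\<close> by linear maps of the model space, so topology and
  compatibility need only be examined for \<open>L0\<close>.\<close>

lemma LA_atlasD:
  assumes "(W, L) \<in> atlas LA"
  shows "W = \<gg>" "inj_on L \<gg>" "L ` \<gg> = model M"
    "\<exists>A. bounded_linear A \<and> (\<forall>X\<in>\<gg>. L X = A (L0 X))"
    "\<exists>B. bounded_linear B \<and> (\<forall>x\<in>model M. L0 (inv_into \<gg> L x) = B x \<and> B x \<in> model M)"
proof -
  have L: "W = \<gg>" "bij_betw L \<gg> (model M)"
    "\<And>X Y \<alpha> \<beta>. X \<in> \<gg> \<Longrightarrow> Y \<in> \<gg> \<Longrightarrow> L (\<lambda>f. \<alpha> * X f + \<beta> * Y f) = \<alpha> *\<^sub>R L X + \<beta> *\<^sub>R L Y"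
    using assms unfolding lie_algebra_manifold_def by auto
  show "W = \<gg>" by (rule L(1))
  show inj: "inj_on L \<gg>" and im: "L ` \<gg> = model M" using L(2) by (auto simp: bij_betw_def)
  show "\<exists>A. bounded_linear A \<and> (\<forall>X\<in>\<gg>. L X = A (L0 X))"
  proof (intro exI conjI ballI)
    show "bounded_linear (\<lambda>x. L (dir (P x)))"
      by (rule linear_on_model) (simp add: dir_combination L(3) dir_tangent)
    show "L X = L (dir (P (L0 X)))" if "X \<in> \<gg>" for X using P(3) dir_L0[OF that] by simp
  qed
  have invL: "inv_into \<gg> L x \<in> \<gg>" "L (inv_into \<gg> L x) = x" if "x \<in> model M" for x
    using that im inv_into_into[of x L \<gg>] f_inv_into_f[of x L \<gg>] by simp_all
  show "\<exists>B. bounded_linear B \<and> (\<forall>x\<in>model M. L0 (inv_into \<gg> L x) = B x \<and> B x \<in> model M)"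
  proof (intro exI conjI ballI)
    show "bounded_linear (\<lambda>x. L0 (inv_into \<gg> L (P x)))"
    proof (rule linear_on_model)
      fix x y \<alpha> \<beta> assume xy: "x \<in> model M" "y \<in> model M"
      have "inv_into \<gg> L (\<alpha> *\<^sub>R x + \<beta> *\<^sub>R y) = (\<lambda>f. \<alpha> * inv_into \<gg> L x f + \<beta> * inv_into \<gg> L y f)"
        by (rule inv_into_f_eq[OF inj lie_algebra_combination]) (use invL xy L(3) in simp_all)
      then show "L0 (inv_into \<gg> L (\<alpha> *\<^sub>R x + \<beta> *\<^sub>R y)) = \<alpha> *\<^sub>R L0 (inv_into \<gg> L x) + \<beta> *\<^sub>R L0 (inv_into \<gg> L y)"
        by (simp add: L0_combination)
    qed
    show "L0 (inv_into \<gg> L x) = L0 (inv_into \<gg> L (P x))" "L0 (inv_into \<gg> L (P x)) \<in> model M"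
      if "x \<in> model M" for x
      using that P(3) dir_L0(1) invL(1) by simp_all
  qed
qed

lemma LA_homeomorphic_maps:
  assumes "(W, L) \<in> atlas LA"
  shows "homeomorphic_maps (top_of_set \<gg>) (top_of_set (model M)) L (inv_into \<gg> L)"
proof -
  note D = LA_atlasD[OF assms]
  obtain A where A: "bounded_linear A" "\<And>X. X \<in> \<gg> \<Longrightarrow> L X = A (L0 X)" using D(4) by blast
  obtain B where B: "bounded_linear B" "\<And>x. x \<in> model M \<Longrightarrow> L0 (inv_into \<gg> L x) = B x \<and> B x \<in> model M"
    using D(5) by blast
  have invL: "inv_into \<gg> L x \<in> \<gg>" "L (inv_into \<gg> L x) = x" if "x \<in> model M" for x
    using that D(3) inv_into_into[of x L \<gg>] f_inv_into_f[of x L \<gg>] by simp_all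
  have "continuous_on \<gg> (\<lambda>X. A (L0 X))" by (rule bounded_linear.continuous_on[OF A(1) continuous_L0])
  then have 1: "continuous_on \<gg> L" using A(2) by (simp cong: continuous_on_cong)
  have "continuous_on (model M) (\<lambda>x. dir (B x))"
    by (rule continuous_on_compose2[OF continuous_dir linear_continuous_on[OF B(1)]]) (use B(2) in auto)
  moreover have "dir (B x) = inv_into \<gg> L x" if "x \<in> model M" for x
    using B(2)[OF that] dir_L0(2)[OF invL(1)[OF that]] by simp
  ultimately have 2: "continuous_on (model M) (inv_into \<gg> L)" by (simp cong: continuous_on_cong)
  show ?thesis
    unfolding homeomorphic_maps_def
    using 1 2 D(2,3) invL by (auto simp: continuous_map_in_subtopology)
qed

lemma manifold_LA: "smooth_manifold LA"
proof -
  have hom: "top_of_set \<gg> homeomorphic_space top_of_set (model M)"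
    using LA_homeomorphic_maps[OF L0_atlas] unfolding homeomorphic_space_def by blast
  have "local_chart LA W L" if WL: "(W, L) \<in> atlas LA" for W L
  proof -
    note D = LA_atlasD[OF WL]
    have "homeomorphic_map (top_of_set \<gg>) (top_of_set (model M)) L"
      using LA_homeomorphic_maps[OF WL] homeomorphic_maps_map by blast
    then show ?thesis
      by (simp add: local_chart_def LA_simps D(1,3) subtopology_subtopology)
  qed
  moreover have "chart_compat (W, L) (W', L')" if WL: "(W, L) \<in> atlas LA" "(W', L') \<in> atlas LA" for W L W' L'
  proof -
    have smooth: "smooth_on (model M) (L' \<circ> inv_into \<gg> L)"
      if at: "(W, L) \<in> atlas LA" "(W', L') \<in> atlas LA" for W L W' L'
    proof -
      obtain A where A: "bounded_linear A" "\<And>X. X \<in> \<gg> \<Longrightarrow> L' X = A (L0 X)"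
        using LA_atlasD(4)[OF at(2)] by blast
      obtain B where B: "bounded_linear B" "\<And>x. x \<in> model M \<Longrightarrow> L0 (inv_into \<gg> L x) = B x"
        using LA_atlasD(5)[OF at(1)] by blast
      have "smooth_on (model M) (\<lambda>x. A (B x))"
        by (rule smooth_on_bounded_linear[OF bounded_linear_compose[OF A(1) B(1)]])
      moreover have "A (B x) = (L' \<circ> inv_into \<gg> L) x" if "x \<in> model M" for x
        using A(2)[of "inv_into \<gg> L x"] B(2)[OF that] inv_into_into[of x L \<gg>] that
          LA_atlasD(3)[OF at(1)] by simp
      ultimately show ?thesis using smooth_on_cong by (metis (no_types, lifting))
    qed
    show ?thesis
      unfolding chart_compat_def prod.case
      using smooth[OF WL(1,2)] smooth[OF WL(2,1)] LA_atlasD(1,3)[OF WL(1)] LA_atlasD(1,3)[OF WL(2)] by simp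
  qed
  moreover have "Hausdorff_space (top_of_set \<gg>)"
    using homeomorphic_Hausdorff_space[OF hom] Hausdorff_space_subtopology[OF Hausdorff_space_euclidean] by blast
  moreover have "second_countable (top_of_set \<gg>)"
    using homeomorphic_space_second_countability[OF hom] second_countable_subset by blast
  moreover have "(\<Union>(U, \<phi>)\<in>atlas LA. U) = \<gg>"
    using L0_atlas LA_atlasD(1) by fastforce
  ultimately show ?thesis
    unfolding smooth_manifold_def using subspace_model by (auto simp: LA_simps)
qed

lemma L0_max_atlas: "(\<gg>, L0) \<in> max_atlas LA"
  by (rule atlas_max_atlas[OF manifold_LA L0_atlas])

lemma plot_LA_iff: "plot LA D d \<longleftrightarrow> d ` D \<subseteq> \<gg> \<and> smooth_on D (\<lambda>x. L0 (d x))"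
proof
  assume d: "plot LA D d"
  then show "d ` D \<subseteq> \<gg> \<and> smooth_on D (\<lambda>x. L0 (d x))"
    using plot_topspace[OF manifold_LA d] plot_chart[OF manifold_LA d L0_max_atlas] by (simp add: LA_simps)
next
  assume "d ` D \<subseteq> \<gg> \<and> smooth_on D (\<lambda>x. L0 (d x))"
  then show "plot LA D d" unfolding plot_def
    by (intro ballI exI[of _ \<gg>] exI[of _ L0] exI[of _ UNIV]) (auto simp: L0_atlas o_def)
qed

section \<open>The differential of the representation and the adjoint action\<close>

lemma functional_rho_smooth: "bounded_linear \<Lambda> \<Longrightarrow> smooth_fun M (\<Lambda> \<circ> \<rho>)"
  using smooth_fun_linear_compose[OF _ smooth_rho, of \<Lambda>] by (simp add: o_def)

lemma dir_functional_rho: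
  fixes \<Lambda> :: "('v \<Rightarrow>\<^sub>L 'v) \<Rightarrow> real"
  assumes "bounded_linear \<Lambda>" "v \<in> model M" shows "dir v (\<Lambda> \<circ> \<rho>) = \<Lambda> (T v)"
proof -
  have "dir v (\<Lambda> \<circ> \<rho>) = \<Lambda> (frechet_derivative h (at a) v)"
    by (rule dir_eq[OF functional_rho_smooth[OF assms(1)] h(1) a_in(3)
          bounded_linear.has_derivative[OF assms(1) h_derivative] _ assms(2)])
       (simp add: h(4))
  then show ?thesis using P(3)[OF assms(2)] by (simp add: T_def)
qed

lemma rep_differential_eq:
  assumes X: "X \<in> \<gg>" shows "rep_differential \<rho> X = T (L0 X)"
  unfolding rep_differential_def
proof (rule the_equality)
  have eq: "X (\<Lambda> \<circ> \<rho>) = \<Lambda> (T (L0 X))" if "bounded_linear \<Lambda>" for \<Lambda> :: "('v \<Rightarrow>\<^sub>L 'v) \<Rightarrow> real"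
    using dir_functional_rho[OF that dir_L0(1)[OF X]] dir_L0(2)[OF X] by simp
  then show "\<forall>\<Lambda>. bounded_linear \<Lambda> \<longrightarrow> \<Lambda> (T (L0 X)) = X (\<Lambda> \<circ> \<rho>)" by simp
  fix A assume A: "\<forall>\<Lambda>. bounded_linear \<Lambda> \<longrightarrow> \<Lambda> A = X (\<Lambda> \<circ> \<rho>)"
  show "A = T (L0 X)"
  proof (rule ccontr)
    assume "A \<noteq> T (L0 X)"
    then obtain \<Lambda> :: "('v \<Rightarrow>\<^sub>L 'v) \<Rightarrow> real" where \<Lambda>: "bounded_linear \<Lambda>" "\<Lambda> (A - T (L0 X)) \<noteq> 0"
      using separating[of "A - T (L0 X)"] by auto
    then show False
      using A eq[OF \<Lambda>(1)] linear_diff[OF bounded_linear.linear[OF \<Lambda>(1)], of A "T (L0 X)"] by simp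
  qed
qed

lemma rep_differential_inj:
  assumes "X \<in> \<gg>" "Y \<in> \<gg>" "rep_differential \<rho> X = rep_differential \<rho> Y" shows "X = Y"
proof -
  have "T (L0 X - L0 Y) = 0"
    using assms by (simp add: rep_differential_eq linear_diff[OF linear_T])
  then have "L0 X = L0 Y"
    using T_injective[OF subspace_diff[OF subspace_model dir_L0(1) dir_L0(1)]] assms(1,2) by force
  then show ?thesis using dir_L0(2) assms(1,2) by metis
qed

lemma smooth_fun_conj:
  assumes "smooth_fun M f" "g \<in> carrier G" shows "smooth_fun M (\<lambda>x. f (conj_map G g x))"
  by (rule smooth_funI, rule plot_smooth_fun[OF manifold_M assms(1)],
      rule plot_conj[OF plot_constant[OF assms(2)] plot_chart_inverse[OF manifold_M atlas_max_atlas[OF manifold_M]]])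

lemma Ad_apply: "smooth_fun M f \<Longrightarrow> Ad G M g X f = X (\<lambda>x. f (conj_map G g x))"
  by (simp add: Ad_def pushforward_def o_def)

lemma Ad_closed:
  assumes g: "g \<in> carrier G" and X: "X \<in> \<gg>" shows "Ad G M g X \<in> \<gg>"
  unfolding lie_algebra_def tangent_space_def
proof (intro CollectI conjI allI impI)
  interpret group G by (rule group_G)
  have X': "X \<in> tangent_space M \<one>\<^bsub>G\<^esub>" using X by (simp add: lie_algebra_def)
  note XD = tangentD[OF X']
  have one: "conj_map G g \<one>\<^bsub>G\<^esub> = \<one>\<^bsub>G\<^esub>" using g by (simp add: conj_map_def)
  show "Ad G M g X f = 0" if "\<not> smooth_fun M f" for f using that by (simp add: Ad_def pushforward_def)
  show "Ad G M g X (\<lambda>x. f x + k x) = Ad G M g X f + Ad G M g X k" if "smooth_fun M f" "smooth_fun M k" for f k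
    using XD(2)[OF smooth_fun_conj[OF that(1) g] smooth_fun_conj[OF that(2) g]] that
    by (simp add: Ad_apply smooth_fun_add)
  show "Ad G M g X (\<lambda>x. c * f x) = c * Ad G M g X f" if "smooth_fun M f" for c f
    using XD(3)[OF smooth_fun_conj[OF that g]] that
    by (simp add: Ad_apply smooth_fun_linear_compose[OF bounded_linear_mult_right])
  show "Ad G M g X (\<lambda>x. f x * k x) = f \<one>\<^bsub>G\<^esub> * Ad G M g X k + k \<one>\<^bsub>G\<^esub> * Ad G M g X f"
    if "smooth_fun M f" "smooth_fun M k" for f k
    using XD(4)[OF smooth_fun_conj[OF that(1) g] smooth_fun_conj[OF that(2) g]] that
    by (simp add: Ad_apply smooth_fun_mult one)
qed

text \<open>Tested against a functional \<open>\<Lambda>\<close>, both sides become the value of \<open>X\<close> at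
  \<open>\<Lambda> \<circ> \<rho> \<circ> conj_map G g\<close>.\<close>

lemma rep_differential_Ad:
  assumes g: "g \<in> carrier G" and X: "X \<in> \<gg>"
  shows "rep_differential \<rho> (Ad G M g X) = (\<rho> g o\<^sub>L rep_differential \<rho> X o\<^sub>L \<rho> (inv\<^bsub>G\<^esub> g))"
proof (rule ccontr)
  let ?c = "\<lambda>A. \<rho> g o\<^sub>L A o\<^sub>L \<rho> (inv\<^bsub>G\<^esub> g)"
  let ?E = "rep_differential \<rho>"
  have functional: "\<Lambda> (?E Y) = Y (\<Lambda> \<circ> \<rho>)" if "Y \<in> \<gg>" "bounded_linear \<Lambda>" for Y and \<Lambda> :: "('v \<Rightarrow>\<^sub>L 'v) \<Rightarrow> real"
    using dir_functional_rho[OF that(2) dir_L0(1)[OF that(1)]] dir_L0(2)[OF that(1)] rep_differential_eq[OF that(1)]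
    by simp
  assume "?E (Ad G M g X) \<noteq> ?c (?E X)"
  then obtain \<Lambda> :: "('v \<Rightarrow>\<^sub>L 'v) \<Rightarrow> real" where \<Lambda>: "bounded_linear \<Lambda>" "\<Lambda> (?E (Ad G M g X) - ?c (?E X)) \<noteq> 0"
    using separating[of "?E (Ad G M g X) - ?c (?E X)"] by auto
  have blc: "bounded_linear ?c"
    by (rule bounded_linear_compose[OF bounded_bilinear.bounded_linear_left[OF bounded_bilinear_blinfun_compose]
         bounded_bilinear.bounded_linear_right[OF bounded_bilinear_blinfun_compose]])
  have bl: "bounded_linear (\<lambda>A. \<Lambda> (?c A))" by (rule bounded_linear_compose[OF \<Lambda>(1) blc])
  have "\<Lambda> (?E (Ad G M g X)) = X (\<lambda>x. \<Lambda> (\<rho> (conj_map G g x)))"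
    using functional[OF Ad_closed[OF g X] \<Lambda>(1)] Ad_apply[OF functional_rho_smooth[OF \<Lambda>(1)]] by (simp add: o_def)
  also have "\<dots> = X ((\<lambda>A. \<Lambda> (?c A)) \<circ> \<rho>)"
  proof -
    have "dir (L0 X) (\<lambda>x. \<Lambda> (\<rho> (conj_map G g x))) = dir (L0 X) ((\<lambda>A. \<Lambda> (?c A)) \<circ> \<rho>)"
      by (rule dir_cong[OF dir_L0(1)[OF X]]) (simp add: rho_conj g)
    then show ?thesis using dir_L0(2)[OF X] by simp
  qed
  also have "\<dots> = \<Lambda> (?c (?E X))" using functional[OF X bl] by simp
  finally show False using \<Lambda>(2) linear_diff[OF bounded_linear.linear[OF \<Lambda>(1)]] by simp
qed

text \<open>The differential of \<open>\<rho>\<close> has a linear left inverse and turns \<open>Ad g\<close> into conjugation by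
  \<open>\<rho> g\<close>; smoothness of the adjoint action follows from that of \<open>\<rho>\<close>.\<close>

lemma plot_Ad:
  assumes c: "plot M D c" and d: "plot LA D d"
  shows "plot LA D (\<lambda>x. Ad G M (c x) (d x))"
proof -
  have dg: "d x \<in> \<gg>" if "x \<in> D" for x using d that plot_LA_iff by blast
  have cg: "c x \<in> carrier G" if "x \<in> D" for x using plot_carrier[OF c that] .
  obtain R where R: "bounded_linear R" "\<And>x. T (R (T x)) = T x"
    using bounded_pseudo_inverse[OF linear_T separating] by metis
  have PRT: "P (R (T v)) = v" if "v \<in> model M" for v
  proof -
    have "T (P (R (T v)) - v) = 0" using R(2) T_P by (simp add: linear_diff[OF linear_T])
    then have "P (R (T v)) - v = 0" by (rule T_injective[OF subspace_diff[OF subspace_model P(2) that]])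
    then show ?thesis by simp
  qed
  have "smooth_on D (\<lambda>x. T (L0 (d x)))"
    by (rule smooth_on_linear_compose[OF bounded_linear_T]) (use d plot_LA_iff in blast)
  then have "smooth_on D (\<lambda>x. \<rho> (c x) o\<^sub>L T (L0 (d x)) o\<^sub>L \<rho> (inv\<^bsub>G\<^esub> (c x)))"
    by (intro smooth_on_bilinear[OF bounded_bilinear_blinfun_compose] rho_plot c plot_inv)
  then have "smooth_on D (\<lambda>x. P (R (\<rho> (c x) o\<^sub>L T (L0 (d x)) o\<^sub>L \<rho> (inv\<^bsub>G\<^esub> (c x)))))"
    by (rule smooth_on_linear_compose[OF bounded_linear_compose[OF P(1) R(1)]])
  moreover have "P (R (\<rho> (c x) o\<^sub>L T (L0 (d x)) o\<^sub>L \<rho> (inv\<^bsub>G\<^esub> (c x)))) = L0 (Ad G M (c x) (d x))" if "x \<in> D" for x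
  proof -
    have "(\<rho> (c x) o\<^sub>L T (L0 (d x)) o\<^sub>L \<rho> (inv\<^bsub>G\<^esub> (c x))) = T (L0 (Ad G M (c x) (d x)))"
      using rep_differential_Ad[OF cg[OF that] dg[OF that]] rep_differential_eq[OF dg[OF that]]
        rep_differential_eq[OF Ad_closed[OF cg[OF that] dg[OF that]]] by simp
    then show ?thesis using PRT[OF dir_L0(1)[OF Ad_closed[OF cg[OF that] dg[OF that]]]] by simp
  qed
  ultimately have "smooth_on D (\<lambda>x. L0 (Ad G M (c x) (d x)))"
    using smooth_on_cong by (metis (no_types, lifting))
  then show ?thesis using plot_LA_iff Ad_closed cg dg by blast
qed

end

section \<open>Adjoint orbits\<close>

text \<open>In the chart \<open>L0\<close> the differential of \<open>\<rho>\<close> is the linear map \<open>T\<close>, so that the slice theorem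
  applies with \<open>S\<close> the identity.\<close>

theorem (in lie_rep) algebra_components:
  assumes f: "coprime f (pderiv f)"
    and C: "C \<in> connected_components_of (subtopology (mtop (lie_algebra_manifold G M)) (z_algebra G M \<rho> f))"
  shows "closedin (mtop (lie_algebra_manifold G M)) C \<and> embedded_submanifold (lie_algebra_manifold G M) C \<and>
    C \<in> adjoint_orbits G M"
proof -
  interpret group G by (rule group_G)
  obtain U \<phi> Q h P where "lie_rep_chart G M \<rho> U \<phi> Q h P" using chart_at_one .
  then interpret lie_rep_chart G M \<rho> U \<phi> Q h P .
  let ?E = "rep_differential \<rho>"
  have Z: "z_algebra G M \<rho> f = {X \<in> topspace (mtop LA). poly_op f (?E X) = 0}"
    by (simp add: z_algebra_def LA_simps)
  have one: "Ad G M \<one>\<^bsub>G\<^esub> X = X" if "X \<in> \<gg>" for X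
    by (rule rep_differential_inj[OF Ad_closed[OF one_closed that] that])
       (simp add: rep_differential_Ad that rho_one blinfun_compose_simps)
  have mult: "Ad G M (g \<otimes>\<^bsub>G\<^esub> k) X = Ad G M g (Ad G M k X)"
    if "g \<in> carrier G" "k \<in> carrier G" "X \<in> \<gg>" for g k X
    by (rule rep_differential_inj)
       (simp_all add: that Ad_closed rep_differential_Ad rho_mult inv_mult_group blinfun_compose_assoc)
  have cont: "continuous_map (mtop LA) euclidean ?E"
  proof -
    have "continuous_on \<gg> (\<lambda>X. T (L0 X))" by (rule bounded_linear.continuous_on[OF bounded_linear_T continuous_L0])
    then show ?thesis by (simp add: LA_simps rep_differential_eq cong: continuous_on_cong)
  qed
  have "closedin (mtop LA) C \<and> embedded_submanifold LA C \<and> C \<in> orbits G (topspace (mtop LA)) (Ad G M)"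
  proof (rule components_are_orbits[where act = "Ad G M", OF manifold_LA _ _ _ plot_Ad _ _ _ C])
    show "Ad G M g X \<in> topspace (mtop LA)" if "g \<in> carrier G" "X \<in> topspace (mtop LA)" for g X
      using that Ad_closed by (simp add: LA_simps)
    show "Ad G M \<one>\<^bsub>G\<^esub> X = X" if "X \<in> topspace (mtop LA)" for X using one that by (simp add: LA_simps)
    show "Ad G M (g \<otimes>\<^bsub>G\<^esub> k) X = Ad G M g (Ad G M k X)"
      if "g \<in> carrier G" "k \<in> carrier G" "X \<in> topspace (mtop LA)" for g k X
      using mult that by (simp add: LA_simps)
    show "closedin (mtop LA) (z_algebra G M \<rho> f)" unfolding Z by (rule closedin_poly_op_zeros[OF cont])
    show "Ad G M g X \<in> z_algebra G M \<rho> f" if "g \<in> carrier G" "X \<in> z_algebra G M \<rho> f" for g X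
      using that Ad_closed by (auto simp: z_algebra_def rep_differential_Ad intro: poly_op_rho_conj)
  next
    fix p assume "p \<in> z_algebra G M \<rho> f"
    then have p: "p \<in> \<gg>" "poly_op f (?E p) = 0" by (auto simp: z_algebra_def)
    have Lp: "L0 p \<in> model M" by (rule dir_L0(1)[OF p(1)])
    have d: "((\<lambda>x. T x) has_derivative T) (at (L0 p) within model M)"
      by (rule bounded_linear_imp_has_derivative[OF bounded_linear_T])
    have "((\<lambda>x. ?E (inv_into \<gg> L0 x)) has_derivative T) (at (L0 p) within model M)"
      by (rule has_derivative_transform_within[OF d zero_less_one Lp])
         (simp add: L0_inverse rep_differential_eq dir_tangent L0_dir)
    then have d': "((\<lambda>x. ?E (inv_into \<gg> L0 x)) has_derivative (\<lambda>u. T u o\<^sub>L id_blinfun)) (at (L0 p) within L0 ` \<gg>)"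
      by (simp add: L0_image blinfun_compose_simps)
    have id: "id_blinfun o\<^sub>L id_blinfun = id_blinfun" "id_blinfun o\<^sub>L ?E p = ?E p o\<^sub>L id_blinfun"
      by (simp_all add: blinfun_compose_simps)
    obtain V' \<theta> L where "(V', \<theta>) \<in> max_atlas LA" "p \<in> V'" "subspace L" "L \<subseteq> model LA"
      "\<And>v. v \<in> V' \<Longrightarrow> \<theta> v \<in> L \<longleftrightarrow> poly_op f (?E v) = 0"
      "\<And>v. v \<in> V' \<Longrightarrow> poly_op f (?E v) = 0 \<Longrightarrow> \<exists>g\<in>carrier G. v = Ad G M g p"
    proof (rule slice[where E = ?E and act = "Ad G M", OF manifold_LA LA_simps(2) plot_Ad _ _ L0_max_atlas p(1) d' id f p(2)])
      show "Ad G M \<one>\<^bsub>G\<^esub> X = X" if "X \<in> topspace (mtop LA)" for X using one that by (simp add: LA_simps)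
      show "?E (Ad G M g X) = (\<rho> g o\<^sub>L ?E X o\<^sub>L \<rho> (inv\<^bsub>G\<^esub> g))"
        if "g \<in> carrier G" "X \<in> topspace (mtop LA)" for g X
        using rep_differential_Ad that by (simp add: LA_simps)
    qed (assumption | rule that)+
    moreover have "v \<in> z_algebra G M \<rho> f \<longleftrightarrow> poly_op f (?E v) = 0" if "v \<in> V'" for v
      using that local_chartD(2)[OF max_atlas_local_chart[OF calculation(1)]]
      by (auto simp: z_algebra_def LA_simps)
    ultimately show "\<exists>V \<theta> L. (V, \<theta>) \<in> max_atlas LA \<and> p \<in> V \<and> subspace L \<and> L \<subseteq> model LA \<and>
        (\<forall>v\<in>V. \<theta> v \<in> L \<longleftrightarrow> v \<in> z_algebra G M \<rho> f) \<and>
        (\<forall>v\<in>V. v \<in> z_algebra G M \<rho> f \<longrightarrow> (\<exists>g\<in>carrier G. v = Ad G M g p))"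
      by (intro exI[of _ V'] exI[of _ \<theta>] exI[of _ L]) simp
  qed
  then show ?thesis by (simp add: adjoint_orbits_def LA_simps)
qed

theorem theorem1p4:
  fixes G :: "('a, 'm) monoid_scheme"
    and M :: "('a, 'e::euclidean_space) manifold"
    and \<rho> :: "'a \<Rightarrow> ('v::real_normed_vector \<Rightarrow>\<^sub>L 'v)"
    and f :: "real poly"
  assumes "lie_group G M"
    and "connected_space (mtop M)"
    and "\<exists>B :: 'v set. finite B \<and> span B = UNIV"
    and "lie_representation G M \<rho>"
    and "subtopology (mtop M) (kernel G GL \<rho>) = discrete_topology (kernel G GL \<rho>)"
    and "f \<noteq> 0" and "coprime f (pderiv f)"
  shows "(\<forall>C \<in> connected_components_of (subtopology (mtop M) (Z_group G \<rho> f)).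
            closedin (mtop M) C \<and> embedded_submanifold M C \<and> C \<in> conjugacy_classes G)
       \<and> (\<forall>C \<in> connected_components_of
                 (subtopology (mtop (lie_algebra_manifold G M)) (z_algebra G M \<rho> f)).
            closedin (mtop (lie_algebra_manifold G M)) C \<and>
            embedded_submanifold (lie_algebra_manifold G M) C \<and>
            C \<in> adjoint_orbits G M)"
proof -
  interpret lie_rep G M \<rho>
    by (rule lie_rep.intro) (fact assms)+
  show ?thesis using group_components[OF assms(7)] algebra_components[OF assms(7)] by blast
qed

end
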